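(* Let $X,\nu,R,M_p,M_p^*$ be as in the context, with $R\nabla$ closable in $L^p(X,\nu)$ for every $p\in(1,\infty)$, and let $g:X\to\mathbb{R}$ be a Borel function such that, for every $p>1$, $g\in W^{1,p}(X,\nu)$ and $Mg\,\|Mg\|^{-2}\in D(M_p^* )$. For $\varphi\in C_b(X)$ put $F_\varphi(r)=\int_{\{g\le r\}}\varphi\,d\nu$, $r\in\mathbb{R}$. Then $F_\varphi$ is differentiable on $\mathbb{R}$ for every $\varphi\in C_b(X)$, and for every $r\in\mathbb{R}$ there exists a (nonnegative) Borel measure $\sigma_r^g$ on $X$ such that $$F_\varphi'(r)=\int_X\varphi(x)\,\sigma_r^g(dx),\qquad \varphi\in C_b(X).$$ In particular $\sigma_r^g(X)=F_1'(r)=q_1(r)$, where $q_1$ is the continuous density of $\nu\circ g^{-1}$ with respect to Lebesgue measure; therefore $\sigma_r^g$ is nontrivial if and only if $F_1'(r)>0$.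
   Context: $X$ is a separable infinite-dimensional real Hilbert space with inner product $\langle\cdot,\cdot\rangle$ and norm $\|\cdot\|$, and $\nu$ is a non-degenerate Borel probability measure on $X$ (non-degenerate: not concentrated on any proper closed linear subspace). $C_b(X)$ is the space of bounded continuous real functions; $C_b^1(X)$ is the space of bounded continuously Fréchet differentiable $\varphi:X\to\mathbb{R}$ with bounded gradient $\nabla\varphi$. $R\in\mathcal{L}(X)$ is a bounded linear operator such that for every $p\in(1,\infty)$ the operator $\varphi\mapsto R\nabla\varphi$, with domain $C^1_b(X)\subset L^p(X,\nu)$ and values in $L^p(X,\nu;X)$, is closable. $M_p$ denotes its closure, $W^{1,p}(X,\nu)$ the domain of $M_p$, with norm $\|f\|_{W^{1,p}}=\|f\|_{L^p(X,\nu)}+\|M_pf\|_{L^p(X,\nu;X)}$. With $p'=p/(p-1)$, $M_p^*:D(M_p^* )\subset L^{p'}(X,\nu;X)\to L^{p'}(X,\nu)$ is the adjoint: $\int_X\langle M_p\varphi,F\rangle\,d\nu=\int_X\varphi\,M_p^*F\,d\nu$ for $\varphi\in W^{1,p}(X,\nu)$, $F\in D(M_p^* )$. For $q<p$, $W^{1,p}\subset W^{1,q}$ and $M_p=M_q$ on $W^{1,p}$, while $D(M_q^* )\subset D(M_p^* )$ and the adjoints agree on $D(M_q^* )$; one writes $M$ and $M^*$ on $\bigcap_{p>1}W^{1,p}(X,\nu)$ and $\bigcap_{p>1}D(M_p^* )$. The condition on $Mg\,\|Mg\|^{-2}$ includes that it is defined $\nu$-a.e. Under the assumptions on $g$ the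 image measure $\nu\circ g^{-1}$ is absolutely continuous with continuous density $q_1(r)=-\int_{\{g<r\}}M^*\big(Mg\,\|Mg\|^{-2}\big)\,d\nu$. *)

theory Defs
  imports "HOL-Analysis.Analysis" "HOL-Probability.Probability_Measure"
begin

definition infinite_dimensional :: "'a::real_vector itself \<Rightarrow> bool" where
  "infinite_dimensional _ \<longleftrightarrow> (\<nexists>B :: 'a set. finite B \<and> span B = UNIV)"

definition nondegenerate :: "'a::real_normed_vector measure \<Rightarrow> bool" where
  "nondegenerate \<nu> \<longleftrightarrow>
     (\<forall>V. subspace V \<and> closed V \<and> V \<noteq> UNIV \<longrightarrow> \<not> (AE x in \<nu>. x \<in> V))"

definition Cb :: "('a::topological_space \<Rightarrow> real) set" where
  "Cb = {\<phi>. continuous_on UNIV \<phi> \<and> bounded (range \<phi>)}"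

definition grad :: "('a::real_inner \<Rightarrow> real) \<Rightarrow> 'a \<Rightarrow> 'a" where
  "grad \<phi> x = (THE D. GDERIV \<phi> x :> D)"

text \<open>In a Hilbert space, Frechet differentiability of a real function is existence of the
  gradient, and continuity of the gradient in norm is continuity of the derivative in operator
  norm (Riesz).\<close>

definition Cb1 :: "('a::real_inner \<Rightarrow> real) set" where
  "Cb1 = {\<phi>. bounded (range \<phi>) \<and> (\<forall>x. GDERIV \<phi> x :> grad \<phi> x) \<and>
             continuous_on UNIV (grad \<phi>) \<and> bounded (range (grad \<phi>))}"

text \<open>Elements of $L^p$ are represented by Borel functions; all notions below are invariant
  under almost everywhere equality.  Operators are given by their graphs, since the values of the
  closure and of the adjoint are only determined almost everywhere.\<close>

definition Lp :: "'a measure \<Rightarrow> real \<Rightarrow> ('a \<Rightarrow> 'b::{real_normed_vector, second_countable_topology}) set" where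
  "Lp \<nu> p = {f. f \<in> borel_measurable \<nu> \<and> integrable \<nu> (\<lambda>x. norm (f x) powr p)}"

definition Lp_norm :: "'a measure \<Rightarrow> real \<Rightarrow> ('a \<Rightarrow> 'b::real_normed_vector) \<Rightarrow> real" where
  "Lp_norm \<nu> p f = (\<integral>x. norm (f x) powr p \<partial>\<nu>) powr (1 / p)"

definition graph_closure ::
  "'a measure \<Rightarrow> real \<Rightarrow>
   (('a \<Rightarrow> 'b::{real_normed_vector, second_countable_topology}) \<times>
    ('a \<Rightarrow> 'c::{real_normed_vector, second_countable_topology})) set \<Rightarrow>
   (('a \<Rightarrow> 'b) \<times> ('a \<Rightarrow> 'c)) set" where
  "graph_closure \<nu> p T =
     {(f, G). f \<in> Lp \<nu> p \<and> G \<in> Lp \<nu> p \<and>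
        (\<exists>\<phi> \<Psi>. (\<forall>n::nat. (\<phi> n, \<Psi> n) \<in> T \<inter> Lp \<nu> p \<times> Lp \<nu> p) \<and>
               (\<lambda>n. Lp_norm \<nu> p (\<lambda>x. \<phi> n x - f x)) \<longlonglongrightarrow> 0 \<and>
               (\<lambda>n. Lp_norm \<nu> p (\<lambda>x. \<Psi> n x - G x)) \<longlonglongrightarrow> 0)}"

text \<open>An operator is closable if the closure of its graph is again the graph of an operator.\<close>

definition closable_graph ::
  "'a measure \<Rightarrow> real \<Rightarrow>
   (('a \<Rightarrow> 'b::{real_normed_vector, second_countable_topology}) \<times>
    ('a \<Rightarrow> 'c::{real_normed_vector, second_countable_topology})) set \<Rightarrow> bool" where
  "closable_graph \<nu> p T \<longleftrightarrow>
     (\<forall>f G H. (f, G) \<in> graph_closure \<nu> p T \<and> (f, H) \<in> graph_closure \<nu> p T \<longrightarrow>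
              (AE x in \<nu>. G x = H x))"

definition Rgrad :: "('a::real_inner \<Rightarrow> 'a) \<Rightarrow> (('a \<Rightarrow> real) \<times> ('a \<Rightarrow> 'a)) set" where
  "Rgrad R = {(\<phi>, \<lambda>x. R (grad \<phi> x)) | \<phi>. \<phi> \<in> Cb1}"

definition Mp_graph ::
  "'a::{real_inner, second_countable_topology} measure \<Rightarrow> ('a \<Rightarrow> 'a) \<Rightarrow> real \<Rightarrow>
   (('a \<Rightarrow> real) \<times> ('a \<Rightarrow> 'a)) set" where
  "Mp_graph \<nu> R p = graph_closure \<nu> p (Rgrad R)"

definition W1 ::
  "'a::{real_inner, second_countable_topology} measure \<Rightarrow> ('a \<Rightarrow> 'a) \<Rightarrow> real \<Rightarrow>
   ('a \<Rightarrow> real) set" where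
  "W1 \<nu> R p = Domain (Mp_graph \<nu> R p)"

definition Mp ::
  "'a::{real_inner, second_countable_topology} measure \<Rightarrow> ('a \<Rightarrow> 'a) \<Rightarrow> real \<Rightarrow>
   ('a \<Rightarrow> real) \<Rightarrow> 'a \<Rightarrow> 'a" where
  "Mp \<nu> R p f = (SOME G. (f, G) \<in> Mp_graph \<nu> R p)"

definition Mp_adj_graph ::
  "'a::{real_inner, second_countable_topology} measure \<Rightarrow> ('a \<Rightarrow> 'a) \<Rightarrow> real \<Rightarrow>
   (('a \<Rightarrow> 'a) \<times> ('a \<Rightarrow> real)) set" where
  "Mp_adj_graph \<nu> R p =
     {(F, h). F \<in> Lp \<nu> (p / (p - 1)) \<and> h \<in> Lp \<nu> (p / (p - 1)) \<and>
        (\<forall>\<phi> \<in> W1 \<nu> R p. (\<integral>x. inner (Mp \<nu> R p \<phi> x) (F x) \<partial>\<nu>) = (\<integral>x. \<phi> x * h x \<partial>\<nu>))}"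

definition Mp_adj_dom ::
  "'a::{real_inner, second_countable_topology} measure \<Rightarrow> ('a \<Rightarrow> 'a) \<Rightarrow> real \<Rightarrow>
   ('a \<Rightarrow> 'a) set" where
  "Mp_adj_dom \<nu> R p = Domain (Mp_adj_graph \<nu> R p)"

text \<open>The common operators: \<open>M\<close> on the intersection of all \<open>W1 \<nu> R p\<close> and \<open>M\<^sup>*\<close> on the
  intersection of all \<open>Mp_adj_dom \<nu> R p\<close>, as one representative that serves every \<open>p > 1\<close>.\<close>

definition Mop ::
  "'a::{real_inner, second_countable_topology} measure \<Rightarrow> ('a \<Rightarrow> 'a) \<Rightarrow>
   ('a \<Rightarrow> real) \<Rightarrow> 'a \<Rightarrow> 'a" where
  "Mop \<nu> R f = (SOME G. \<forall>p>1. (f, G) \<in> Mp_graph \<nu> R p)"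

definition Mstar ::
  "'a::{real_inner, second_countable_topology} measure \<Rightarrow> ('a \<Rightarrow> 'a) \<Rightarrow>
   ('a \<Rightarrow> 'a) \<Rightarrow> 'a \<Rightarrow> real" where
  "Mstar \<nu> R F = (SOME h. \<forall>p>1. (F, h) \<in> Mp_adj_graph \<nu> R p)"

text \<open>The field $Mg\,\|Mg\|^{-2}$; it takes the value 0 where $Mg$ vanishes, so that $Mg \neq 0$
  almost everywhere has to be required separately.\<close>

definition normal_field ::
  "'a::{real_inner, second_countable_topology} measure \<Rightarrow> ('a \<Rightarrow> 'a) \<Rightarrow>
   ('a \<Rightarrow> real) \<Rightarrow> 'a \<Rightarrow> 'a" where
  "normal_field \<nu> R g x = Mop \<nu> R g x /\<^sub>R (norm (Mop \<nu> R g x))\<^sup>2"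

definition F_int :: "'a measure \<Rightarrow> ('a \<Rightarrow> real) \<Rightarrow> ('a \<Rightarrow> real) \<Rightarrow> real \<Rightarrow> real" where
  "F_int \<nu> g \<phi> r = (\<integral>x \<in> {x. g x \<le> r}. \<phi> x \<partial>\<nu>)"

definition q1 ::
  "'a::{real_inner, second_countable_topology} measure \<Rightarrow> ('a \<Rightarrow> 'a) \<Rightarrow>
   ('a \<Rightarrow> real) \<Rightarrow> real \<Rightarrow> real" where
  "q1 \<nu> R g r = - (\<integral>x \<in> {x. g x < r}. Mstar \<nu> R (normal_field \<nu> R g) x \<partial>\<nu>)"

end

theory Submission
  imports Defs "HOL-Probability.Distribution_Functions"
begin

text \<open>
  Write \<open>\<Psi> = Mg / \<parallel>Mg\<parallel>\<^sup>2\<close>, so that \<open>\<langle>Mg, \<Psi>\<rangle> = 1\<close> almost everywhere.  For \<open>\<phi>\<close> in \<open>Cb1\<close> the chain rule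
  and the adjoint relation give \<open>\<integral> \<theta>'(g) \<phi> d\<nu> = \<integral> \<theta>(g) M\<^sup>*(\<phi> \<Psi>) d\<nu>\<close>, where
  \<open>M\<^sup>*(\<phi> \<Psi>) = \<phi> M\<^sup>*\<Psi> - \<langle>R \<nabla>\<phi>, \<Psi>\<rangle>\<close> (\<open>integration_by_parts\<close>).  Taking for \<open>\<theta>'\<close> the indicator of a
  half-line yields \<open>F_\<phi>(b) = - \<integral> max 0 (b - g) M\<^sup>*(\<phi> \<Psi>) d\<nu>\<close> (\<open>F_int_formula\<close>).  With \<open>\<phi> = 1\<close> the
  right-hand side is Lipschitz in \<open>b\<close>, so level sets of \<open>g\<close> are null sets; then differentiation
  under the integral gives \<open>F_\<phi>'(r) = - \<integral>_{g < r} M\<^sup>*(\<phi> \<Psi>) d\<nu>\<close>.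

  It remains to pass from \<open>Cb1\<close> to all bounded continuous functions.  The map \<open>\<phi> \<mapsto> F_\<phi>'(r)\<close> is
  linear and positive on \<open>Cb1\<close>, but \<open>Cb1\<close> is not uniformly dense in the bounded continuous
  functions, and on a space that is not locally compact a positive functional need not be an
  integral.  What saves the argument is tightness (\<open>level_density_tight\<close>).  There are functions
  \<open>d k\<close> in \<open>Cb1\<close>, smooth substitutes for the truncated distance to the first \<open>k\<close> points of a dense
  sequence, that tend to 0 pointwise and have gradients bounded by 1
  (\<open>soft_distance_to_dense_sequence\<close>).  The difference quotients of \<open>F_\<phi>\<close> at \<open>r\<close> converge
  uniformly over \<open>\<phi>\<close> in a ball of \<open>Cb1\<close> (\<open>quotient_minus_density\<close>), and for a fixed increment
  they tend to 0 along \<open>\<phi> = d k\<close>; hence the derivatives at \<open>r\<close> of \<open>F_{d k}\<close> tend to 0 as well.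
  Thus the functional gives little weight to the complement of a totally bounded set.

  A tight positive functional on \<open>Cb1\<close> is represented by a measure, built from Daniell's outer
  measure by Caratheodory's theorem (locale \<open>positive_functional\<close>); tightness shows that the total
  mass is the value of the functional at 1 (\<open>represent_mass\<close>).  Every continuous \<open>\<phi>\<close> with values in
  \<open>[0, 1]\<close> has inscribed \<open>Cb1\<close> functions whose functional values almost reach its integral
  (\<open>represent_integral_le\<close>).  Since difference quotients are monotone in \<open>\<phi>\<close>, inscribed functions
  for \<open>\<phi>\<close> and for \<open>1 - \<phi>\<close> enclose the quotients of \<open>F_\<phi>\<close> and force them to converge to
  \<open>\<integral> \<phi> d\<sigma>\<close>.
\<close>

section \<open>Calculus in \<open>Cb1\<close>\<close>

lemma GDERIV_unique:
  assumes "GDERIV f x :> D" "GDERIV f x :> E"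
  shows "D = E"
proof -
  have "(\<lambda>h. inner h D) = (\<lambda>h. inner h E)"
    using assms unfolding gderiv_def by (rule has_derivative_unique)
  then have "inner (D - E) D = inner (D - E) E"
    by meson
  then have "inner (D - E) (D - E) = 0"
    by (simp add: inner_diff_right)
  then show ?thesis by simp
qed

lemma grad_eq: "GDERIV f x :> D \<Longrightarrow> grad f x = D"
  unfolding grad_def using GDERIV_unique by blast

lemma GDERIV_continuous: "(\<And>x. GDERIV f x :> D x) \<Longrightarrow> continuous_on UNIV f"
  unfolding gderiv_def continuous_on_eq_continuous_at[OF open_UNIV]
  using has_derivative_continuous by blast

lemma Cb1I:
  assumes "\<And>x. \<bar>f x\<bar> \<le> B" "\<And>x. GDERIV f x :> D x" "continuous_on UNIV D" "\<And>x. norm (D x) \<le> C"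
  shows "f \<in> Cb1" and "grad f = D"
proof -
  show g: "grad f = D"
    using assms(2) grad_eq by blast
  show "f \<in> Cb1"
  proof -
    have "bounded (range f)" "bounded (range D)"
      using assms(1,4) by (auto simp: bounded_iff)
    then show ?thesis
      unfolding Cb1_def mem_Collect_eq g using assms(2,3) by simp
  qed
qed

lemma Cb1D:
  assumes "f \<in> Cb1"
  shows "GDERIV f x :> grad f x" "continuous_on UNIV (grad f)" "continuous_on UNIV f"
    "\<exists>B\<ge>0. \<forall>x. \<bar>f x\<bar> \<le> B" "\<exists>B\<ge>0. \<forall>x. norm (grad f x) \<le> B"
proof -
  show *: "GDERIV f x :> grad f x" for x
    using assms unfolding Cb1_def by blast
  then show "continuous_on UNIV f" by (rule GDERIV_continuous)
  show "continuous_on UNIV (grad f)"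
    using assms unfolding Cb1_def by blast
  have "bounded (range f)" "bounded (range (grad f))"
    using assms unfolding Cb1_def by blast+
  then show "\<exists>B\<ge>0. \<forall>x. \<bar>f x\<bar> \<le> B" "\<exists>B\<ge>0. \<forall>x. norm (grad f x) \<le> B"
    unfolding bounded_pos by (auto intro: less_imp_le)
qed

lemma Cb1_const [simp, intro]: "(\<lambda>_. c) \<in> Cb1" and grad_const: "grad (\<lambda>_. c) = (\<lambda>_. 0)"
  by (rule Cb1I[of _ "\<bar>c\<bar>" "\<lambda>_. 0" 0]; simp add: GDERIV_const del: gderiv_deriv)+

lemma
  assumes "f \<in> Cb1" "h \<in> Cb1"
  shows Cb1_add: "(\<lambda>x. f x + h x) \<in> Cb1"
    and grad_add: "grad (\<lambda>x. f x + h x) = (\<lambda>x. grad f x + grad h x)"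
proof -
  obtain B C B' C' where b: "\<And>x. \<bar>f x\<bar> \<le> B" "\<And>x. norm (grad f x) \<le> C"
    "\<And>x. \<bar>h x\<bar> \<le> B'" "\<And>x. norm (grad h x) \<le> C'"
    using Cb1D(4,5)[OF assms(1)] Cb1D(4,5)[OF assms(2)] by blast
  have 1: "\<bar>f x + h x\<bar> \<le> B + B'" for x
    using b(1)[of x] b(3)[of x] by linarith
  have 2: "norm (grad f x + grad h x) \<le> C + C'" for x
    using b(2)[of x] b(4)[of x] norm_triangle_ineq[of "grad f x" "grad h x"] by linarith
  note * = Cb1I[of "\<lambda>x. f x + h x" "B + B'" "\<lambda>x. grad f x + grad h x" "C + C'"]
  show "(\<lambda>x. f x + h x) \<in> Cb1" "grad (\<lambda>x. f x + h x) = (\<lambda>x. grad f x + grad h x)"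
    by (intro *[OF 1 _ _ 2] GDERIV_add Cb1D assms continuous_on_add)+
qed

lemma
  assumes "f \<in> Cb1" "h \<in> Cb1"
  shows Cb1_mult: "(\<lambda>x. f x * h x) \<in> Cb1"
    and grad_mult: "grad (\<lambda>x. f x * h x) = (\<lambda>x. f x *\<^sub>R grad h x + h x *\<^sub>R grad f x)"
proof -
  obtain B C B' C' where b: "\<And>x. \<bar>f x\<bar> \<le> B" "\<And>x. norm (grad f x) \<le> C"
    "\<And>x. \<bar>h x\<bar> \<le> B'" "\<And>x. norm (grad h x) \<le> C'" and B: "0 \<le> B" "0 \<le> B'"
    using Cb1D(4,5)[OF assms(1)] Cb1D(4,5)[OF assms(2)] by blast
  have 1: "\<bar>f x * h x\<bar> \<le> B * B'" for x
    using mult_mono[OF b(1)[of x] b(3)[of x]] B by (simp add: abs_mult)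
  have 2: "norm (f x *\<^sub>R grad h x + h x *\<^sub>R grad f x) \<le> B * C' + B' * C" for x
  proof -
    have "norm (f x *\<^sub>R grad h x) \<le> B * C'" "norm (h x *\<^sub>R grad f x) \<le> B' * C"
      using mult_mono[OF b(1)[of x] b(4)[of x]] mult_mono[OF b(3)[of x] b(2)[of x]] B by simp_all
    then show ?thesis
      using norm_triangle_ineq[of "f x *\<^sub>R grad h x" "h x *\<^sub>R grad f x"] by linarith
  qed
  note * = Cb1I[of "\<lambda>x. f x * h x" "B * B'" "\<lambda>x. f x *\<^sub>R grad h x + h x *\<^sub>R grad f x" "B * C' + B' * C"]
  show "(\<lambda>x. f x * h x) \<in> Cb1"
    "grad (\<lambda>x. f x * h x) = (\<lambda>x. f x *\<^sub>R grad h x + h x *\<^sub>R grad f x)"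
    by (intro *[OF 1 _ _ 2] GDERIV_mult Cb1D assms continuous_on_add continuous_on_scaleR)+
qed

lemma
  fixes f :: "'a::real_inner \<Rightarrow> real"
  assumes f: "f \<in> Cb1" and K: "compact K" "range f \<subseteq> K"
    and T: "\<And>y. y \<in> K \<Longrightarrow> DERIV T y :> T' y" and T': "continuous_on K T'"
  shows Cb1_compose: "(\<lambda>x. T (f x)) \<in> Cb1"
    and grad_compose: "grad (\<lambda>x. T (f x)) = (\<lambda>x. T' (f x) *\<^sub>R grad f x)"
proof -
  have fK: "f x \<in> K" for x using K by auto
  have "continuous_on K T"
    using T by (meson DERIV_isCont continuous_at_imp_continuous_on)
  then have "bounded (T ` K)" "bounded (T' ` K)"
    using K(1) T' by (auto intro: compact_imp_bounded compact_continuous_image)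
  then obtain B B' where b: "\<And>y. y \<in> K \<Longrightarrow> \<bar>T y\<bar> \<le> B" "\<And>y. y \<in> K \<Longrightarrow> \<bar>T' y\<bar> \<le> B'"
    unfolding bounded_iff by auto
  obtain C where C: "\<And>x. norm (grad f x) \<le> C"
    using Cb1D(5)[OF f] by blast
  have 1: "\<bar>T (f x)\<bar> \<le> B" for x using b(1) fK by blast
  have 2: "norm (T' (f x) *\<^sub>R grad f x) \<le> B' * C" for x
    using mult_mono[OF b(2)[OF fK[of x]] C[of x]]
      order_trans[OF abs_ge_zero b(2)[OF fK[of x]]] by simp
  have 3: "continuous_on UNIV (\<lambda>x. T' (f x))"
    by (rule continuous_on_compose2[OF T' Cb1D(3)[OF f] K(2)])
  note * = Cb1I[of "\<lambda>x. T (f x)" B "\<lambda>x. T' (f x) *\<^sub>R grad f x" "B' * C"]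
  show "(\<lambda>x. T (f x)) \<in> Cb1" "grad (\<lambda>x. T (f x)) = (\<lambda>x. T' (f x) *\<^sub>R grad f x)"
    by (intro *[OF 1 _ _ 2] GDERIV_DERIV_compose Cb1D f T fK continuous_on_scaleR 3)+
qed

lemma Cb1_compose_UNIV:
  assumes f: "f \<in> Cb1" and T: "\<And>y. DERIV T y :> T' y" and T': "continuous_on UNIV T'"
  shows "(\<lambda>x. T (f x)) \<in> Cb1" "grad (\<lambda>x. T (f x)) = (\<lambda>x. T' (f x) *\<^sub>R grad f x)"
proof -
  obtain B where "\<And>x. \<bar>f x\<bar> \<le> B" using Cb1D(4)[OF f] by blast
  then have r: "range f \<subseteq> {-B..B}" by (auto simp: abs_le_iff minus_le_iff)
  have c: "continuous_on {-B..B} T'" using T' by (rule continuous_on_subset) simp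
  show "(\<lambda>x. T (f x)) \<in> Cb1" "grad (\<lambda>x. T (f x)) = (\<lambda>x. T' (f x) *\<^sub>R grad f x)"
    by (rule Cb1_compose[OF f compact_Icc r T c] grad_compose[OF f compact_Icc r T c])+
qed

lemma Cb1_cmult: "f \<in> Cb1 \<Longrightarrow> (\<lambda>x. c * f x) \<in> Cb1"
  by (intro Cb1_mult Cb1_const)

lemma grad_cmult: "f \<in> Cb1 \<Longrightarrow> grad (\<lambda>x. c * f x) = (\<lambda>x. c *\<^sub>R grad f x)"
  by (subst grad_mult) (simp_all add: grad_const)

lemma Cb1_diff: "f \<in> Cb1 \<Longrightarrow> h \<in> Cb1 \<Longrightarrow> (\<lambda>x. f x - h x) \<in> Cb1"
  using Cb1_add[OF _ Cb1_cmult[of h "-1"], of f] by simp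

lemma Cb1_sum: "(\<And>i. i \<in> I \<Longrightarrow> f i \<in> Cb1) \<Longrightarrow> (\<lambda>x. \<Sum>i\<in>I. f i x) \<in> Cb1"
  by (induction I rule: infinite_finite_induct) (auto intro: Cb1_add)

lemma grad_sum:
  "(\<And>i. i \<in> I \<Longrightarrow> f i \<in> Cb1) \<Longrightarrow> grad (\<lambda>x. \<Sum>i\<in>I. f i x) = (\<lambda>x. \<Sum>i\<in>I. grad (f i) x)"
  by (induction I rule: infinite_finite_induct) (auto simp: grad_const grad_add Cb1_sum)

lemma Cb1_subset_Cb: "f \<in> Cb1 \<Longrightarrow> f \<in> Cb"
  using Cb1D(3) unfolding Cb_def Cb1_def by blast

text \<open>The half square of the positive part is the cut-off from which the bumps and ramps below are
  assembled: it is continuously differentiable although \<open>max 0\<close> is not.\<close>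

lemma DERIV_half_square_pos: "DERIV (\<lambda>y::real. (max 0 y)\<^sup>2 / 2) y :> max 0 y"
proof (cases y "0::real" rule: linorder_cases)
  case less
  have "DERIV (\<lambda>y::real. 0) y :> 0" by simp
  then show ?thesis
    using has_field_derivative_transform_within_open[of "\<lambda>y. 0" 0 y "{..<0}"
        "\<lambda>y::real. (max 0 y)\<^sup>2 / 2"] less by (auto simp: max_def)
next
  case equal
  have "((\<lambda>h. (max 0 h)\<^sup>2 / 2 / h) \<longlongrightarrow> 0) (at (0::real))"
  proof (rule Lim_null_comparison)
    show "\<forall>\<^sub>F h in at 0. norm ((max 0 h)\<^sup>2 / 2 / h) \<le> \<bar>h\<bar>"
      by (intro always_eventually) (auto simp: max_def power2_eq_square)
    show "((\<lambda>h::real. \<bar>h\<bar>) \<longlongrightarrow> 0) (at 0)"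
      by (intro tendsto_eq_intros) auto
  qed
  then show ?thesis
    using equal by (simp add: DERIV_def)
next
  case greater
  have "DERIV (\<lambda>y::real. y\<^sup>2 / 2) y :> y"
    by (auto intro!: derivative_eq_intros)
  then have "DERIV (\<lambda>y::real. (max 0 y)\<^sup>2 / 2) y :> y"
    by (rule has_field_derivative_transform_within_open[where S = "{0<..}"])
      (use greater in \<open>auto simp: max_def\<close>)
  then show ?thesis using greater by (simp add: max_def)
qed

lemma GDERIV_dist_square: "GDERIV (\<lambda>x::'a::real_inner. (norm (x - a))\<^sup>2) x :> 2 *\<^sub>R (x - a)"
proof -
  have "((\<lambda>x. inner (x - a) (x - a)) has_derivative (\<lambda>h. inner (x - a) h + inner h (x - a))) (at x)"
    by (auto intro!: derivative_eq_intros)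
  then show ?thesis
    unfolding gderiv_def power2_norm_eq_inner
    by (rule has_derivative_eq_rhs) (auto simp: inner_commute)
qed

text \<open>Composing the half square cut-off with \<open>\<rho>\<^sup>2 - (norm (x - a))\<^sup>2\<close> gives a gradient that vanishes
  outside the ball and is therefore bounded.\<close>

lemma ball_bump:
  fixes a :: "'a::real_inner"
  assumes "\<rho> > 0"
  shows "\<exists>\<psi>\<in>Cb1. (\<forall>x. 0 \<le> \<psi> x) \<and> {x. 0 < \<psi> x} = ball a \<rho>"
proof -
  define \<psi> where "\<psi> x = (max 0 (\<rho>\<^sup>2 - (norm (x - a))\<^sup>2))\<^sup>2 / 2" for x
  define D where "D x = max 0 (\<rho>\<^sup>2 - (norm (x - a))\<^sup>2) *\<^sub>R (- (2 *\<^sub>R (x - a)))" for x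
  have d: "GDERIV \<psi> x :> D x" for x
    unfolding \<psi>_def D_def
    by (rule GDERIV_DERIV_compose[OF _ DERIV_half_square_pos, of "\<lambda>x. \<rho>\<^sup>2 - (norm (x - a))\<^sup>2"])
      (rule GDERIV_subst[OF GDERIV_diff[OF GDERIV_const GDERIV_dist_square]], simp)
  have 1: "\<bar>\<psi> x\<bar> \<le> (\<rho>\<^sup>2)\<^sup>2 / 2" for x
  proof -
    have "(max 0 (\<rho>\<^sup>2 - (norm (x - a))\<^sup>2))\<^sup>2 \<le> (\<rho>\<^sup>2)\<^sup>2"
      by (rule power_mono) auto
    then show ?thesis unfolding \<psi>_def by simp
  qed
  have 2: "norm (D x) \<le> \<rho>\<^sup>2 * (2 * \<rho>)" for x
  proof (cases "norm (x - a) \<le> \<rho>")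
    case True
    then have "\<bar>max 0 (\<rho>\<^sup>2 - (norm (x - a))\<^sup>2)\<bar> \<le> \<rho>\<^sup>2" by auto
    then have "\<bar>max 0 (\<rho>\<^sup>2 - (norm (x - a))\<^sup>2)\<bar> * (2 * norm (x - a)) \<le> \<rho>\<^sup>2 * (2 * \<rho>)"
      using True by (intro mult_mono) auto
    then show ?thesis by (simp add: D_def norm_minus_commute)
  next
    case False
    then have "\<rho>\<^sup>2 \<le> (norm (x - a))\<^sup>2" using assms by (intro power_mono) auto
    then show ?thesis using assms by (simp add: D_def max_def)
  qed
  have c: "continuous_on UNIV D"
    unfolding D_def by (intro continuous_intros)
  have "0 < \<psi> x \<longleftrightarrow> x \<in> ball a \<rho>" for x
  proof -
    have "0 < \<psi> x \<longleftrightarrow> (norm (x - a))\<^sup>2 < \<rho>\<^sup>2"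
      by (auto simp: \<psi>_def max_def)
    also have "\<dots> \<longleftrightarrow> norm (x - a) < \<rho>"
      using assms power_strict_mono[of "norm (x - a)" \<rho> 2]
        power2_less_imp_less[of "norm (x - a)" \<rho>] by auto
    finally show ?thesis by (simp add: dist_norm norm_minus_commute)
  qed
  moreover have "0 \<le> \<psi> x" for x by (simp add: \<psi>_def)
  ultimately show ?thesis
    using Cb1I(1)[OF 1 d c 2] by blast
qed

section \<open>Approximation by \<open>Cb1\<close> functions\<close>

text \<open>Separability makes an open set a countable union of balls, hence the increasing union of
  the positivity sets of the partial sums \<open>s k\<close> of ball bumps; \<open>k s / (1 + k s)\<close> turns these
  sums into functions with values in \<open>[0, 1)\<close> that increase to the indicator.\<close>

lemma open_indicator_approx:
  fixes U :: "'a::{real_inner, second_countable_topology} set"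
  assumes "open U"
  obtains \<theta> :: "nat \<Rightarrow> 'a \<Rightarrow> real" where
    "\<And>k. \<theta> k \<in> Cb1" "\<And>x. \<theta> 0 x = 0" "\<And>k x. 0 \<le> \<theta> k x" "\<And>k x. \<theta> k x \<le> 1"
    "\<And>k x. \<theta> k x \<le> \<theta> (Suc k) x" "\<And>k x. x \<notin> U \<Longrightarrow> \<theta> k x = 0"
    "\<And>x. (\<lambda>k. \<theta> k x) \<longlonglongrightarrow> indicator U x"
proof -
  have "\<exists>\<psi> :: nat \<Rightarrow> 'a \<Rightarrow> real.
    (\<forall>i. \<psi> i \<in> Cb1) \<and> (\<forall>i x. 0 \<le> \<psi> i x) \<and> (\<forall>x. x \<in> U \<longleftrightarrow> (\<exists>i. 0 < \<psi> i x))"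
  proof (cases "U = {}")
    case True
    then show ?thesis by (intro exI[of _ "\<lambda>_ _. 0"]) auto
  next
    case False
    define B where "B = {ball a \<rho> | a \<rho>. \<rho> > 0 \<and> ball a \<rho> \<subseteq> U}"
    have UB: "\<Union>B = U"
    proof
      show "U \<subseteq> \<Union>B"
      proof
        fix x assume "x \<in> U"
        then obtain e where "e > 0" "ball x e \<subseteq> U" using assms openE by blast
        then have "ball x e \<in> B" "x \<in> ball x e" by (auto simp: B_def)
        then show "x \<in> \<Union>B" by blast
      qed
    qed (auto simp: B_def)
    obtain B' where B': "B' \<subseteq> B" "countable B'" "\<Union>B' = \<Union>B"
      using Lindelof[of B] unfolding B_def by blast
    have ne: "B' \<noteq> {}" using B' UB False by auto
    have "\<exists>\<psi>\<in>Cb1. (\<forall>x. 0 \<le> \<psi> x) \<and> {x. 0 < \<psi> x} = S" if "S \<in> B'" for S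
      using that B'(1) ball_bump unfolding B_def by blast
    then obtain \<psi> where \<psi>: "\<And>S. S \<in> B' \<Longrightarrow> \<psi> S \<in> Cb1" "\<And>S x. S \<in> B' \<Longrightarrow> 0 \<le> \<psi> S x"
      "\<And>S. S \<in> B' \<Longrightarrow> {x. 0 < \<psi> S x} = S"
      by metis
    have "x \<in> U \<longleftrightarrow> (\<exists>i. 0 < \<psi> (from_nat_into B' i) x)" for x
    proof -
      have "x \<in> U \<longleftrightarrow> (\<exists>S\<in>B'. 0 < \<psi> S x)"
        using \<psi>(3) B'(3) UB by blast
      also have "\<dots> \<longleftrightarrow> (\<exists>S\<in>range (from_nat_into B'). 0 < \<psi> S x)"
        by (simp add: range_from_nat_into[OF ne B'(2)])
      finally show ?thesis by auto
    qed
    then show ?thesis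
      using \<psi>(1,2) from_nat_into[OF ne]
      by (intro exI[of _ "\<lambda>i. \<psi> (from_nat_into B' i)"]) auto
  qed
  then obtain \<psi> :: "nat \<Rightarrow> 'a \<Rightarrow> real" where \<psi>: "\<And>i. \<psi> i \<in> Cb1" "\<And>i x. 0 \<le> \<psi> i x"
      "\<And>x. x \<in> U \<longleftrightarrow> (\<exists>i. 0 < \<psi> i x)"
    by blast
  define s where "s k x = real k * (\<Sum>i<k. \<psi> i x)" for k x
  have sC: "s k \<in> Cb1" for k
    unfolding s_def[abs_def] by (intro Cb1_cmult Cb1_sum \<psi>)
  have s0: "0 \<le> s k x" for k x
    unfolding s_def by (intro mult_nonneg_nonneg sum_nonneg \<psi>) simp
  have smono: "s k x \<le> s (Suc k) x" for k x
    unfolding s_def by (intro mult_mono) (auto intro!: sum_nonneg \<psi>)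
  define \<theta> where "\<theta> k x = s k x / (1 + s k x)" for k x
  show ?thesis
  proof (rule that[of \<theta>])
    show "\<theta> k \<in> Cb1" for k
    proof -
      obtain B where B: "\<And>x. \<bar>s k x\<bar> \<le> B" using Cb1D(4)[OF sC] by blast
      have "range (s k) \<subseteq> {0..B}" using B s0 by (auto simp: abs_le_iff)
      moreover have "DERIV (\<lambda>y. y / (1 + y)) y :> (inverse (1 + y))\<^sup>2" if "y \<in> {0..B}" for y
      proof -
        have "1 + y \<noteq> 0" using that by auto
        then show ?thesis
          by (auto intro!: derivative_eq_intros simp: power2_eq_square inverse_eq_divide)
      qed
      moreover have "continuous_on {0..B} (\<lambda>y. (inverse (1 + y))\<^sup>2)"
        by (intro continuous_intros) auto
      ultimately show ?thesis
        unfolding \<theta>_def[abs_def] by (rule Cb1_compose[OF sC compact_Icc])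
    qed
    show "\<theta> 0 x = 0" for x by (simp add: \<theta>_def s_def)
    show "0 \<le> \<theta> k x" for k x using s0[of k x] by (simp add: \<theta>_def)
    show "\<theta> k x \<le> 1" for k x using s0[of k x] by (simp add: \<theta>_def)
    show "\<theta> k x \<le> \<theta> (Suc k) x" for k x
      using s0[of k x] smono[of k x] by (simp add: \<theta>_def field_simps)
    show z: "\<theta> k x = 0" if "x \<notin> U" for k x
    proof -
      have "\<psi> i x = 0" for i
        using that \<psi>(2)[of i x] \<psi>(3)[of x] by (metis not_less order.antisym)
      then show ?thesis by (simp add: \<theta>_def s_def)
    qed
    show "(\<lambda>k. \<theta> k x) \<longlonglongrightarrow> indicator U x" for x
    proof (cases "x \<in> U")
      case False
      then show ?thesis using z by simp
    next
      case True
      then obtain j where j: "0 < \<psi> j x" using \<psi>(3) by blast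
      have "real k * \<psi> j x \<le> s k x" if "k \<ge> Suc j" for k
        unfolding s_def using that \<psi>(2)
        by (intro mult_left_mono member_le_sum) auto
      then have "\<forall>\<^sub>F k in sequentially. real k * \<psi> j x \<le> s k x"
        unfolding eventually_sequentially by blast
      moreover have "filterlim (\<lambda>k. real k * \<psi> j x) at_top sequentially"
        by (rule filterlim_tendsto_pos_mult_at_top[OF tendsto_const j filterlim_real_sequentially,
              THEN filterlim_cong[THEN iffD1, rotated -1]]) (auto simp: mult.commute)
      ultimately have "filterlim (\<lambda>k. s k x) at_top sequentially"
        by (rule filterlim_at_top_mono[rotated])
      then have "filterlim (\<lambda>k. 1 + s k x) at_top sequentially"
        by (rule filterlim_tendsto_add_at_top[OF tendsto_const])
      then have "(\<lambda>k. 1 - inverse (1 + s k x)) \<longlonglongrightarrow> 1 - 0"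
        by (intro tendsto_diff tendsto_const tendsto_inverse_0_at_top)
      moreover have "1 - inverse (1 + s k x) = \<theta> k x" for k
        using s0[of k x] by (simp add: \<theta>_def field_simps)
      ultimately show ?thesis using True by simp
    qed
  qed
qed

text \<open>The smooth bounded gauge \<open>n / (1 + n)\<close>, \<open>n = (norm (x - a))\<^sup>2\<close>, is comparable with the
  squared distance from \<open>a\<close> near \<open>a\<close>.\<close>

lemma bounded_gauge:
  fixes a :: "'a::real_inner"
  defines "b \<equiv> \<lambda>x. (norm (x - a))\<^sup>2 / (1 + (norm (x - a))\<^sup>2)"
  shows "b \<in> Cb1" "norm (grad b x) \<le> 1" "0 \<le> b x" "b x \<le> 1" "b x \<le> (norm (x - a))\<^sup>2"
    "b x < t \<Longrightarrow> t \<le> 1/2 \<Longrightarrow> x \<in> ball a (sqrt (2 * t))"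
proof -
  define D where "D x = (1 / (1 + (norm (x - a))\<^sup>2)\<^sup>2) *\<^sub>R (2 *\<^sub>R (x - a))" for x
  have pos: "1 + (norm (x - a))\<^sup>2 > 0" for x
    by (simp add: add_pos_nonneg)
  have d: "GDERIV b x :> D x" for x
    unfolding b_def D_def
    by (rule GDERIV_DERIV_compose[OF GDERIV_dist_square, where g = "\<lambda>y. y / (1 + y)"])
      (use pos[of x] in \<open>auto intro!: derivative_eq_intros simp: power2_eq_square field_simps\<close>)
  have D1: "norm (D x) \<le> 1" for x
  proof -
    define n where "n = norm (x - a)"
    have "0 \<le> (1 - n)\<^sup>2" by simp
    then have "2 * n \<le> 1 + n\<^sup>2" by (simp add: power2_eq_square algebra_simps)
    also have "\<dots> \<le> (1 + n\<^sup>2)\<^sup>2"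
      using mult_left_mono[of 1 "1 + n\<^sup>2" "1 + n\<^sup>2"] by (simp add: power2_eq_square[of "1 + n\<^sup>2"])
    finally show ?thesis
      using pos[of x] by (simp add: D_def n_def)
  qed
  have c: "continuous_on UNIV D"
    unfolding D_def using pos by (intro continuous_intros) (auto simp: less_imp_neq[symmetric] add_nonneg_eq_0_iff)
  show b0: "0 \<le> b x" for x unfolding b_def by simp
  show b1: "b x \<le> 1" for x unfolding b_def using pos[of x] by simp
  have B: "\<bar>b x\<bar> \<le> 1" for x using b0[of x] b1[of x] by simp
  show "b \<in> Cb1" "norm (grad b x) \<le> 1"
    using Cb1I[OF B d c D1] D1 by auto
  show "b x \<le> (norm (x - a))\<^sup>2"
    unfolding b_def using pos[of x] by (simp add: field_simps)
  assume t: "b x < t" "t \<le> 1/2"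
  define n where "n = (norm (x - a))\<^sup>2"
  have n: "0 \<le> n" "n < t * (1 + n)"
    using t pos[of x] by (simp_all add: n_def b_def field_simps)
  moreover have "t * (1 + n) \<le> t + n / 2"
    using mult_right_mono[OF t(2) n(1)] by (simp add: algebra_simps)
  ultimately have "(norm (x - a))\<^sup>2 < 2 * t" unfolding n_def by linarith
  then have "norm (x - a) < sqrt (2 * t)" by (rule real_less_rsqrt)
  then show "x \<in> ball a (sqrt (2 * t))" by (simp add: dist_norm norm_minus_commute)
qed

text \<open>Smooth substitutes for the truncated distance to the first \<open>m\<close> points of a dense sequence.
  A minimum of gauges is not differentiable; the normalised logarithm of exponential means is,
  and its gradient is a convex combination of the gradients of the gauges, so that it keeps the
  bound 1 however many points are used.  The price is an error \<open>ln m / m\<close>.\<close>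

lemma soft_distance_to_dense_sequence:
  obtains d :: "nat \<Rightarrow> 'a::{real_inner, second_countable_topology} \<Rightarrow> real" where
    "\<And>m. d m \<in> Cb1" "\<And>m x. 0 \<le> d m x" "\<And>m x. d m x \<le> 1" "\<And>m x. norm (grad (d m) x) \<le> 1"
    "\<And>x. (\<lambda>m. d m x) \<longlonglongrightarrow> 0"
    "\<And>m t. t \<le> 1/2 \<Longrightarrow> \<exists>F. finite F \<and> {x. d m x < t} \<subseteq> (\<Union>a\<in>F. ball a (sqrt (2 * t)))"
proof -
  obtain Q :: "'a set" where Q: "countable Q" "\<And>X. open X \<Longrightarrow> X \<noteq> {} \<Longrightarrow> \<exists>q\<in>Q. q \<in> X"
    using countable_dense_setE by blast
  have "Q \<noteq> {}" using Q(2)[of UNIV] by auto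
  then have rQ: "range (from_nat_into Q) = Q" using Q(1) by (rule range_from_nat_into)
  define b where "b i x = (norm (x - from_nat_into Q i))\<^sup>2 / (1 + (norm (x - from_nat_into Q i))\<^sup>2)"
    for i :: nat and x
  have b: "b i \<in> Cb1" "norm (grad (b i) x) \<le> 1" "0 \<le> b i x" "b i x \<le> 1"
    "b i x \<le> (norm (x - from_nat_into Q i))\<^sup>2"
    "b i x < t \<Longrightarrow> t \<le> 1/2 \<Longrightarrow> x \<in> ball (from_nat_into Q i) (sqrt (2 * t))" for i x t
    unfolding b_def[abs_def] by (fact bounded_gauge)+
  define M where "M m = real (Suc m)" for m
  have M: "M m > 0" for m by (simp add: M_def)
  define E where "E m i x = exp (- M m * b i x)" for m i x
  define Z where "Z m x = (\<Sum>i<Suc m. E m i x)" for m x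
  define d where "d m x = - ln (Z m x / M m) / M m" for m x
  have EC: "E m i \<in> Cb1" and gE: "grad (E m i) = (\<lambda>x. (- M m * E m i x) *\<^sub>R grad (b i) x)" for m i
  proof -
    have D: "DERIV (\<lambda>y. exp (- M m * y)) y :> - M m * exp (- M m * y)" for y
      by (auto intro!: derivative_eq_intros)
    have c: "continuous_on UNIV (\<lambda>y. - M m * exp (- M m * y))"
      by (intro continuous_intros)
    show "E m i \<in> Cb1" "grad (E m i) = (\<lambda>x. (- M m * E m i x) *\<^sub>R grad (b i) x)"
      using Cb1_compose_UNIV[OF b(1) D c, of i] by (simp_all add: E_def[abs_def])
  qed
  have E0: "0 < E m i x" for m i x by (simp add: E_def)
  have E1: "E m i x \<le> 1" for m i x
    using b(3)[of i x] M[of m] by (simp add: E_def mult_nonneg_nonneg less_imp_le)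
  have El: "exp (- M m) \<le> E m i x" for m i x
    using mult_left_mono[OF b(4)[of i x], of "M m"] M[of m] by (simp add: E_def)
  have ZE: "E m i x \<le> Z m x" if "i \<le> m" for m i x
    unfolding Z_def using that E0 by (intro member_le_sum) (auto intro: less_imp_le)
  have Z0: "0 < Z m x" for m x using ZE[of 0 m x] E0[of m 0 x] by linarith
  have Z1: "Z m x / M m \<le> 1" for m x
  proof -
    have "Z m x \<le> (\<Sum>i<Suc m. 1)"
      unfolding Z_def by (intro sum_mono E1)
    then show ?thesis using M[of m] by (simp add: M_def)
  qed
  have Zl: "exp (- M m) \<le> Z m x / M m" for m x
  proof -
    have "(\<Sum>i<Suc m. exp (- M m)) \<le> Z m x"
      unfolding Z_def by (intro sum_mono El)
    then have "M m * exp (- M m) \<le> Z m x" by (simp add: M_def algebra_simps)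
    then show ?thesis using M[of m] by (simp add: field_simps)
  qed
  have ZC: "Z m \<in> Cb1" for m
    unfolding Z_def[abs_def] by (intro Cb1_sum EC)
  have gZ: "grad (Z m) x = (\<Sum>i<Suc m. (- M m * E m i x) *\<^sub>R grad (b i) x)" for m x
    unfolding Z_def[abs_def] by (subst grad_sum) (simp_all only: EC gE)
  have r: "range (Z m) \<subseteq> {M m * exp (- M m) .. M m}" for m
    using Zl[of m] Z1[of m] M[of m] by (auto simp: field_simps)
  have y_pos: "y > 0" if "y \<in> {M m * exp (- M m) .. M m}" for m y
    using that less_le_trans[OF mult_pos_pos[OF M[of m] exp_gt_zero[of "- M m"]]] by simp
  have T: "DERIV (\<lambda>y. - ln (y / M m) / M m) y :> - 1 / (M m * y)"
    if "y \<in> {M m * exp (- M m) .. M m}" for m y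
  proof -
    have "y > 0" using y_pos[OF that] .
    then show ?thesis
      using M[of m] by (auto intro!: derivative_eq_intros simp: field_simps)
  qed
  have T': "continuous_on {M m * exp (- M m) .. M m} (\<lambda>y. - 1 / (M m * y))" for m
  proof (intro continuous_intros ballI)
    fix y assume "y \<in> {M m * exp (- M m) .. M m}"
    then show "M m * y \<noteq> 0" using y_pos[of y m] M[of m] by force
  qed
  have dC: "d m \<in> Cb1" for m
    unfolding d_def[abs_def] by (rule Cb1_compose[OF ZC compact_Icc r T T'])
  have gd: "grad (d m) x = (- 1 / (M m * Z m x)) *\<^sub>R grad (Z m) x" for m x
    using fun_cong[OF grad_compose[OF ZC compact_Icc r T T', of m], of x]
    by (simp add: d_def[abs_def])
  have d0: "0 \<le> d m x" for m x
  proof -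
    have "ln (Z m x / M m) \<le> 0"
      using Z1[of m x] Z0[of m x] M[of m] by simp
    then show ?thesis
      using M[of m] unfolding d_def by (intro divide_nonneg_pos) auto
  qed
  have d_le: "d m x \<le> b i x + ln (M m) / M m" if "i \<le> m" for i m x
  proof -
    have "- M m * b i x \<le> ln (Z m x)"
      using ZE[OF that, of x] Z0[of m x] by (simp add: E_def ln_ge_iff)
    then have "- ln (Z m x / M m) \<le> M m * b i x + ln (M m)"
      using Z0[of m x] M[of m] by (simp add: ln_div)
    then show ?thesis
      using M[of m] by (simp add: d_def field_simps)
  qed
  show ?thesis
  proof (rule that[OF dC])
    fix m x
    show "0 \<le> d m x"
      by (rule d0)
    have "- M m \<le> ln (Z m x / M m)"
      using Zl[of m x] Z0[of m x] M[of m] by (simp add: ln_ge_iff)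
    then show "d m x \<le> 1"
      using M[of m] by (simp add: d_def field_simps)
    have "norm (grad (Z m) x) \<le> (\<Sum>i<Suc m. M m * E m i x)"
      unfolding gZ
    proof (rule sum_norm_le)
      fix i
      have "norm ((- M m * E m i x) *\<^sub>R grad (b i) x) = (M m * E m i x) * norm (grad (b i) x)"
        using M[of m] E0[of m i x] by (simp add: abs_mult)
      also have "\<dots> \<le> (M m * E m i x) * 1"
        using M[of m] E0[of m i x] b(2) by (intro mult_left_mono) auto
      finally show "norm ((- M m * E m i x) *\<^sub>R grad (b i) x) \<le> M m * E m i x" by simp
    qed
    also have "\<dots> = M m * Z m x" by (simp only: Z_def sum_distrib_left)
    finally show "norm (grad (d m) x) \<le> 1"
      using M[of m] Z0[of m x] by (simp add: gd abs_mult field_simps)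
  next
    fix x
    show "(\<lambda>m. d m x) \<longlonglongrightarrow> 0"
    proof (rule LIMSEQ_I)
      fix e :: real assume e: "e > 0"
      obtain i where i: "norm (x - from_nat_into Q i) < sqrt (e/2)"
        using Q(2)[of "ball x (sqrt (e/2))"] e rQ by (force simp: dist_norm)
      have "b i x \<le> (norm (x - from_nat_into Q i))\<^sup>2" by (rule b(5))
      also have "\<dots> < (sqrt (e/2))\<^sup>2" using i by (intro power_strict_mono) auto
      finally have bi: "b i x < e/2" using e by simp
      have "(\<lambda>m. ln (M m) / M m) \<longlonglongrightarrow> 0"
        unfolding M_def by (rule LIMSEQ_Suc[OF lim_ln_over_n])
      then obtain N where N: "\<And>m. m \<ge> N \<Longrightarrow> \<bar>ln (M m) / M m\<bar> < e/2"
        using LIMSEQ_D[of _ 0 "e/2"] e by force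
      have "norm (d m x - 0) < e" if "m \<ge> max N i" for m
      proof -
        have "d m x \<le> b i x + ln (M m) / M m" using that by (intro d_le) simp
        moreover note d0[of m x]
        moreover have "ln (M m) / M m < e/2"
          using N[of m] that abs_ge_self[of "ln (M m) / M m"] by linarith
        ultimately have "\<bar>d m x\<bar> < e" using bi by linarith
        then show ?thesis by simp
      qed
      then show "\<exists>no. \<forall>n\<ge>no. norm (d n x - 0) < e" by blast
    qed
  next
    fix m and t :: real assume t: "t \<le> 1/2"
    have "{x. d m x < t} \<subseteq> (\<Union>a\<in>from_nat_into Q ` {..m}. ball a (sqrt (2 * t)))"
    proof
      fix x assume "x \<in> {x. d m x < t}"
      then have x: "d m x < t" by simp
      have "\<exists>i\<le>m. b i x < t"
      proof (rule ccontr)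
        assume "\<not> ?thesis"
        then have "E m i x \<le> exp (- M m * t)" if "i < Suc m" for i
          using that M[of m] by (auto simp: E_def not_less)
        then have "Z m x \<le> (\<Sum>i<Suc m. exp (- M m * t))"
          unfolding Z_def by (intro sum_mono) auto
        then have "Z m x / M m \<le> exp (- M m * t)"
          using M[of m] by (simp add: M_def field_simps)
        then have "ln (Z m x / M m) \<le> - M m * t"
          using Z0[of m x] M[of m] by (metis divide_pos_pos ln_exp ln_mono exp_gt_zero)
        then have "t \<le> d m x" using M[of m] by (simp add: d_def field_simps)
        then show False using x by simp
      qed
      then show "x \<in> (\<Union>a\<in>from_nat_into Q ` {..m}. ball a (sqrt (2 * t)))"
        using b(6) t by blast
    qed
    then show "\<exists>F. finite F \<and> {x. d m x < t} \<subseteq> (\<Union>a\<in>F. ball a (sqrt (2 * t)))"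
      by blast
  qed
qed

section \<open>Representation of tight positive functionals on \<open>Cb1\<close>\<close>

locale positive_functional =
  fixes L :: "('a::{real_inner, banach, second_countable_topology} \<Rightarrow> real) \<Rightarrow> real"
  assumes L_add: "f \<in> Cb1 \<Longrightarrow> h \<in> Cb1 \<Longrightarrow> L (\<lambda>x. f x + h x) = L f + L h"
    and L_cmult: "f \<in> Cb1 \<Longrightarrow> L (\<lambda>x. c * f x) = c * L f"
    and L_nonneg: "f \<in> Cb1 \<Longrightarrow> (\<And>x. 0 \<le> f x) \<Longrightarrow> 0 \<le> L f"
begin

lemma L_diff: "f \<in> Cb1 \<Longrightarrow> h \<in> Cb1 \<Longrightarrow> L (\<lambda>x. f x - h x) = L f - L h"
  using L_add[of f "\<lambda>x. -1 * h x"] L_cmult[of h "-1"] Cb1_cmult[of h "-1"] by simp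

lemma L_mono: "f \<in> Cb1 \<Longrightarrow> h \<in> Cb1 \<Longrightarrow> (\<And>x. f x \<le> h x) \<Longrightarrow> L f \<le> L h"
  using L_nonneg[of "\<lambda>x. h x - f x"] L_diff[of h f] Cb1_diff[of h f] by simp

lemma L_zero: "L (\<lambda>_. 0) = 0"
  using L_cmult[of "\<lambda>_. 0" 0] by simp

lemma L_sum: "(\<And>i. i \<in> I \<Longrightarrow> f i \<in> Cb1) \<Longrightarrow> L (\<lambda>x. \<Sum>i\<in>I. f i x) = (\<Sum>i\<in>I. L (f i))"
  by (induction I rule: infinite_finite_induct) (auto simp: L_zero L_add Cb1_sum)

text \<open>Covers of sets by functions take the place of covers by sets: \<open>outer\<close> is the upper integral
  of the indicator in Daniell's construction, with \<open>Cb1\<close> as class of elementary functions.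
  Daniell's lattice operations are replaced by products, under which \<open>Cb1\<close> is closed.\<close>

definition cover :: "'a set \<Rightarrow> (nat \<Rightarrow> 'a \<Rightarrow> real) \<Rightarrow> bool" where
  "cover A \<phi> \<longleftrightarrow> (\<forall>n. \<phi> n \<in> Cb1) \<and> (\<forall>n x. 0 \<le> \<phi> n x) \<and> (\<forall>x\<in>A. 1 \<le> (\<Sum>n. ennreal (\<phi> n x)))"

definition outer :: "'a set \<Rightarrow> ennreal" where
  "outer A = (INF \<phi>\<in>Collect (cover A). \<Sum>n. ennreal (L (\<phi> n)))"

lemma coverD:
  assumes "cover A \<phi>"
  shows "\<phi> n \<in> Cb1" "0 \<le> \<phi> n x" "0 \<le> L (\<phi> n)" "x \<in> A \<Longrightarrow> 1 \<le> (\<Sum>n. ennreal (\<phi> n x))"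
  using assms L_nonneg unfolding cover_def by blast+

lemma outer_le: "cover A \<phi> \<Longrightarrow> outer A \<le> (\<Sum>n. ennreal (L (\<phi> n)))"
  unfolding outer_def by (rule INF_lower) simp

lemma outer_mono: "A \<subseteq> B \<Longrightarrow> outer A \<le> outer B"
  unfolding outer_def by (rule INF_superset_mono) (unfold cover_def, blast+)

lemma outer_le_L:
  assumes "f \<in> Cb1" "\<And>x. 0 \<le> f x" "\<And>x. x \<in> A \<Longrightarrow> 1 \<le> f x"
  shows "outer A \<le> ennreal (L f)"
proof -
  have "cover A (\<lambda>n. if n = 0 then f else (\<lambda>_. 0))"
  proof -
    have "(\<Sum>n. ennreal ((if n = (0::nat) then f else (\<lambda>_. 0)) x)) = ennreal (f x)" for x
      by (subst suminf_finite[of "{0}"]) auto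
    then show ?thesis using assms by (auto simp: cover_def)
  qed
  from outer_le[OF this] show ?thesis
    by (subst (asm) suminf_finite[of "{0}"]) (auto simp: L_zero)
qed

lemma outer_empty: "outer {} = 0"
  using outer_le_L[of "\<lambda>_. 0" "{}"] by (simp add: L_zero)

lemma outer_finite: "outer A < top"
  using outer_le_L[of "\<lambda>_. 1" A] by (simp add: le_less_trans)

lemma outer_close: "outer A < c \<Longrightarrow> \<exists>\<phi>. cover A \<phi> \<and> (\<Sum>n. ennreal (L (\<phi> n))) < c"
  unfolding outer_def INF_less_iff by auto

lemma outer_countably_subadditive: "outer (\<Union>i. A i) \<le> (\<Sum>i. outer (A i))"
proof (rule ennreal_le_epsilon)
  fix e :: real assume e: "0 < e"
  have *: "outer (A i) < outer (A i) + ennreal (e * (1/2)^Suc i)" for i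
    using e outer_finite[of "A i"] by (simp add: ennreal_zero_less_mult_iff less_top[symmetric])
  obtain \<phi> where \<phi>: "\<And>i. cover (A i) (\<phi> i)"
    and le: "\<And>i. (\<Sum>n. ennreal (L (\<phi> i n))) \<le> outer (A i) + ennreal (e * (1/2)^Suc i)"
    using outer_close[OF *] by (metis less_imp_le)
  define \<psi> where "\<psi> k = \<phi> (fst (prod_decode k)) (snd (prod_decode k))" for k
  have "cover (\<Union>i. A i) \<psi>"
    unfolding cover_def
  proof (intro conjI allI ballI)
    show "\<psi> k \<in> Cb1" "0 \<le> \<psi> k x" for k x
      unfolding \<psi>_def by (rule coverD[OF \<phi>])+
    fix x assume "x \<in> (\<Union>i. A i)"
    then obtain i where "x \<in> A i" by blast
    then have "1 \<le> (\<Sum>n. ennreal (\<phi> i n x))" using coverD(4)[OF \<phi>] by blast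
    also have "\<dots> = (\<Sum>j\<in>{i}. (\<Sum>n. ennreal (\<phi> j n x)))" by simp
    also have "\<dots> \<le> (\<Sum>j. \<Sum>n. ennreal (\<phi> j n x))"
      by (rule sum_le_suminf) auto
    also have "\<dots> = (\<Sum>k. ennreal (\<psi> k x))"
      unfolding \<psi>_def
      by (subst suminf_ennreal_2dimen[where f = "\<lambda>p. ennreal (\<phi> (fst p) (snd p) x)", symmetric]) auto
    finally show "1 \<le> (\<Sum>k. ennreal (\<psi> k x))" .
  qed
  then have "outer (\<Union>i. A i) \<le> (\<Sum>k. ennreal (L (\<psi> k)))" by (rule outer_le)
  also have "\<dots> = (\<Sum>i. \<Sum>n. ennreal (L (\<phi> i n)))"
    unfolding \<psi>_def
    by (subst suminf_ennreal_2dimen[where f = "\<lambda>p. ennreal (L (\<phi> (fst p) (snd p)))", symmetric]) auto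
  also have "\<dots> \<le> (\<Sum>i. outer (A i) + ennreal (e * (1/2)^Suc i))"
    by (intro suminf_le le summableI)
  also have "\<dots> = (\<Sum>i. outer (A i)) + (\<Sum>i. ennreal (e * (1/2)^Suc i))"
    by (rule suminf_add[symmetric]) auto
  also have "(\<Sum>i. ennreal (e * (1/2)^Suc i)) = ennreal e"
    using sums_mult[OF power_half_series, of e] e by (intro suminf_ennreal_eq) auto
  finally show "outer (\<Union>i. A i) \<le> (\<Sum>i. outer (A i)) + ennreal e" .
qed

lemma outer_measure_space_outer: "outer_measure_space (Pow UNIV) outer"
  unfolding outer_measure_space_def positive_def increasing_def countably_subadditive_def
  using outer_empty outer_mono outer_countably_subadditive by simp

text \<open>A cover \<open>\<phi>\<close> of \<open>A\<close> is split by the functions \<open>\<theta> k\<close> increasing to the indicator of \<open>U\<close>: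
  \<open>\<phi> (1 - \<theta> k)\<close> covers \<open>A - U\<close> for each \<open>k\<close>, and the increments \<open>\<phi> (\<theta> (k + 1) - \<theta> k)\<close>
  together cover \<open>A \<inter> U\<close> at a cost that is the supremum of the costs of \<open>\<phi> (\<theta> k)\<close>.\<close>

lemma open_in_lambda_system:
  assumes "open U"
  shows "U \<in> lambda_system UNIV (Pow UNIV) outer"
proof -
  obtain \<theta> :: "nat \<Rightarrow> 'a \<Rightarrow> real" where \<theta>:
    "\<And>k. \<theta> k \<in> Cb1" "\<And>x. \<theta> 0 x = 0" "\<And>k x. 0 \<le> \<theta> k x" "\<And>k x. \<theta> k x \<le> 1"
    "\<And>k x. \<theta> k x \<le> \<theta> (Suc k) x" "\<And>k x. x \<notin> U \<Longrightarrow> \<theta> k x = 0"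
    "\<And>x. (\<lambda>k. \<theta> k x) \<longlonglongrightarrow> indicator U x"
    using open_indicator_approx[OF assms] by blast
  have split: "outer (A \<inter> U) + outer (A - U) \<le> (\<Sum>n. ennreal (L (\<phi> n)))" if c: "cover A \<phi>" for A \<phi>
  proof -
    note \<phi> = coverD[OF c]
    define a where "a n k = L (\<lambda>x. \<phi> n x * \<theta> k x)" for n k
    define \<delta> where "\<delta> n k x = \<phi> n x * (\<theta> (Suc k) x - \<theta> k x)" for n k x
    have C: "(\<lambda>x. \<phi> n x * \<theta> k x) \<in> Cb1" for n k by (intro Cb1_mult \<phi> \<theta>)
    have \<delta>C: "\<delta> n k \<in> Cb1" and \<delta>0: "0 \<le> \<delta> n k x" for n k x
      unfolding \<delta>_def[abs_def] using \<phi> \<theta> by (auto intro!: Cb1_mult Cb1_diff)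
    have L\<delta>: "L (\<delta> n k) = a n (Suc k) - a n k" for n k
      using L_diff[OF C[of n "Suc k"] C[of n k]]
      by (simp add: \<delta>_def[abs_def] a_def right_diff_distrib)
    have a0: "a n 0 = 0" for n using \<theta>(2) by (simp add: a_def L_zero)
    have a_nn: "0 \<le> a n k" for n k
      unfolding a_def using \<phi> \<theta> by (intro L_nonneg C) auto
    have a_mono: "a n k \<le> a n (Suc k)" for n k
      using L_nonneg[OF \<delta>C \<delta>0, of n k] L\<delta>[of n k] by simp
    have inc: "incseq (\<lambda>k. ennreal (a n k))" for n
      by (intro incseq_SucI ennreal_leI a_mono)
    have U: "outer (A \<inter> U) \<le> (SUP k. \<Sum>n. ennreal (a n k))"
    proof -
      define \<psi> where "\<psi> i = \<delta> (fst (prod_decode i)) (snd (prod_decode i))" for i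
      have "cover (A \<inter> U) \<psi>"
        unfolding cover_def
      proof (intro conjI allI ballI)
        show "\<psi> i \<in> Cb1" "0 \<le> \<psi> i x" for i x
          using \<delta>C \<delta>0 by (simp_all add: \<psi>_def)
        fix x assume x: "x \<in> A \<inter> U"
        have "(\<lambda>k. \<theta> (Suc k) x - \<theta> k x) sums (1 - \<theta> 0 x)"
          using \<theta>(7)[of x] x by (intro telescope_sums) simp
        then have "(\<lambda>k. \<delta> n k x) sums \<phi> n x" for n
          using sums_mult[of _ _ "\<phi> n x"] \<theta>(2) by (force simp: \<delta>_def)
        then have "(\<Sum>k. ennreal (\<delta> n k x)) = ennreal (\<phi> n x)" for n
          using \<delta>0 by (intro suminf_ennreal_eq)
        then have "(\<Sum>i. ennreal (\<psi> i x)) = (\<Sum>n. ennreal (\<phi> n x))"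
          unfolding \<psi>_def
          by (subst suminf_ennreal_2dimen[where f = "\<lambda>p. ennreal (\<delta> (fst p) (snd p) x)" and
                g = "\<lambda>n. ennreal (\<phi> n x)"]) auto
        then show "1 \<le> (\<Sum>i. ennreal (\<psi> i x))" using \<phi>(4) x by simp
      qed
      then have "outer (A \<inter> U) \<le> (\<Sum>i. ennreal (L (\<psi> i)))" by (rule outer_le)
      also have "\<dots> = (\<Sum>n. \<Sum>k. ennreal (L (\<delta> n k)))"
        unfolding \<psi>_def
        by (subst suminf_ennreal_2dimen[where f = "\<lambda>p. ennreal (L (\<delta> (fst p) (snd p)))", symmetric]) auto
      also have "\<dots> = (\<Sum>n. SUP k. ennreal (a n k))"
      proof (intro suminf_cong)
        fix n
        have "(\<Sum>k<K. ennreal (L (\<delta> n k))) = ennreal (a n K)" for K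
        proof -
          have "(\<Sum>k<K. ennreal (L (\<delta> n k))) = ennreal (\<Sum>k<K. a n (Suc k) - a n k)"
            unfolding L\<delta> using a_mono by (intro sum_ennreal) simp
          then show ?thesis by (simp add: sum_lessThan_telescope a0)
        qed
        then show "(\<Sum>k. ennreal (L (\<delta> n k))) = (SUP k. ennreal (a n k))"
          by (simp add: suminf_eq_SUP)
      qed
      also have "\<dots> = (SUP k. \<Sum>n. ennreal (a n k))"
        by (rule ennreal_suminf_SUP_eq[OF inc])
      finally show ?thesis .
    qed
    have "(\<Sum>n. ennreal (a n k)) + outer (A - U) \<le> (\<Sum>n. ennreal (L (\<phi> n)))" for k
    proof -
      define \<psi> where "\<psi> n x = \<phi> n x * (1 - \<theta> k x)" for n x
      have \<psi>C: "\<psi> n \<in> Cb1" for n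
        unfolding \<psi>_def[abs_def] using \<phi> \<theta> by (intro Cb1_mult Cb1_diff) auto
      have \<psi>0: "0 \<le> \<psi> n x" for n x unfolding \<psi>_def using \<phi> \<theta> by simp
      have "cover (A - U) \<psi>"
        unfolding cover_def using \<psi>C \<psi>0 \<phi>(4) \<theta>(6) by (auto simp: \<psi>_def)
      then have "(\<Sum>n. ennreal (a n k)) + outer (A - U)
          \<le> (\<Sum>n. ennreal (a n k)) + (\<Sum>n. ennreal (L (\<psi> n)))"
        by (intro add_left_mono outer_le)
      also have "\<dots> = (\<Sum>n. ennreal (a n k) + ennreal (L (\<psi> n)))"
        by (rule suminf_add) auto
      also have "\<dots> = (\<Sum>n. ennreal (L (\<phi> n)))"
      proof (intro suminf_cong)
        fix n
        have "L (\<psi> n) = L (\<phi> n) - a n k"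
          using L_diff[OF \<phi>(1) C, of n n k] by (simp add: \<psi>_def[abs_def] a_def right_diff_distrib)
        moreover have "0 \<le> L (\<psi> n)" by (rule L_nonneg[OF \<psi>C \<psi>0])
        ultimately show "ennreal (a n k) + ennreal (L (\<psi> n)) = ennreal (L (\<phi> n))"
          using a_nn by (simp add: ennreal_plus[symmetric] del: ennreal_plus)
      qed
      finally show ?thesis .
    qed
    then have "(SUP k. (\<Sum>n. ennreal (a n k)) + outer (A - U)) \<le> (\<Sum>n. ennreal (L (\<phi> n)))"
      by (intro SUP_least)
    then have "(SUP k. \<Sum>n. ennreal (a n k)) + outer (A - U) \<le> (\<Sum>n. ennreal (L (\<phi> n)))"
      by (simp add: ennreal_SUP_add_left)
    then show ?thesis using add_right_mono[OF U] order_trans by blast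
  qed
  have "outer (U \<inter> A) + outer ((UNIV - U) \<inter> A) = outer A" for A
  proof (rule antisym)
    have "outer (A \<inter> U) + outer (A - U) \<le> outer A"
      by (subst outer_def[of A], rule INF_greatest) (simp add: split)
    then show "outer (U \<inter> A) + outer ((UNIV - U) \<inter> A) \<le> outer A"
      by (simp add: Int_commute Diff_eq)
    have "outer (\<Union>i. if i = (0::nat) then U \<inter> A else if i = 1 then (UNIV - U) \<inter> A else {})
      \<le> (\<Sum>i. outer (if i = (0::nat) then U \<inter> A else if i = 1 then (UNIV - U) \<inter> A else {}))"
      by (rule outer_countably_subadditive)
    also have "\<dots> = outer (U \<inter> A) + outer ((UNIV - U) \<inter> A)"
      by (subst suminf_finite[of "{0, 1}"]) (auto simp: outer_empty)
    finally show "outer A \<le> outer (U \<inter> A) + outer ((UNIV - U) \<inter> A)"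
      by (rule order_trans[rotated]) (rule outer_mono, auto split: if_splits)
  qed
  then show ?thesis by (simp add: lambda_system_def)
qed

definition represent :: "'a measure" where
  "represent = measure_of UNIV (sets borel) outer"

lemma sets_represent [simp]: "sets represent = sets borel"
  and space_represent [simp]: "space represent = UNIV"
  using sets.sets_measure_of_eq[of borel] sets.space_measure_of_eq[of borel]
  by (simp_all add: represent_def)

lemma emeasure_represent:
  assumes "A \<in> sets borel"
  shows "emeasure represent A = outer A"
proof -
  interpret P: sigma_algebra UNIV "Pow UNIV :: 'a set set" by (rule sigma_algebra_Pow)
  let ?S = "lambda_system UNIV (Pow UNIV) outer"
  have ms: "measure_space UNIV ?S outer"
    by (rule P.caratheodory_lemma[OF outer_measure_space_outer])
  then interpret S: sigma_algebra UNIV ?S by (simp add: measure_space_def)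
  have sub: "sets borel \<subseteq> ?S"
  proof -
    have "sigma_sets UNIV {U. open U} \<subseteq> ?S"
      using open_in_lambda_system by (intro S.sigma_sets_subset) auto
    then show ?thesis by (simp add: borel_def)
  qed
  have ca: "countably_additive (sets borel) outer"
    using ms sub unfolding measure_space_def countably_additive_def by blast
  have "positive (sets borel) outer" by (simp add: positive_def outer_empty)
  from emeasure_measure_of_sigma[OF _ this ca assms] show ?thesis
    using sets.sigma_algebra_axioms[of borel] by (simp add: represent_def)
qed

sublocale represent: finite_measure represent
  using outer_finite by (intro finite_measureI) (simp add: emeasure_represent less_top[symmetric])

lemma measure_represent_UNIV_le: "measure represent UNIV \<le> L (\<lambda>_. 1)"
  using outer_le_L[of "\<lambda>_. 1" UNIV] L_nonneg[of "\<lambda>_. 1"]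
  by (simp add: represent.emeasure_eq_measure[symmetric] emeasure_represent
      flip: ennreal_le_iff)

text \<open>The increments of the functions increasing to the indicator of \<open>U\<close> form a cover of \<open>U\<close> whose
  partial costs are the values of the functional at those functions.\<close>

lemma represent_open_le:
  assumes "open U" "e > 0"
  shows "\<exists>\<theta>\<in>Cb1. (\<forall>x. 0 \<le> \<theta> x \<and> \<theta> x \<le> indicator U x) \<and> measure represent U \<le> L \<theta> + e"
proof -
  obtain \<theta> :: "nat \<Rightarrow> 'a \<Rightarrow> real" where \<theta>:
    "\<And>k. \<theta> k \<in> Cb1" "\<And>x. \<theta> 0 x = 0" "\<And>k x. 0 \<le> \<theta> k x" "\<And>k x. \<theta> k x \<le> 1"
    "\<And>k x. \<theta> k x \<le> \<theta> (Suc k) x" "\<And>k x. x \<notin> U \<Longrightarrow> \<theta> k x = 0"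
    "\<And>x. (\<lambda>k. \<theta> k x) \<longlonglongrightarrow> indicator U x"
    using open_indicator_approx[OF assms(1)] by blast
  define \<delta> where "\<delta> k x = \<theta> (Suc k) x - \<theta> k x" for k x
  have \<delta>C: "\<delta> k \<in> Cb1" and \<delta>0: "0 \<le> \<delta> k x" and L\<delta>: "L (\<delta> k) = L (\<theta> (Suc k)) - L (\<theta> k)" for k x
    unfolding \<delta>_def[abs_def] using \<theta> by (auto intro!: Cb1_diff L_diff)
  have "cover U \<delta>"
    unfolding cover_def
  proof (intro conjI allI ballI \<delta>C \<delta>0)
    fix x assume "x \<in> U"
    then have "(\<lambda>k. \<delta> k x) sums (1 - \<theta> 0 x)"
      using \<theta>(7)[of x] unfolding \<delta>_def by (intro telescope_sums) simp
    then show "1 \<le> (\<Sum>k. ennreal (\<delta> k x))"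
      using \<delta>0 \<theta>(2) by (subst suminf_ennreal_eq[of _ 1]) auto
  qed
  then have le: "ennreal (measure represent U) \<le> (\<Sum>k. ennreal (L (\<delta> k)))"
    using assms(1) outer_le by (simp add: represent.emeasure_eq_measure[symmetric] emeasure_represent)
  have part: "(\<Sum>k<K. ennreal (L (\<delta> k))) = ennreal (L (\<theta> K))" for K
  proof -
    have "\<theta> 0 = (\<lambda>_. 0)" using \<theta>(2) by blast
    then have "(\<Sum>k<K. L (\<delta> k)) = L (\<theta> K)"
      using sum_lessThan_telescope[of "\<lambda>k. L (\<theta> k)" K] by (simp add: L\<delta> L_zero)
    then show ?thesis using L_nonneg[OF \<delta>C \<delta>0] by (simp add: sum_ennreal)
  qed
  have "\<exists>K. measure represent U \<le> L (\<theta> K) + e"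
  proof (rule ccontr)
    assume "\<not> ?thesis"
    then have less: "L (\<theta> K) \<le> measure represent U - e" for K
      by (simp add: not_le less_imp_le less_diff_eq)
    moreover have "0 \<le> L (\<theta> 0)" using \<theta> by (intro L_nonneg)
    ultimately have nn: "0 \<le> measure represent U - e" using order_trans by blast
    have "(\<Sum>k. ennreal (L (\<delta> k))) \<le> ennreal (measure represent U - e)"
      unfolding suminf_eq_SUP part using less by (intro SUP_least ennreal_leI)
    with le have "ennreal (measure represent U) \<le> ennreal (measure represent U - e)"
      by (rule order_trans)
    then show False using nn assms(2) by (simp add: ennreal_le_iff)
  qed
  moreover have "\<theta> k x \<le> indicator U x" for k x
    using \<theta>(4,6) by (simp add: indicator_def)
  ultimately show ?thesis using \<theta>(1,3) by blast
qed

end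

text \<open>The number of levels \<open>k / N\<close> lying strictly below \<open>y\<close> determines \<open>y\<close> up to \<open>1 / N\<close>.\<close>

lemma layer_count:
  assumes "0 \<le> y" "y \<le> 1" "0 < N"
  shows "(\<Sum>k=1..N. indicator {z. real k / N < z} y) \<le> N * y"
    and "N * y \<le> 1 + (\<Sum>k=1..N. indicator {z::real. real k / N < z} y)"
proof -
  define z where "z = N * y"
  have z: "0 \<le> z" "z \<le> N" using assms by (auto simp: z_def mult_left_le)
  have "(\<Sum>k=1..N. indicator {z. real k / N < z} y :: real) = (\<Sum>k\<in>{1..N} \<inter> {k. real k < z}. 1)"
    unfolding sum.inter_restrict[OF finite_atLeastAtMost]
    using assms(3) by (intro sum.cong) (auto simp: indicator_def z_def field_simps)
  also have "{1..N} \<inter> {k. real k < z} = {1..<nat \<lceil>z\<rceil>}"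
    using z by (auto simp: zless_nat_eq_int_zless less_ceiling_iff) 
  finally have *: "(\<Sum>k=1..N. indicator {z. real k / N < z} y) = real (nat \<lceil>z\<rceil> - 1)" by simp
  show "(\<Sum>k=1..N. indicator {z. real k / N < z} y) \<le> N * y"
    "N * y \<le> 1 + (\<Sum>k=1..N. indicator {z::real. real k / N < z} y)"
    unfolding * z_def[symmetric] using z by linarith+
qed

context positive_functional
begin

text \<open>Superlevel sets of \<open>\<phi>\<close> are open, so that each layer \<open>{\<phi> > k / N}\<close> can be replaced by an
  inscribed function; the mean of the layers is within \<open>1 / N\<close> of \<open>\<phi>\<close>.\<close>

lemma represent_integral_le:
  assumes \<phi>: "continuous_on UNIV \<phi>" "\<And>x. 0 \<le> \<phi> x" "\<And>x. \<phi> x \<le> 1" and e: "e > 0"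
  shows "\<exists>\<psi>\<in>Cb1. (\<forall>x. 0 \<le> \<psi> x \<and> \<psi> x \<le> \<phi> x) \<and> (\<integral>x. \<phi> x \<partial>represent) \<le> L \<psi> + e"
proof -
  let ?\<sigma> = represent
  obtain N :: nat where N: "0 < N" "measure ?\<sigma> UNIV / N < e / 2"
  proof -
    obtain n :: nat where "measure ?\<sigma> UNIV / (e/2) < real n"
      using reals_Archimedean2 by blast
    then show ?thesis using e that[of "Suc n"] by (auto simp: field_simps)
  qed
  define U where "U k = {x. real k / N < \<phi> x}" for k
  have opU: "open (U k)" for k
    unfolding U_def using \<phi>(1) by (intro open_Collect_less) auto
  then have "\<forall>k. \<exists>\<theta>\<in>Cb1. (\<forall>x. 0 \<le> \<theta> x \<and> \<theta> x \<le> indicator (U k) x) \<and> measure ?\<sigma> (U k) \<le> L \<theta> + e / 2"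
    using e represent_open_le by simp
  then obtain \<theta> where \<theta>: "\<And>k. \<theta> k \<in> Cb1" "\<And>k x. 0 \<le> \<theta> k x" "\<And>k x. \<theta> k x \<le> indicator (U k) x"
    "\<And>k. measure ?\<sigma> (U k) \<le> L (\<theta> k) + e / 2"
    by metis
  define \<psi> where "\<psi> x = (1 / N) * (\<Sum>k=1..N. \<theta> k x)" for x
  have C: "\<psi> \<in> Cb1" unfolding \<psi>_def[abs_def] by (intro Cb1_cmult Cb1_sum \<theta>)
  have ind: "indicator (U k) x = (indicator {z. real k / N < z} (\<phi> x) :: real)" for k x
    by (simp add: U_def indicator_def)
  have "\<psi> x \<le> \<phi> x" for x
  proof -
    have "(\<Sum>k=1..N. \<theta> k x) \<le> (\<Sum>k=1..N. indicator {z. real k / N < z} (\<phi> x))"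
      using \<theta>(3) by (intro sum_mono) (simp add: ind[symmetric])
    also have "\<dots> \<le> N * \<phi> x" by (rule layer_count[OF \<phi>(2,3) N(1)])
    finally show ?thesis using N(1) by (simp add: \<psi>_def field_simps)
  qed
  moreover have "0 \<le> \<psi> x" for x
    unfolding \<psi>_def by (intro mult_nonneg_nonneg sum_nonneg \<theta>) simp
  moreover have "(\<integral>x. \<phi> x \<partial>?\<sigma>) \<le> L \<psi> + e"
  proof -
    have [measurable]: "U k \<in> sets borel" for k using opU by simp
    have m\<phi>: "\<phi> \<in> borel_measurable ?\<sigma>"
      using borel_measurable_continuous_onI[OF \<phi>(1)] by (simp add: measurable_cong_sets[OF sets_represent refl])
    have int: "integrable ?\<sigma> (\<lambda>x. 1 / N * (1 + (\<Sum>k=1..N. indicator (U k) x)) :: real)"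
      by (intro integrable_mult_right Bochner_Integration.integrable_add Bochner_Integration.integrable_sum)
        (auto simp: represent.emeasure_finite less_top[symmetric])
    have "(\<integral>x. \<phi> x \<partial>?\<sigma>) \<le> (\<integral>x. 1 / N * (1 + (\<Sum>k=1..N. indicator (U k) x)) \<partial>?\<sigma>)"
    proof (rule integral_mono[OF _ int])
      show "integrable ?\<sigma> \<phi>"
        using \<phi>(2,3) by (intro represent.integrable_const_bound[of _ 1] m\<phi>) auto
      show "\<phi> x \<le> 1 / N * (1 + (\<Sum>k=1..N. indicator (U k) x))" for x
        using layer_count(2)[OF \<phi>(2,3) N(1), of x] N(1) by (simp add: ind field_simps)
    qed
    also have "\<dots> = 1 / N * (measure ?\<sigma> UNIV + (\<Sum>k=1..N. measure ?\<sigma> (U k)))"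
      by (subst integral_mult_right_zero, subst Bochner_Integration.integral_add,
          (auto intro!: Bochner_Integration.integrable_sum simp: represent.emeasure_finite less_top[symmetric] Bochner_Integration.integral_sum)[3])
    also have "\<dots> \<le> 1 / N * (measure ?\<sigma> UNIV + (\<Sum>k=1..N. L (\<theta> k) + e / 2))"
      using \<theta>(4) by (intro mult_left_mono add_left_mono sum_mono) auto
    also have "\<dots> = L \<psi> + measure ?\<sigma> UNIV / N + e / 2"
    proof -
      have "L \<psi> = 1 / N * (\<Sum>k=1..N. L (\<theta> k))"
        unfolding \<psi>_def[abs_def] using \<theta>(1) by (subst L_cmult) (auto simp: L_sum Cb1_sum)
      moreover have "(\<Sum>k=1..N. L (\<theta> k) + e / 2) = (\<Sum>k=1..N. L (\<theta> k)) + N * (e / 2)"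
        by (simp add: sum.distrib)
      ultimately show ?thesis using N(1) by (simp add: distrib_left)
    qed
    finally show ?thesis using N(2) by linarith
  qed
  ultimately show ?thesis using C by blast
qed

text \<open>Tightness rules out loss of mass.  If finitely many members of a cover of the whole space,
  together with a small constant and small functions \<open>u j\<close> controlling the complement of a
  totally bounded set, never dominated 1, there would be points violating the domination; they
  would lie in a totally bounded set, and the cover would fail at a limit point.\<close>

lemma represent_mass:
  assumes tight: "\<And>\<eta> e. \<eta> > 0 \<Longrightarrow> e > 0 \<Longrightarrow> \<exists>u\<in>Cb1. (\<forall>x. 0 \<le> u x) \<and> L u \<le> \<eta> \<and>
      (\<exists>F. finite F \<and> {x. u x < 1} \<subseteq> (\<Union>a\<in>F. ball a e))"
  shows "measure represent UNIV = L (\<lambda>_. 1)"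
proof (rule antisym[OF measure_represent_UNIV_le])
  have L1: "0 \<le> L (\<lambda>_. 1)" by (rule L_nonneg) auto
  have "ennreal (L (\<lambda>_. 1)) \<le> (\<Sum>n. ennreal (L (\<phi> n)))" if c: "cover UNIV \<phi>" for \<phi>
  proof (rule ennreal_le_epsilon)
    fix e :: real assume e: "0 < e"
    note \<phi> = coverD[OF c]
    define \<eta> where "\<eta> = e / (L (\<lambda>_. 1) + 1)"
    have \<eta>: "\<eta> > 0" using e L1 by (simp add: \<eta>_def)
    have "\<eta> * (L (\<lambda>_. 1) + 1) = e" using L1 by (simp add: \<eta>_def)
    then have \<eta>e: "\<eta> * L (\<lambda>_. 1) + \<eta> = e" by (simp add: distrib_left)
    \<comment> \<open>The costs of the \<open>u j\<close> add up to at most \<open>\<eta>\<close>, and \<open>\<eta>\<close> is chosen so that the cost of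
      the constant \<open>\<eta>\<close> and of all \<open>u j\<close> together is \<open>e\<close>.\<close>
    have "\<forall>j. \<exists>u\<in>Cb1. (\<forall>x. 0 \<le> u x) \<and> L u \<le> \<eta> * (1/2) ^ Suc j \<and>
      (\<exists>F. finite F \<and> {x. u x < 1} \<subseteq> (\<Union>a\<in>F. ball a (1 / real (Suc j))))"
      using \<eta> by (intro allI tight) auto
    then obtain u where u: "\<And>j. u j \<in> Cb1" "\<And>j x. 0 \<le> u j x" "\<And>j. L (u j) \<le> \<eta> * (1/2) ^ Suc j"
      "\<And>j. \<exists>F. finite F \<and> {x. u j x < 1} \<subseteq> (\<Union>a\<in>F. ball a (1 / real (Suc j)))"
      by metis
    have "\<exists>N. \<forall>x. 1 \<le> (\<Sum>n<N. \<phi> n x) + \<eta> + (\<Sum>j<N. u j x)"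
    proof (rule ccontr)
      assume "\<not> ?thesis"
      then obtain X where X: "\<And>N. (\<Sum>n<N. \<phi> n (X N)) + \<eta> + (\<Sum>j<N. u j (X N)) < 1"
        unfolding not_ex not_all not_le by metis
      have uX: "u j (X N) < 1" if "j < N" for j N
      proof -
        have "u j (X N) \<le> (\<Sum>j<N. u j (X N))"
          using that u(2) by (intro member_le_sum) auto
        moreover have "0 \<le> (\<Sum>n<N. \<phi> n (X N))" using \<phi>(2) by (intro sum_nonneg)
        ultimately show ?thesis using X[of N] \<eta> by linarith
      qed
      have "compact (closure (range X))"
        unfolding compact_eq_totally_bounded
      proof (intro conjI allI impI)
        show "complete (closure (range X))" by (simp add: complete_eq_closed)
        fix r :: real assume r: "r > 0"
        obtain j where j: "1 / real (Suc j) < r / 2"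
          using r nat_approx_posE[of "r/2"] by auto
        obtain F where F: "finite F" "{x. u j x < 1} \<subseteq> (\<Union>a\<in>F. ball a (1 / real (Suc j)))"
          using u(4) by blast
        define K where "K = F \<union> X ` {..j}"
        have "X N \<in> (\<Union>a\<in>K. cball a (r/2))" for N
        proof (cases "N \<le> j")
          case True
          then show ?thesis using r unfolding K_def by (intro UN_I[of "X N"]) auto
        next
          case False
          then have "X N \<in> {x. u j x < 1}" using uX by simp
          then have "X N \<in> (\<Union>a\<in>F. ball a (1 / real (Suc j)))" using F(2) by (rule subsetD[rotated])
          then show ?thesis using j unfolding K_def by fastforce
        qed
        then have "range X \<subseteq> (\<Union>a\<in>K. cball a (r/2))" by blast
        moreover have "closed (\<Union>a\<in>K. cball a (r/2))"
          using F(1) by (intro closed_UN) (auto simp: K_def)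
        ultimately have "closure (range X) \<subseteq> (\<Union>a\<in>K. cball a (r/2))"
          by (rule closure_minimal)
        also have "\<dots> \<subseteq> (\<Union>a\<in>K. ball a r)" using r by fastforce
        finally show "\<exists>k. finite k \<and> closure (range X) \<subseteq> (\<Union>x\<in>k. ball x r)"
          using F(1) by (intro exI[of _ K]) (auto simp: K_def)
      qed
      then obtain l r where l: "strict_mono (r :: nat \<Rightarrow> nat)" "(X \<circ> r) \<longlonglongrightarrow> l"
        unfolding compact_def by (metis closure_subset range_subsetD)
      have bound: "(\<Sum>n<M. \<phi> n l) \<le> 1 - \<eta>" for M
      proof (rule tendsto_upperbound)
        show "((\<lambda>i. \<Sum>n<M. \<phi> n (X (r i))) \<longlongrightarrow> (\<Sum>n<M. \<phi> n l)) sequentially"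
          using l(2) unfolding comp_def
          by (intro tendsto_sum continuous_on_tendsto_compose[OF Cb1D(3)[OF \<phi>(1)]]) auto
        have "(\<Sum>n<M. \<phi> n (X (r i))) \<le> 1 - \<eta>" if "i \<ge> M" for i
        proof -
          have "M \<le> r i" using seq_suble[OF l(1), of i] that by simp
          then have "(\<Sum>n<M. \<phi> n (X (r i))) \<le> (\<Sum>n<r i. \<phi> n (X (r i)))"
            using \<phi>(2) by (intro sum_mono2) auto
          moreover have "0 \<le> (\<Sum>j<r i. u j (X (r i)))" using u(2) by (intro sum_nonneg)
          ultimately show ?thesis using X[of "r i"] by linarith
        qed
        then show "\<forall>\<^sub>F i in sequentially. (\<Sum>n<M. \<phi> n (X (r i))) \<le> 1 - \<eta>"
          unfolding eventually_sequentially by blast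
      qed simp
      have "(\<Sum>n. ennreal (\<phi> n l)) \<le> ennreal (1 - \<eta>)"
        unfolding suminf_eq_SUP using bound \<phi>(2)
        by (intro SUP_least) (simp add: sum_ennreal ennreal_leI)
      then have "1 \<le> ennreal (1 - \<eta>)" by (rule order_trans[OF \<phi>(4)[OF UNIV_I]])
      then have "ennreal 1 \<le> ennreal (1 - \<eta>)" by simp
      then show False using \<eta> by (simp add: ennreal_le_iff2)
    qed
    then obtain N where N: "\<And>x. 1 \<le> (\<Sum>n<N. \<phi> n x) + \<eta> + (\<Sum>j<N. u j x)" by blast
    have "L (\<lambda>_. 1) \<le> L (\<lambda>x. (\<Sum>n<N. \<phi> n x) + \<eta> * 1 + (\<Sum>j<N. u j x))"
      using N \<phi>(1) u(1) by (intro L_mono Cb1_add Cb1_sum Cb1_const) auto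
    also have "\<dots> = (\<Sum>n<N. L (\<phi> n)) + \<eta> * L (\<lambda>_. 1) + (\<Sum>j<N. L (u j))"
      using \<phi>(1) u(1) L_cmult[of "\<lambda>_. 1" \<eta>] by (simp add: L_add L_sum Cb1_add Cb1_sum)
    also have "(\<Sum>j<N. L (u j)) \<le> (\<Sum>j<N. \<eta> * (1/2) ^ Suc j)" by (intro sum_mono u(3))
    also have "\<dots> \<le> \<eta>"
      using sum_le_suminf[OF sums_summable[OF power_half_series], of "{..<N}"] \<eta>
        sums_unique[OF power_half_series]
      by (simp add: sum_distrib_left[symmetric] del: power_Suc)
    finally have "L (\<lambda>_. 1) \<le> (\<Sum>n<N. L (\<phi> n)) + e" using \<eta>e by linarith
    then have "ennreal (L (\<lambda>_. 1)) \<le> ennreal (\<Sum>n<N. L (\<phi> n)) + ennreal e"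
      using \<phi>(3) e by (simp add: ennreal_plus[symmetric] sum_nonneg ennreal_leI del: ennreal_plus)
    also have "ennreal (\<Sum>n<N. L (\<phi> n)) = (\<Sum>n<N. ennreal (L (\<phi> n)))"
      using \<phi>(3) by (simp add: sum_ennreal)
    also have "\<dots> \<le> (\<Sum>n. ennreal (L (\<phi> n)))" by (rule sum_le_suminf) auto
    finally show "ennreal (L (\<lambda>_. 1)) \<le> (\<Sum>n. ennreal (L (\<phi> n))) + ennreal e" by simp
  qed
  then have "ennreal (L (\<lambda>_. 1)) \<le> outer UNIV"
    unfolding outer_def by (intro INF_greatest) simp
  then show "L (\<lambda>_. 1) \<le> measure represent UNIV"
    by (simp add: represent.emeasure_eq_measure[symmetric] emeasure_represent[symmetric] flip: ennreal_le_iff)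
qed

end

section \<open>Comparison of \<open>L\<^sup>p\<close> graphs\<close>

text \<open>Splitting at the height \<open>\<delta>\<close> compares \<open>L\<^sup>q\<close> with \<open>L\<^sup>p\<close> convergence on a probability space
  without Hoelder's inequality: the first summand is small, the second tends to 0 for each fixed
  \<open>\<delta>\<close>.\<close>

lemma powr_le_split:
  fixes t :: real
  assumes "0 \<le> t" "0 < \<delta>" "0 < q" "q \<le> p"
  shows "t powr q \<le> \<delta> powr q + \<delta> powr (q - p) * t powr p"
proof (cases "t \<le> \<delta>")
  case True
  then have "t powr q \<le> \<delta> powr q" using assms by (intro powr_mono2) auto
  then show ?thesis by (simp add: add_increasing2)
next
  case False
  then have "t powr (q - p) \<le> \<delta> powr (q - p)" using assms by (intro powr_mono2') auto
  then have "t powr (q - p) * t powr p \<le> \<delta> powr (q - p) * t powr p"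
    by (rule mult_right_mono) simp
  moreover have "t powr (q - p) * t powr p = t powr q"
    by (simp flip: powr_add)
  ultimately show ?thesis by (simp add: add_increasing)
qed

lemma Lp_normD: "f \<in> Lp M p \<Longrightarrow> f \<in> borel_measurable M"
  "f \<in> Lp M p \<Longrightarrow> integrable M (\<lambda>x. norm (f x) powr p)"
  by (auto simp: Lp_def)

lemma (in prob_space) Lp_antimono:
  assumes "0 < q" "q \<le> p"
  shows "Lp M p \<subseteq> Lp M q"
proof
  fix f assume f: "f \<in> Lp M p"
  have [measurable]: "f \<in> borel_measurable M" using f by (rule Lp_normD)
  have "integrable M (\<lambda>x. norm (f x) powr q)"
  proof (rule Bochner_Integration.integrable_bound)
    show "integrable M (\<lambda>x. 1 + norm (f x) powr p)"
      using Lp_normD(2)[OF f] by simp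
    show "AE x in M. norm (norm (f x) powr q) \<le> norm (1 + norm (f x) powr p)"
      using powr_le_split[of _ 1 q p] assms by (auto simp: add_nonneg_nonneg)
  qed simp
  then show "f \<in> Lp M q" by (simp add: Lp_def)
qed

lemma Lp_diff:
  assumes f: "f \<in> Lp M p" and h: "h \<in> Lp M p" and p: "0 < p"
  shows "(\<lambda>x. f x - h x) \<in> Lp M p"
proof -
  have [measurable]: "f \<in> borel_measurable M" "h \<in> borel_measurable M"
    using f h by (auto simp: Lp_def)
  have le: "norm (f x - h x) powr p \<le> 2 powr p * (norm (f x) powr p + norm (h x) powr p)" for x
  proof -
    define m where "m = max (norm (f x)) (norm (h x))"
    have "norm (f x - h x) \<le> 2 * m"
      unfolding m_def using norm_triangle_ineq4[of "f x" "h x"] by linarith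
    then have "norm (f x - h x) powr p \<le> (2 * m) powr p"
      using p by (intro powr_mono2) auto
    also have "\<dots> = 2 powr p * m powr p" by (rule powr_mult)
    also have "m powr p \<le> norm (f x) powr p + norm (h x) powr p"
      unfolding m_def max_def by simp
    finally show ?thesis by simp
  qed
  have "integrable M (\<lambda>x. norm (f x - h x) powr p)"
  proof (rule Bochner_Integration.integrable_bound)
    show "integrable M (\<lambda>x. 2 powr p * (norm (f x) powr p + norm (h x) powr p))"
      using Lp_normD(2)[OF f] Lp_normD(2)[OF h] by simp
    show "AE x in M. norm (norm (f x - h x) powr p)
        \<le> norm (2 powr p * (norm (f x) powr p + norm (h x) powr p))"
      using le by (auto simp: abs_of_nonneg)
  qed simp
  then show ?thesis by (simp add: Lp_def)
qed

lemma Lp_norm_tendsto_0_iff: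
  assumes "0 < p"
  shows "(\<lambda>n. Lp_norm M p (f n)) \<longlonglongrightarrow> 0 \<longleftrightarrow> (\<lambda>n. \<integral>x. norm (f n x) powr p \<partial>M) \<longlonglongrightarrow> 0"
proof
  assume "(\<lambda>n. Lp_norm M p (f n)) \<longlonglongrightarrow> 0"
  then have "(\<lambda>n. Lp_norm M p (f n) powr p) \<longlonglongrightarrow> 0"
    using assms by (intro tendsto_zero_powrI[of _ _ _ p]) (auto simp: Lp_norm_def)
  moreover have "Lp_norm M p (f n) powr p = (\<integral>x. norm (f n x) powr p \<partial>M)" for n
    using assms by (simp add: Lp_norm_def powr_powr)
  ultimately show "(\<lambda>n. \<integral>x. norm (f n x) powr p \<partial>M) \<longlonglongrightarrow> 0" by simp
next
  assume "(\<lambda>n. \<integral>x. norm (f n x) powr p \<partial>M) \<longlonglongrightarrow> 0"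
  then show "(\<lambda>n. Lp_norm M p (f n)) \<longlonglongrightarrow> 0"
    unfolding Lp_norm_def using assms
    by (intro tendsto_zero_powrI[of _ _ _ "1 / p"]) auto
qed

lemma (in prob_space) Lp_norm_tendsto_0_antimono:
  assumes q: "0 < q" "q \<le> p" and f: "\<And>n. f n \<in> Lp M p"
    and lim: "(\<lambda>n. Lp_norm M p (f n)) \<longlonglongrightarrow> 0"
  shows "(\<lambda>n. Lp_norm M q (f n)) \<longlonglongrightarrow> 0"
  unfolding Lp_norm_tendsto_0_iff[OF q(1)]
proof (rule LIMSEQ_I)
  define A where "A n = (\<integral>x. norm (f n x) powr p \<partial>M)" for n
  have A: "A \<longlonglongrightarrow> 0"
    using lim q unfolding A_def by (subst (asm) Lp_norm_tendsto_0_iff) auto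
  fix e :: real assume e: "0 < e"
  define \<delta> where "\<delta> = (e / 2) powr (1 / q)"
  have \<delta>: "\<delta> > 0" "\<delta> powr q = e / 2"
    using e q by (auto simp: \<delta>_def powr_powr)
  have "(\<lambda>n. \<delta> powr (q - p) * A n) \<longlonglongrightarrow> \<delta> powr (q - p) * 0"
    by (intro tendsto_intros A)
  then obtain N where N: "\<And>n. n \<ge> N \<Longrightarrow> \<bar>\<delta> powr (q - p) * A n\<bar> < e / 2"
    using LIMSEQ_D[of _ _ "e / 2"] e by (metis diff_zero half_gt_zero mult_zero_right real_norm_def)
  have "norm ((\<integral>x. norm (f n x) powr q \<partial>M) - 0) < e" if "n \<ge> N" for n
  proof -
    have "(\<integral>x. norm (f n x) powr q \<partial>M)
        \<le> (\<integral>x. \<delta> powr q + \<delta> powr (q - p) * norm (f n x) powr p \<partial>M)"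
      using Lp_normD(2)[OF f[of n]] Lp_normD(2)[OF subsetD[OF Lp_antimono[OF q] f[of n]]] q \<delta>
      by (intro integral_mono powr_le_split) auto
    also have "\<dots> = \<delta> powr q + \<delta> powr (q - p) * A n"
      using Lp_normD(2)[OF f[of n]] by (simp add: A_def prob_space)
    finally have "(\<integral>x. norm (f n x) powr q \<partial>M) < e"
      using N[OF that] \<delta>(2) by linarith
    moreover have "0 \<le> (\<integral>x. norm (f n x) powr q \<partial>M)" by simp
    ultimately show ?thesis by simp
  qed
  then show "\<exists>no. \<forall>n\<ge>no. norm ((\<integral>x. norm (f n x) powr q \<partial>M) - 0) < e" by blast
qed

lemma (in prob_space) graph_closure_antimono:
  assumes q: "0 < q" "q \<le> p"
  shows "graph_closure M p T \<subseteq> graph_closure M q T"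
proof (rule subrelI)
  fix f G assume "(f, G) \<in> graph_closure M p T"
  then obtain \<phi> \<Psi> where fG: "f \<in> Lp M p" "G \<in> Lp M p"
    and T: "\<And>n::nat. (\<phi> n, \<Psi> n) \<in> T \<inter> Lp M p \<times> Lp M p"
    and lim: "(\<lambda>n. Lp_norm M p (\<lambda>x. \<phi> n x - f x)) \<longlonglongrightarrow> 0"
      "(\<lambda>n. Lp_norm M p (\<lambda>x. \<Psi> n x - G x)) \<longlonglongrightarrow> 0"
    unfolding graph_closure_def by blast
  have "0 < p" using q by simp
  then have "(\<lambda>n. Lp_norm M q (\<lambda>x. \<phi> n x - f x)) \<longlonglongrightarrow> 0" "(\<lambda>n. Lp_norm M q (\<lambda>x. \<Psi> n x - G x)) \<longlonglongrightarrow> 0"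
    using T fG by (intro Lp_norm_tendsto_0_antimono[OF q _ lim(1)] Lp_norm_tendsto_0_antimono[OF q _ lim(2)]
        Lp_diff; blast)+
  moreover have "(\<phi> n, \<Psi> n) \<in> T \<inter> Lp M q \<times> Lp M q" for n
    using T[of n] by (auto intro: subsetD[OF Lp_antimono[OF q]])
  moreover have "f \<in> Lp M q" "G \<in> Lp M q"
    using fG by (auto intro: subsetD[OF Lp_antimono[OF q]])
  ultimately show "(f, G) \<in> graph_closure M q T"
    unfolding graph_closure_def mem_Collect_eq case_prod_conv by (intro conjI exI[of _ \<phi>] exI[of _ \<Psi>] allI)
qed

lemma Lp_cong_AE:
  assumes "G \<in> Lp M p" "H \<in> borel_measurable M" "AE x in M. G x = H x"
  shows "H \<in> Lp M p"
proof -
  have [measurable]: "G \<in> borel_measurable M" "H \<in> borel_measurable M" using assms by (auto simp: Lp_def)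
  have "integrable M (\<lambda>x. norm (G x) powr p) \<longleftrightarrow> integrable M (\<lambda>x. norm (H x) powr p)"
    using assms(3) by (intro integrable_cong_AE) auto
  then show ?thesis using assms by (simp add: Lp_def)
qed

lemma graph_closure_cong_AE:
  assumes fG: "(f, G) \<in> graph_closure M p T" and H: "H \<in> borel_measurable M" "AE x in M. G x = H x"
  shows "(f, H) \<in> graph_closure M p T"
proof -
  have G: "G \<in> Lp M p" using fG by (auto simp: graph_closure_def)
  then have HL: "H \<in> Lp M p" using H by (rule Lp_cong_AE)
  have "Lp_norm M p (\<lambda>x. \<Psi> x - G x) = Lp_norm M p (\<lambda>x. \<Psi> x - H x)" if "\<Psi> \<in> Lp M p" for \<Psi>
  proof -
    have [measurable]: "G \<in> borel_measurable M" "H \<in> borel_measurable M" "\<Psi> \<in> borel_measurable M"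
      using G H that by (auto simp: Lp_def)
    have "(\<integral>x. norm (\<Psi> x - G x) powr p \<partial>M) = (\<integral>x. norm (\<Psi> x - H x) powr p \<partial>M)"
      using H(2) by (intro integral_cong_AE) auto
    then show ?thesis by (simp add: Lp_norm_def)
  qed
  note norm_eq = this
  obtain \<phi> \<Psi> where f: "f \<in> Lp M p"
    and T: "\<And>n::nat. (\<phi> n, \<Psi> n) \<in> T \<inter> Lp M p \<times> Lp M p"
    and lim: "(\<lambda>n. Lp_norm M p (\<lambda>x. \<phi> n x - f x)) \<longlonglongrightarrow> 0"
      "(\<lambda>n. Lp_norm M p (\<lambda>x. \<Psi> n x - G x)) \<longlonglongrightarrow> 0"
    using fG unfolding graph_closure_def by blast
  have "\<Psi> n \<in> Lp M p" for n using T[of n] by simp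
  then have "(\<lambda>n. Lp_norm M p (\<lambda>x. \<Psi> n x - H x)) \<longlonglongrightarrow> 0"
    using lim(2) by (simp add: norm_eq)
  then show ?thesis
    unfolding graph_closure_def mem_Collect_eq case_prod_conv
    by (intro conjI exI[of _ \<phi>] exI[of _ \<Psi>] allI f HL T lim(1))
qed

lemma bounded_in_Lp:
  assumes "finite_measure M" "f \<in> borel_measurable M" "\<And>x. norm (f x) \<le> B" "0 < p"
  shows "f \<in> Lp M p"
proof -
  have [measurable]: "f \<in> borel_measurable M" by fact
  have "integrable M (\<lambda>x. norm (f x) powr p)"
    using assms(3,4)
    by (intro finite_measure.integrable_const_bound[OF assms(1), of _ "B powr p"])
      (auto intro!: powr_mono2 AE_I2)
  then show ?thesis using assms(2) by (simp add: Lp_def)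
qed

text \<open>Indicators of open sets are bounded limits of \<open>Cb1\<close> functions, and the open sets generate
  the Borel sets and are stable under intersection.\<close>

lemma AE_zero_if_orthogonal_to_Cb1:
  fixes \<nu> :: "'a::{real_inner, second_countable_topology} measure"
  assumes sets_nu: "sets \<nu> = sets borel" and h: "integrable \<nu> h"
    and orth: "\<And>\<phi>. \<phi> \<in> Cb1 \<Longrightarrow> (\<integral>x. \<phi> x * h x \<partial>\<nu>) = (0::real)"
  shows "AE x in \<nu>. h x = 0"
proof (rule density_unique_real[OF h integrable_zero])
  note [measurable_cong] = sets_nu
  have [measurable]: "h \<in> borel_measurable \<nu>" using h by simp
  have open0: "(LINT x:U|\<nu>. h x) = 0" if U: "open U" for U
  proof -
    obtain \<theta> :: "nat \<Rightarrow> 'a \<Rightarrow> real" where \<theta>: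
      "\<And>k. \<theta> k \<in> Cb1" "\<And>x. \<theta> 0 x = 0" "\<And>k x. 0 \<le> \<theta> k x" "\<And>k x. \<theta> k x \<le> 1"
      "\<And>k x. \<theta> k x \<le> \<theta> (Suc k) x" "\<And>k x. x \<notin> U \<Longrightarrow> \<theta> k x = 0"
      "\<And>x. (\<lambda>k. \<theta> k x) \<longlonglongrightarrow> indicator U x"
      using open_indicator_approx[OF U] by blast
    have [measurable]: "\<theta> k \<in> borel_measurable borel" "U \<in> sets borel" for k
      using U borel_measurable_continuous_onI[OF Cb1D(3)[OF \<theta>(1)]] by auto
    have "(\<lambda>k. \<integral>x. \<theta> k x * h x \<partial>\<nu>) \<longlonglongrightarrow> (\<integral>x. indicator U x * h x \<partial>\<nu>)"
    proof (rule integral_dominated_convergence[where w = "\<lambda>x. \<bar>h x\<bar>"])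
      show "AE x in \<nu>. (\<lambda>k. \<theta> k x * h x) \<longlonglongrightarrow> indicator U x * h x"
        by (intro AE_I2 tendsto_mult \<theta> tendsto_const)
      show "AE x in \<nu>. norm (\<theta> k x * h x) \<le> \<bar>h x\<bar>" for k
        using \<theta>(3,4) by (intro AE_I2) (simp add: abs_mult mult_left_le_one_le)
    qed (use h in simp_all)
    then show ?thesis
      using orth[OF \<theta>(1)] by (simp add: LIMSEQ_const_iff set_lebesgue_integral_def)
  qed
  have si: "set_integrable \<nu> A h" if "A \<in> sets borel" for A
    unfolding set_integrable_def using h that sets_nu by (intro integrable_mult_indicator) auto
  fix A assume "A \<in> sets \<nu>"
  then have A: "A \<in> sigma_sets UNIV {U. open U}" using sets_nu by (simp add: borel_def)
  have "Int_stable {U::'a set. open U}" "{U::'a set. open U} \<subseteq> Pow UNIV"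
    by (auto simp: Int_stable_def)
  then have "(LINT x:A|\<nu>. h x) = 0" using A
  proof (induction rule: sigma_sets_induct_disjoint)
    case (compl A)
    then have A: "A \<in> sets borel" by (simp add: borel_def)
    have "(LINT x:A|\<nu>. h x) + (LINT x:UNIV - A|\<nu>. h x) = (LINT x:UNIV|\<nu>. h x)"
      using set_integral_Un[of A "UNIV - A" \<nu> h] si A by (auto simp: sets.Diff)
    then show ?case using compl open0[of UNIV] by simp
  next
    case (union A)
    then have A: "A i \<in> sets borel" for i by (auto simp: borel_def)
    have "(LINT x:(\<Union>i. A i)|\<nu>. h x) = (\<Sum>i. (LINT x:(A i)|\<nu>. h x))"
      using union(1) A sets_nu
      by (intro lebesgue_integral_countable_add si) (auto simp: disjoint_family_on_def)
    then show ?case using union by simp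
  qed (auto intro: open0)
  then show "(LINT x:A|\<nu>. h x) = (LINT x:A|\<nu>. 0)" by simp
qed

section \<open>The common operators\<close>

locale gradient_operator = prob_space \<nu>
  for \<nu> :: "'a::{real_inner, banach, second_countable_topology} measure" +
  fixes R :: "'a \<Rightarrow> 'a"
  assumes sets_nu [measurable_cong]: "sets \<nu> = sets borel"
    and R: "bounded_linear R"
    and closable: "p > 1 \<Longrightarrow> closable_graph \<nu> p (Rgrad R)"
begin

lemma space_nu [simp]: "space \<nu> = UNIV"
  using sets_eq_imp_space_eq[OF sets_nu] by simp

lemma continuous_measurable: "continuous_on UNIV f \<Longrightarrow> f \<in> borel_measurable \<nu>"
  using borel_measurable_continuous_onI by (simp add: measurable_cong_sets[OF sets_nu refl])

lemma Rgrad_continuous: "\<phi> \<in> Cb1 \<Longrightarrow> continuous_on UNIV (\<lambda>x. R (grad \<phi> x))"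
  by (intro bounded_linear.continuous_on[OF R] Cb1D)

lemma Cb1_in_graph:
  assumes \<phi>: "\<phi> \<in> Cb1" and p: "p > 0"
  shows "(\<phi>, \<lambda>x. R (grad \<phi> x)) \<in> Mp_graph \<nu> R p"
proof -
  obtain B where B: "\<And>x. \<bar>\<phi> x\<bar> \<le> B" using Cb1D(4)[OF \<phi>] by blast
  obtain C where C: "\<And>x. norm (grad \<phi> x) \<le> C" using Cb1D(5)[OF \<phi>] by blast
  obtain K where K: "K \<ge> 0" "\<And>x. norm (R x) \<le> norm x * K"
    using bounded_linear.nonneg_bounded[OF R] by blast
  have "norm (R (grad \<phi> x)) \<le> C * K" for x
    using K(2)[of "grad \<phi> x"] mult_right_mono[OF C[of x] K(1)] by linarith
  then have 1: "(\<lambda>x. R (grad \<phi> x)) \<in> Lp \<nu> p"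
    using p by (intro bounded_in_Lp continuous_measurable Rgrad_continuous \<phi>) unfold_locales
  have 2: "\<phi> \<in> Lp \<nu> p"
    using p B by (intro bounded_in_Lp[of _ _ B] continuous_measurable Cb1D \<phi>) (unfold_locales, auto)
  have "(\<phi>, \<lambda>x. R (grad \<phi> x)) \<in> Rgrad R" using \<phi> by (auto simp: Rgrad_def)
  then show ?thesis
    unfolding Mp_graph_def graph_closure_def using 1 2 p
    by (auto simp: Lp_norm_def intro!: exI[of _ "\<lambda>_. \<phi>"] exI[of _ "\<lambda>_ x. R (grad \<phi> x)"])
qed

lemma Mp_Cb1:
  assumes "\<phi> \<in> Cb1" "p > 1"
  shows "AE x in \<nu>. Mp \<nu> R p \<phi> x = R (grad \<phi> x)"
proof -
  have 1: "(\<phi>, \<lambda>x. R (grad \<phi> x)) \<in> Mp_graph \<nu> R p" using assms by (intro Cb1_in_graph) auto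
  then have "(\<phi>, Mp \<nu> R p \<phi>) \<in> Mp_graph \<nu> R p" unfolding Mp_def
    by (rule someI[where P = "\<lambda>G. (\<phi>, G) \<in> Mp_graph \<nu> R p"])
  then show ?thesis
    using 1 closable[OF assms(2)] unfolding closable_graph_def Mp_graph_def by blast
qed

text \<open>The graphs decrease as \<open>p\<close> grows, so that the values belonging to \<open>p\<close> and to 2 both lie in the
  graph for \<open>min p 2\<close>, where closability identifies them.  One representative thus serves every
  \<open>p > 1\<close>, which makes the choice in the definition of \<open>Mop\<close> meaningful.\<close>

lemma Mop_in_graph:
  assumes f: "\<And>p. p > 1 \<Longrightarrow> f \<in> W1 \<nu> R p" and p: "p > 1"
  shows "(f, Mop \<nu> R f) \<in> Mp_graph \<nu> R p"
proof -
  obtain G where G: "(f, G) \<in> Mp_graph \<nu> R 2" using f[of 2] by (auto simp: W1_def)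
  have "(f, G) \<in> Mp_graph \<nu> R p" if p: "p > 1" for p
  proof -
    obtain H where H: "(f, H) \<in> Mp_graph \<nu> R p" using f[OF p] by (auto simp: W1_def)
    have q: "0 < min p 2" "min p 2 \<le> p" "min p 2 \<le> 2" "1 < min p 2" using p by auto
    have "(f, H) \<in> graph_closure \<nu> (min p 2) (Rgrad R)" "(f, G) \<in> graph_closure \<nu> (min p 2) (Rgrad R)"
      using G H graph_closure_antimono[OF q(1,2)] graph_closure_antimono[OF q(1,3)]
      unfolding Mp_graph_def by blast+
    then have HG: "AE x in \<nu>. H x = G x"
      using closable[OF q(4)] unfolding closable_graph_def by blast
    have "G \<in> borel_measurable \<nu>"
      using G by (auto simp: Mp_graph_def graph_closure_def Lp_def)
    from graph_closure_cong_AE[OF H[unfolded Mp_graph_def] this HG]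
    show ?thesis by (simp add: Mp_graph_def)
  qed
  then have "\<forall>p>1. (f, Mop \<nu> R f) \<in> Mp_graph \<nu> R p"
    unfolding Mop_def by (intro someI[where P = "\<lambda>G. \<forall>p>1. (f, G) \<in> Mp_graph \<nu> R p"]) blast
  then show ?thesis using p by blast
qed

lemma Lp_integrable:
  fixes f :: "'a \<Rightarrow> real"
  assumes "f \<in> Lp \<nu> p" "p \<ge> 1"
  shows "integrable \<nu> f"
proof -
  have "f \<in> Lp \<nu> 1" using assms Lp_antimono[of 1 p] by auto
  then show ?thesis by (auto simp: Lp_def integrable_abs_iff)
qed

lemma adjoint_Cb1:
  assumes "(F, h) \<in> Mp_adj_graph \<nu> R p" "p > 1" "\<phi> \<in> Cb1"
  shows "(\<integral>x. inner (R (grad \<phi> x)) (F x) \<partial>\<nu>) = (\<integral>x. \<phi> x * h x \<partial>\<nu>)"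
proof -
  have W: "\<phi> \<in> W1 \<nu> R p"
    using Cb1_in_graph[OF assms(3), of p] assms(2) by (auto simp: W1_def)
  have "Mp \<nu> R p \<phi> \<in> borel_measurable \<nu>"
  proof -
    have "(\<phi>, Mp \<nu> R p \<phi>) \<in> Mp_graph \<nu> R p"
      unfolding Mp_def using Cb1_in_graph[OF assms(3), of p] assms(2)
      by (intro someI[where P = "\<lambda>G. (\<phi>, G) \<in> Mp_graph \<nu> R p"]) auto
    then show ?thesis by (auto simp: Mp_graph_def graph_closure_def Lp_def)
  qed
  moreover have "F \<in> borel_measurable \<nu>" using assms(1) by (auto simp: Mp_adj_graph_def Lp_def)
  moreover have "(\<lambda>x. R (grad \<phi> x)) \<in> borel_measurable \<nu>"
    by (intro continuous_measurable Rgrad_continuous assms)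
  ultimately have "(\<integral>x. inner (R (grad \<phi> x)) (F x) \<partial>\<nu>) = (\<integral>x. inner (Mp \<nu> R p \<phi> x) (F x) \<partial>\<nu>)"
    using Mp_Cb1[OF assms(3,2)] by (intro integral_cong_AE) auto
  then show ?thesis using assms(1) W by (auto simp: Mp_adj_graph_def)
qed

text \<open>Two candidates for the adjoint, taken from different exponents, differ by a function that is
  orthogonal to \<open>Cb1\<close> and hence vanishes.\<close>

lemma Mstar_in_graph:
  assumes F: "\<And>p. p > 1 \<Longrightarrow> F \<in> Mp_adj_dom \<nu> R p" and p: "p > 1"
  shows "(F, Mstar \<nu> R F) \<in> Mp_adj_graph \<nu> R p"
proof -
  obtain h where h: "(F, h) \<in> Mp_adj_graph \<nu> R 2" using F[of 2] by (auto simp: Mp_adj_dom_def)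
  have "(F, h) \<in> Mp_adj_graph \<nu> R p" if p: "p > 1" for p
  proof -
    obtain k where k: "(F, k) \<in> Mp_adj_graph \<nu> R p" using F[OF p] by (auto simp: Mp_adj_dom_def)
    have p': "p / (p - 1) \<ge> 1" using p by (simp add: field_simps)
    have hL: "h \<in> Lp \<nu> 2" using h by (simp add: Mp_adj_graph_def)
    have kL: "k \<in> Lp \<nu> (p / (p - 1))" using k by (simp add: Mp_adj_graph_def)
    have int: "integrable \<nu> h" "integrable \<nu> k"
      using Lp_integrable[OF hL] Lp_integrable[OF kL p'] by auto
    have "AE x in \<nu>. h x - k x = 0"
    proof (rule AE_zero_if_orthogonal_to_Cb1[OF sets_nu])
      fix \<phi> :: "'a \<Rightarrow> real" assume \<phi>: "\<phi> \<in> Cb1"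
      obtain B where B: "\<And>x. \<bar>\<phi> x\<bar> \<le> B" using Cb1D(4)[OF \<phi>] by blast
      have [measurable]: "\<phi> \<in> borel_measurable \<nu>" by (intro continuous_measurable Cb1D \<phi>)
      have "integrable \<nu> (\<lambda>x. \<phi> x * f x)" if "integrable \<nu> f" for f
      proof (rule Bochner_Integration.integrable_bound)
        show "integrable \<nu> (\<lambda>x. B * f x)" using that by simp
        show "(\<lambda>x. \<phi> x * f x) \<in> borel_measurable \<nu>" using that by simp
        have "\<bar>\<phi> x\<bar> * \<bar>f x\<bar> \<le> \<bar>B\<bar> * \<bar>f x\<bar>" for x
          using order_trans[OF B abs_ge_self] by (rule mult_right_mono) simp
        then show "AE x in \<nu>. norm (\<phi> x * f x) \<le> norm (B * f x)" by (simp add: abs_mult)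
      qed
      then have "(\<integral>x. \<phi> x * (h x - k x) \<partial>\<nu>) = (\<integral>x. \<phi> x * h x \<partial>\<nu>) - (\<integral>x. \<phi> x * k x \<partial>\<nu>)"
        using int by (simp add: right_diff_distrib)
      also have "\<dots> = 0"
        using adjoint_Cb1[OF h _ \<phi>] adjoint_Cb1[OF k p \<phi>] by simp
      finally show "(\<integral>x. \<phi> x * (h x - k x) \<partial>\<nu>) = 0" .
    qed (use int in simp)
    then have eq: "AE x in \<nu>. k x = h x" by (auto elim: eventually_mono)
    have hm: "h \<in> borel_measurable \<nu>" "k \<in> borel_measurable \<nu>" using int by auto
    have "h \<in> Lp \<nu> (p / (p - 1))" by (rule Lp_cong_AE[OF kL hm(1) eq])
    moreover have "(\<integral>x. \<phi> x * k x \<partial>\<nu>) = (\<integral>x. \<phi> x * h x \<partial>\<nu>)" if "\<phi> \<in> W1 \<nu> R p" for \<phi>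
    proof -
      have [measurable]: "\<phi> \<in> borel_measurable \<nu>"
        using that by (auto simp: W1_def Mp_graph_def graph_closure_def Lp_def)
      show ?thesis using eq hm by (intro integral_cong_AE) auto
    qed
    ultimately show ?thesis using k by (auto simp: Mp_adj_graph_def)
  qed
  then have "\<forall>p>1. (F, Mstar \<nu> R F) \<in> Mp_adj_graph \<nu> R p"
    unfolding Mstar_def by (intro someI[where P = "\<lambda>h. \<forall>p>1. (F, h) \<in> Mp_adj_graph \<nu> R p"]) blast
  then show ?thesis using p by blast
qed

end

section \<open>Products of square integrable functions\<close>

lemma integrable_if_square_integrable_factors:
  fixes a b :: "'a \<Rightarrow> real" and f :: "'a \<Rightarrow> real"
  assumes [measurable]: "f \<in> borel_measurable M"
    and "integrable M (\<lambda>x. (a x)\<^sup>2)" "integrable M (\<lambda>x. (b x)\<^sup>2)"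
    and le: "AE x in M. \<bar>f x\<bar> \<le> \<bar>a x\<bar> * \<bar>b x\<bar>"
  shows "integrable M f"
proof (rule Bochner_Integration.integrable_bound)
  show "integrable M (\<lambda>x. (a x)\<^sup>2 + (b x)\<^sup>2)" using assms by simp
  have "\<bar>a x\<bar> * \<bar>b x\<bar> \<le> (a x)\<^sup>2 + (b x)\<^sup>2" for x
  proof -
    have "0 \<le> \<bar>a x\<bar> * \<bar>b x\<bar>" by simp
    moreover have "2 * (\<bar>a x\<bar> * \<bar>b x\<bar>) \<le> (a x)\<^sup>2 + (b x)\<^sup>2"
      using sum_squares_bound[of "\<bar>a x\<bar>" "\<bar>b x\<bar>"] by simp
    ultimately show ?thesis by linarith
  qed
  then show "AE x in M. norm (f x) \<le> norm ((a x)\<^sup>2 + (b x)\<^sup>2)"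
    using le by (auto elim!: eventually_mono intro: order_trans)
qed simp

text \<open>The weighted arithmetic-geometric mean inequality \<open>a b \<le> a\<^sup>2 / \<delta> + \<delta> b\<^sup>2\<close> replaces the
  Cauchy-Schwarz inequality for integrals.\<close>

lemma integral_tendsto_0_if_L2_factor:
  fixes a :: "nat \<Rightarrow> 'a \<Rightarrow> real" and b :: "'a \<Rightarrow> real" and f :: "nat \<Rightarrow> 'a \<Rightarrow> real"
  assumes f: "\<And>n. f n \<in> borel_measurable M"
    and a: "\<And>n. integrable M (\<lambda>x. (a n x)\<^sup>2)" and b: "integrable M (\<lambda>x. (b x)\<^sup>2)"
    and lim: "(\<lambda>n. \<integral>x. (a n x)\<^sup>2 \<partial>M) \<longlonglongrightarrow> 0"
    and le: "\<And>n. AE x in M. \<bar>f n x\<bar> \<le> \<bar>a n x\<bar> * \<bar>b x\<bar>"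
  shows "(\<lambda>n. \<integral>x. f n x \<partial>M) \<longlonglongrightarrow> 0"
proof (rule LIMSEQ_I)
  fix e :: real assume e: "0 < e"
  define I where "I = (\<integral>x. (b x)\<^sup>2 \<partial>M)"
  have I: "0 \<le> I" by (simp add: I_def)
  define \<delta> where "\<delta> = e / (2 * (I + 1))"
  have \<delta>: "\<delta> > 0" using e I by (simp add: \<delta>_def)
  have "\<delta> * I \<le> \<delta> * (I + 1)" using \<delta> by simp
  also have "\<dots> = e / 2" using I by (simp add: \<delta>_def field_simps)
  finally have \<delta>I: "\<delta> * I \<le> e / 2" .
  have "(\<lambda>n. (\<integral>x. (a n x)\<^sup>2 \<partial>M) / \<delta>) \<longlonglongrightarrow> 0 / \<delta>"
    using \<delta> by (intro tendsto_divide lim tendsto_const) auto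
  then obtain N where N: "\<And>n. n \<ge> N \<Longrightarrow> \<bar>(\<integral>x. (a n x)\<^sup>2 \<partial>M) / \<delta>\<bar> < e / 2"
    using LIMSEQ_D[of _ 0 "e/2"] e by force
  have "norm ((\<integral>x. f n x \<partial>M) - 0) < e" if "n \<ge> N" for n
  proof -
    have int: "integrable M (f n)" by (rule integrable_if_square_integrable_factors[OF f a b le])
    have ab: "\<bar>a n x\<bar> * \<bar>b x\<bar> \<le> (a n x)\<^sup>2 / \<delta> + \<delta> * (b x)\<^sup>2" for x
    proof -
      have "2 * \<delta> * (\<bar>a n x\<bar> * \<bar>b x\<bar>) \<le> (a n x)\<^sup>2 + \<delta>\<^sup>2 * (b x)\<^sup>2"
        using sum_squares_bound[of "\<bar>a n x\<bar>" "\<delta> * \<bar>b x\<bar>"]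
        by (simp add: power_mult_distrib algebra_simps)
      moreover have "0 \<le> \<delta> * (\<bar>a n x\<bar> * \<bar>b x\<bar>)" using \<delta> by simp
      ultimately have "\<delta> * (\<bar>a n x\<bar> * \<bar>b x\<bar>) \<le> (a n x)\<^sup>2 + \<delta>\<^sup>2 * (b x)\<^sup>2" by linarith
      then show ?thesis using \<delta> by (simp add: field_simps power2_eq_square)
    qed
    have "\<bar>\<integral>x. f n x \<partial>M\<bar> \<le> (\<integral>x. \<bar>f n x\<bar> \<partial>M)" by (rule integral_abs_bound)
    also have "\<dots> \<le> (\<integral>x. (a n x)\<^sup>2 / \<delta> + \<delta> * (b x)\<^sup>2 \<partial>M)"
      using int a b le[of n] ab
      by (intro integral_mono_AE) (auto elim!: eventually_mono intro: order_trans)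
    also have "\<dots> = (\<integral>x. (a n x)\<^sup>2 \<partial>M) / \<delta> + \<delta> * I"
      using a b by (simp add: I_def)
    finally have "\<bar>\<integral>x. f n x \<partial>M\<bar> < e"
      using N[OF that] \<delta>I abs_ge_self[of "(\<integral>x. (a n x)\<^sup>2 \<partial>M) / \<delta>"] by linarith
    then show ?thesis by simp
  qed
  then show "\<exists>no. \<forall>n\<ge>no. norm ((\<integral>x. f n x \<partial>M) - 0) < e" by blast
qed

text \<open>Rescaled ramps approximate indicators of half-lines.  Being Lipschitz, they are admissible as
  derivatives in the integration by parts below.\<close>

definition ramp :: "real \<Rightarrow> real" where "ramp y = max 0 (min 1 y)"

definition ramp_prim :: "real \<Rightarrow> real" where "ramp_prim y = (max 0 y)\<^sup>2 / 2 - (max 0 (y - 1))\<^sup>2 / 2"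

lemma DERIV_ramp_prim: "DERIV ramp_prim y :> ramp y"
proof -
  have 2: "DERIV (\<lambda>y. (max 0 (y - 1))\<^sup>2 / 2) y :> max 0 (y - 1) * 1"
    by (rule DERIV_chain2[OF DERIV_half_square_pos]) (auto intro!: derivative_eq_intros)
  have "DERIV ramp_prim y :> max 0 y - max 0 (y - 1) * 1"
    unfolding ramp_prim_def[abs_def] by (rule DERIV_diff[OF DERIV_half_square_pos 2])
  then show ?thesis by (auto simp: ramp_def max_def min_def split: if_splits)
qed

lemma ramp_bounds: "0 \<le> ramp y" "ramp y \<le> 1" "\<bar>ramp y - ramp z\<bar> \<le> \<bar>y - z\<bar>"
  by (auto simp: ramp_def)

lemma ramp_prim_nonpos: "y \<le> 0 \<Longrightarrow> ramp_prim y = 0"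
  and ramp_prim_ge_1: "1 \<le> y \<Longrightarrow> ramp_prim y = y - 1 / 2"
  by (auto simp: ramp_prim_def power2_eq_square field_simps)

lemma ramp_prim_bounds: "0 \<le> ramp_prim y \<and> ramp_prim y \<le> max 0 y"
proof -
  consider "y \<le> 0" | "0 \<le> y" "y \<le> 1" | "1 \<le> y" by linarith
  then show ?thesis
  proof cases
    case 2
    then have "ramp_prim y = y\<^sup>2 / 2" "y\<^sup>2 \<le> y"
      by (auto simp: ramp_prim_def power2_eq_square mult_left_le)
    then have "0 \<le> ramp_prim y" "ramp_prim y \<le> y" using 2(1) zero_le_power2[of y] by linarith+
    then show ?thesis using 2(1) by simp
  qed (simp_all add: ramp_prim_nonpos ramp_prim_ge_1)
qed

section \<open>Differentiation of \<open>F_int\<close> on \<open>Cb1\<close>\<close>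

locale level_function = gradient_operator \<nu> R
  for \<nu> :: "'a::{real_inner, banach, second_countable_topology} measure" and R +
  fixes g :: "'a \<Rightarrow> real"
  assumes g_borel [measurable]: "g \<in> borel_measurable borel"
    and g_W1: "p > 1 \<Longrightarrow> g \<in> W1 \<nu> R p"
    and Mg_nonzero: "AE x in \<nu>. Mop \<nu> R g x \<noteq> 0"
    and field_dom: "p > 1 \<Longrightarrow> normal_field \<nu> R g \<in> Mp_adj_dom \<nu> R p"
begin

abbreviation "\<Psi> \<equiv> normal_field \<nu> R g"

abbreviation "m \<equiv> Mstar \<nu> R \<Psi>"

lemma R_add: "R (x + y) = R x + R y" and R_scaleR: "R (c *\<^sub>R x) = c *\<^sub>R R x" and R_zero: "R 0 = 0"
  using bounded_linear.linear[OF R] by (simp_all add: linear_add linear_cmul linear_0)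

text \<open>By the product rule this is \<open>M\<^sup>*\<close> applied to the field \<open>\<phi> \<Psi>\<close>.\<close>

definition adj :: "('a \<Rightarrow> real) \<Rightarrow> 'a \<Rightarrow> real" where
  "adj \<phi> x = \<phi> x * m x - inner (R (grad \<phi> x)) (\<Psi> x)"

lemma L2_data:
  shows g_sq: "integrable \<nu> (\<lambda>x. (g x)\<^sup>2)"
    and Mg_measurable [measurable]: "Mop \<nu> R g \<in> borel_measurable \<nu>"
    and \<Psi>_measurable [measurable]: "\<Psi> \<in> borel_measurable \<nu>"
    and m_measurable [measurable]: "m \<in> borel_measurable \<nu>"
    and \<Psi>_sq: "integrable \<nu> (\<lambda>x. (norm (\<Psi> x))\<^sup>2)"
    and m_sq: "integrable \<nu> (\<lambda>x. (m x)\<^sup>2)"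
  using Mop_in_graph[OF g_W1, of 2] Mstar_in_graph[OF field_dom, of 2]
  by (auto simp: Mp_graph_def graph_closure_def Mp_adj_graph_def Lp_def)

lemma inner_Mg_field: "AE x in \<nu>. inner (Mop \<nu> R g x) (\<Psi> x) = 1"
  using Mg_nonzero by (auto simp: normal_field_def power2_norm_eq_inner elim!: eventually_mono)

lemma approx_g:
  obtains G :: "nat \<Rightarrow> 'a \<Rightarrow> real" where "\<And>n. G n \<in> Cb1"
    "\<And>n. integrable \<nu> (\<lambda>x. (G n x - g x)\<^sup>2)" "(\<lambda>n. \<integral>x. (G n x - g x)\<^sup>2 \<partial>\<nu>) \<longlonglongrightarrow> 0"
    "\<And>n. integrable \<nu> (\<lambda>x. (norm (R (grad (G n) x) - Mop \<nu> R g x))\<^sup>2)"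
    "(\<lambda>n. \<integral>x. (norm (R (grad (G n) x) - Mop \<nu> R g x))\<^sup>2 \<partial>\<nu>) \<longlonglongrightarrow> 0"
proof -
  obtain \<phi> \<Phi> where T: "\<And>n::nat. (\<phi> n, \<Phi> n) \<in> Rgrad R \<inter> Lp \<nu> 2 \<times> Lp \<nu> 2"
    and lim: "(\<lambda>n. Lp_norm \<nu> 2 (\<lambda>x. \<phi> n x - g x)) \<longlonglongrightarrow> 0"
      "(\<lambda>n. Lp_norm \<nu> 2 (\<lambda>x. \<Phi> n x - Mop \<nu> R g x)) \<longlonglongrightarrow> 0"
    and L2: "g \<in> Lp \<nu> 2" "Mop \<nu> R g \<in> Lp \<nu> 2"
    using Mop_in_graph[OF g_W1, of 2] unfolding Mp_graph_def graph_closure_def by auto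
  have C: "\<phi> n \<in> Cb1" and \<Phi>: "\<Phi> n = (\<lambda>x. R (grad (\<phi> n) x))" for n
    using T[of n] by (auto simp: Rgrad_def)
  have "(\<lambda>x. \<phi> n x - g x) \<in> Lp \<nu> 2" "(\<lambda>x. \<Phi> n x - Mop \<nu> R g x) \<in> Lp \<nu> 2" for n
    using T[of n] L2 by (auto intro!: Lp_diff)
  then have i: "integrable \<nu> (\<lambda>x. (\<phi> n x - g x)\<^sup>2)"
    "integrable \<nu> (\<lambda>x. (norm (R (grad (\<phi> n) x) - Mop \<nu> R g x))\<^sup>2)" for n
    by (simp_all add: Lp_def \<Phi>)
  have l: "(\<lambda>n. \<integral>x. (\<phi> n x - g x)\<^sup>2 \<partial>\<nu>) \<longlonglongrightarrow> 0"
    "(\<lambda>n. \<integral>x. (norm (R (grad (\<phi> n) x) - Mop \<nu> R g x))\<^sup>2 \<partial>\<nu>) \<longlonglongrightarrow> 0"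
    using lim by (simp_all add: Lp_norm_tendsto_0_iff \<Phi>)
  show ?thesis by (rule that[OF C i(1) l(1) i(2) l(2)])
qed

lemma Cb1_bounds:
  assumes "\<phi> \<in> Cb1"
  obtains B where "B \<ge> 0" "\<And>x. \<bar>\<phi> x\<bar> \<le> B" "\<And>x. norm (R (grad \<phi> x)) \<le> B"
proof -
  obtain B where B: "\<And>x. \<bar>\<phi> x\<bar> \<le> B" using Cb1D(4)[OF assms] by blast
  obtain C where C: "\<And>x. norm (grad \<phi> x) \<le> C" using Cb1D(5)[OF assms] by blast
  obtain K where K: "K \<ge> 0" "\<And>x. norm (R x) \<le> norm x * K"
    using bounded_linear.nonneg_bounded[OF R] by blast
  have CK: "norm (R (grad \<phi> x)) \<le> C * K" for x
    using K(2)[of "grad \<phi> x"] mult_right_mono[OF C[of x] K(1)] by linarith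
  have "0 \<le> max B (C * K)" using abs_ge_zero[of "\<phi> undefined"] B[of undefined] by linarith
  then show ?thesis using B CK by (intro that[of "max B (C * K)"]) (auto simp: le_max_iff_disj)
qed

lemma Cb1_measurable [measurable (raw)]:
  assumes "\<phi> \<in> Cb1"
  shows "\<phi> \<in> borel_measurable \<nu>" "(\<lambda>x. R (grad \<phi> x)) \<in> borel_measurable \<nu>"
  using assms by (auto intro!: continuous_measurable Rgrad_continuous Cb1D)

text \<open>A square integrable function that dominates \<open>adj \<phi>\<close> up to a bound for \<open>\<phi>\<close> and \<open>R \<nabla>\<phi>\<close>.\<close>

definition weight :: "'a \<Rightarrow> real" where "weight x = \<bar>m x\<bar> + norm (\<Psi> x)"

lemma weight_measurable [measurable]: "weight \<in> borel_measurable \<nu>"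
  unfolding weight_def[abs_def] by measurable

lemma weight_nonneg: "0 \<le> weight x" by (simp add: weight_def)

lemma weight_sq: "integrable \<nu> (\<lambda>x. (weight x)\<^sup>2)"
proof (rule Bochner_Integration.integrable_bound)
  show "integrable \<nu> (\<lambda>x. 2 * ((m x)\<^sup>2 + (norm (\<Psi> x))\<^sup>2))" using m_sq \<Psi>_sq by simp
  have "(weight x)\<^sup>2 \<le> 2 * ((m x)\<^sup>2 + (norm (\<Psi> x))\<^sup>2)" for x
    using sum_squares_bound[of "\<bar>m x\<bar>" "norm (\<Psi> x)"]
    by (simp add: weight_def power2_sum)
  then show "AE x in \<nu>. norm ((weight x)\<^sup>2) \<le> norm (2 * ((m x)\<^sup>2 + (norm (\<Psi> x))\<^sup>2))" by simp
qed measurable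

lemma square_integrable_const: "integrable \<nu> (\<lambda>_. c\<^sup>2 :: real)"
  by simp

lemma weight_integrable: "integrable \<nu> weight"
  by (rule integrable_if_square_integrable_factors[OF _ weight_sq square_integrable_const[of 1]]) auto

lemma adj_measurable [measurable (raw)]: "\<phi> \<in> Cb1 \<Longrightarrow> adj \<phi> \<in> borel_measurable \<nu>"
  unfolding adj_def[abs_def] by measurable

lemma adj_le:
  assumes "\<bar>\<phi> x\<bar> \<le> B" "norm (R (grad \<phi> x)) \<le> B"
  shows "\<bar>adj \<phi> x\<bar> \<le> B * weight x"
proof -
  have "\<bar>adj \<phi> x\<bar> \<le> \<bar>\<phi> x\<bar> * \<bar>m x\<bar> + norm (R (grad \<phi> x)) * norm (\<Psi> x)"
    unfolding adj_def using Cauchy_Schwarz_ineq2[of "R (grad \<phi> x)" "\<Psi> x"]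
    by (simp flip: abs_mult) 
  also have "\<dots> \<le> B * \<bar>m x\<bar> + B * norm (\<Psi> x)"
    using assms by (intro add_mono mult_right_mono) auto
  finally show ?thesis by (simp add: weight_def distrib_left)
qed

lemma adj_add: "\<phi> \<in> Cb1 \<Longrightarrow> \<psi> \<in> Cb1 \<Longrightarrow> adj (\<lambda>x. \<phi> x + \<psi> x) x = adj \<phi> x + adj \<psi> x"
  by (simp add: adj_def grad_add R_add inner_add_left algebra_simps)

lemma adj_cmult: "\<phi> \<in> Cb1 \<Longrightarrow> adj (\<lambda>x. c * \<phi> x) x = c * adj \<phi> x"
  by (simp add: adj_def grad_cmult R_scaleR algebra_simps)

lemma adj_one: "adj (\<lambda>_. 1) = m"
  by (simp add: adj_def[abs_def] grad_const R_zero)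

text \<open>The chain rule \<open>M (\<theta> \<circ> g) = \<theta>' (g) Mg\<close> and \<open>\<langle>Mg, \<Psi>\<rangle> = 1\<close> turn the adjoint relation into an
  integration by parts along the level function.  The adjoint relation is applied to
  \<open>\<theta> (G n) \<phi>\<close> with \<open>Cb1\<close> approximations \<open>G n\<close> of \<open>g\<close>; the Lipschitz bounds make both sides converge.\<close>

lemma integration_by_parts:
  assumes D: "\<And>y. DERIV \<theta> y :> \<theta>' y" and bd: "\<And>y. \<bar>\<theta>' y\<bar> \<le> C"
    and lip: "\<And>y z. \<bar>\<theta>' y - \<theta>' z\<bar> \<le> K * \<bar>y - z\<bar>" and \<phi>: "\<phi> \<in> Cb1"
  shows "(\<integral>x. \<theta>' (g x) * \<phi> x \<partial>\<nu>) = (\<integral>x. \<theta> (g x) * adj \<phi> x \<partial>\<nu>)"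
proof -
  obtain B where B: "B \<ge> 0" "\<And>x. \<bar>\<phi> x\<bar> \<le> B" "\<And>x. norm (R (grad \<phi> x)) \<le> B"
    using Cb1_bounds[OF \<phi>] by blast
  obtain G where G: "\<And>n. G n \<in> Cb1"
    "\<And>n. integrable \<nu> (\<lambda>x. (G n x - g x)\<^sup>2)" "(\<lambda>n. \<integral>x. (G n x - g x)\<^sup>2 \<partial>\<nu>) \<longlonglongrightarrow> 0"
    "\<And>n. integrable \<nu> (\<lambda>x. (norm (R (grad (G n) x) - Mop \<nu> R g x))\<^sup>2)"
    "(\<lambda>n. \<integral>x. (norm (R (grad (G n) x) - Mop \<nu> R g x))\<^sup>2 \<partial>\<nu>) \<longlonglongrightarrow> 0"
    using approx_g by blast
  have C0: "0 \<le> C" using bd[of 0] by linarith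
  have K0: "0 \<le> K" using lip[of 1 0] by simp
  have lip\<theta>: "\<bar>\<theta> y - \<theta> z\<bar> \<le> C * \<bar>y - z\<bar>" for y z
    using field_differentiable_bound[of UNIV \<theta> \<theta>' C y z] D bd by auto
  have cont\<theta>: "continuous_on UNIV \<theta>" using D DERIV_isCont continuous_at_imp_continuous_on by blast
  have cont\<theta>': "continuous_on UNIV \<theta>'"
  proof (rule lipschitz_on_continuous_on[of K])
    show "K-lipschitz_on UNIV \<theta>'" using lip K0 by (intro lipschitz_onI) (auto simp: dist_real_def)
  qed
  have [measurable]: "\<theta> \<in> borel_measurable borel" "\<theta>' \<in> borel_measurable borel"
    using cont\<theta> cont\<theta>' by (auto intro: borel_measurable_continuous_onI)
  note [measurable] = Cb1_measurable[OF \<phi>] Cb1_measurable[OF G(1)] adj_measurable[OF \<phi>]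
  have adj_le': "\<bar>adj \<phi> x\<bar> \<le> B * weight x" for x by (rule adj_le[OF B(2,3)])
  have Bw: "integrable \<nu> (\<lambda>x. (C * (B * weight x))\<^sup>2)"
    using weight_sq by (simp add: power_mult_distrib)
  have \<theta>adj: "integrable \<nu> (\<lambda>x. \<theta> (g x) * adj \<phi> x)"
  proof (rule integrable_if_square_integrable_factors)
    show "integrable \<nu> (\<lambda>x. (\<bar>\<theta> 0\<bar> + C * \<bar>g x\<bar>)\<^sup>2)"
    proof (rule Bochner_Integration.integrable_bound)
      show "integrable \<nu> (\<lambda>x. 2 * ((\<theta> 0)\<^sup>2 + C\<^sup>2 * (g x)\<^sup>2))" using g_sq by simp
      have "(\<bar>\<theta> 0\<bar> + C * \<bar>g x\<bar>)\<^sup>2 \<le> 2 * ((\<theta> 0)\<^sup>2 + C\<^sup>2 * (g x)\<^sup>2)" for x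
        using sum_squares_bound[of "\<bar>\<theta> 0\<bar>" "C * \<bar>g x\<bar>"]
        by (simp add: power2_sum power_mult_distrib)
      then show "AE x in \<nu>. norm ((\<bar>\<theta> 0\<bar> + C * \<bar>g x\<bar>)\<^sup>2) \<le> norm (2 * ((\<theta> 0)\<^sup>2 + C\<^sup>2 * (g x)\<^sup>2))"
        by simp
    qed measurable
    show "integrable \<nu> (\<lambda>x. (B * weight x)\<^sup>2)" using weight_sq by (simp add: power_mult_distrib)
    have "\<bar>\<theta> (g x)\<bar> \<le> \<bar>\<bar>\<theta> 0\<bar> + C * \<bar>g x\<bar>\<bar>" for x using lip\<theta>[of "g x" 0] by auto
    then show "AE x in \<nu>. \<bar>\<theta> (g x) * adj \<phi> x\<bar> \<le> \<bar>\<bar>\<theta> 0\<bar> + C * \<bar>g x\<bar>\<bar> * \<bar>B * weight x\<bar>"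
      unfolding abs_mult[of "\<theta> _"] using order_trans[OF adj_le' abs_ge_self]
      by (intro AE_I2 mult_mono) auto
  qed measurable
  have \<theta>'int: "integrable \<nu> (\<lambda>x. \<theta>' (g x) * \<phi> x)"
    using bd B C0 by (intro integrable_const_bound[of _ "C * B"]) (auto simp: abs_mult intro!: mult_mono)
  define u where "u n x = \<theta>' (G n x) * \<phi> x * inner (R (grad (G n) x)) (\<Psi> x)" for n x
  have [measurable]: "u n \<in> borel_measurable \<nu>" for n unfolding u_def[abs_def] by measurable
  have \<theta>adj_n: "integrable \<nu> (\<lambda>x. \<theta> (G n x) * adj \<phi> x)" and u_int: "integrable \<nu> (u n)"
    and parts: "(\<integral>x. u n x \<partial>\<nu>) = (\<integral>x. \<theta> (G n x) * adj \<phi> x \<partial>\<nu>)" for n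
  proof -
    obtain Bn where Bn: "Bn \<ge> 0" "\<And>x. \<bar>G n x\<bar> \<le> Bn" "\<And>x. norm (R (grad (G n) x)) \<le> Bn"
      using Cb1_bounds[OF G(1)] by blast
    have \<theta>C: "(\<lambda>x. \<theta> (G n x)) \<in> Cb1" and g\<theta>: "grad (\<lambda>x. \<theta> (G n x)) = (\<lambda>x. \<theta>' (G n x) *\<^sub>R grad (G n) x)"
      using Cb1_compose_UNIV[OF G(1) D cont\<theta>'] by auto
    have PC: "(\<lambda>x. \<theta> (G n x) * \<phi> x) \<in> Cb1" by (rule Cb1_mult[OF \<theta>C \<phi>])
    have gP: "R (grad (\<lambda>x. \<theta> (G n x) * \<phi> x) x) = \<theta> (G n x) *\<^sub>R R (grad \<phi> x)
        + (\<phi> x * \<theta>' (G n x)) *\<^sub>R R (grad (G n) x)" for x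
      by (simp add: grad_mult[OF \<theta>C \<phi>] g\<theta> R_add R_scaleR)
    obtain T where T: "\<And>x. \<bar>\<theta> (G n x)\<bar> \<le> T" using Cb1D(4)[OF \<theta>C] by blast
    show i1: "integrable \<nu> (\<lambda>x. \<theta> (G n x) * adj \<phi> x)"
    proof (rule integrable_if_square_integrable_factors)
      show "AE x in \<nu>. \<bar>\<theta> (G n x) * adj \<phi> x\<bar> \<le> \<bar>T\<bar> * \<bar>B * weight x\<bar>"
        unfolding abs_mult[of "\<theta> _"] using order_trans[OF adj_le' abs_ge_self] order_trans[OF T abs_ge_self]
        by (intro AE_I2 mult_mono) auto
      show "integrable \<nu> (\<lambda>x. (B * weight x)\<^sup>2)" using weight_sq by (simp add: power_mult_distrib)
    qed simp_all
    show i2: "integrable \<nu> (u n)"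
    proof (rule integrable_if_square_integrable_factors)
      have "\<bar>inner (R (grad (G n) x)) (\<Psi> x)\<bar> \<le> Bn * norm (\<Psi> x)" for x
        using Cauchy_Schwarz_ineq2[of "R (grad (G n) x)" "\<Psi> x"]
          mult_right_mono[OF Bn(3)[of x] norm_ge_zero[of "\<Psi> x"]] by linarith
      moreover have "\<bar>\<theta>' (G n x) * \<phi> x\<bar> \<le> C * B" for x
        unfolding abs_mult using bd B C0 by (intro mult_mono) auto
      ultimately have "\<bar>u n x\<bar> \<le> (C * B) * (Bn * norm (\<Psi> x))" for x
        unfolding u_def abs_mult[of "_ * _" "inner _ _"] using C0 B(1) by (intro mult_mono) auto
      then show "AE x in \<nu>. \<bar>u n x\<bar> \<le> \<bar>C * B * Bn\<bar> * \<bar>norm (\<Psi> x)\<bar>"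
        using C0 B(1) Bn(1) by (simp add: mult.assoc)
      show "integrable \<nu> (\<lambda>x. (norm (\<Psi> x))\<^sup>2)" by (rule \<Psi>_sq)
    qed simp_all
    obtain TB where TB: "\<And>x. \<bar>\<theta> (G n x) * \<phi> x\<bar> \<le> TB" using Cb1D(4)[OF PC] by blast
    have i3: "integrable \<nu> (\<lambda>x. (\<theta> (G n x) * \<phi> x) * m x)"
    proof (rule integrable_if_square_integrable_factors)
      show "AE x in \<nu>. \<bar>\<theta> (G n x) * \<phi> x * m x\<bar> \<le> \<bar>TB\<bar> * \<bar>m x\<bar>"
        unfolding abs_mult[of "_ * _" "m _"] using order_trans[OF TB abs_ge_self]
        by (intro AE_I2 mult_right_mono) auto
    qed (use m_sq in simp_all)
    have "(\<integral>x. inner (R (grad (\<lambda>x. \<theta> (G n x) * \<phi> x) x)) (\<Psi> x) \<partial>\<nu>) = (\<integral>x. (\<theta> (G n x) * \<phi> x) * m x \<partial>\<nu>)"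
      by (rule adjoint_Cb1[OF Mstar_in_graph[OF field_dom, of 2] _ PC]) auto
    moreover have "inner (R (grad (\<lambda>x. \<theta> (G n x) * \<phi> x) x)) (\<Psi> x)
        = u n x + ((\<theta> (G n x) * \<phi> x) * m x - \<theta> (G n x) * adj \<phi> x)" for x
      unfolding gP u_def adj_def inner_add_left inner_scaleR_left by (simp add: algebra_simps)
    ultimately show "(\<integral>x. u n x \<partial>\<nu>) = (\<integral>x. \<theta> (G n x) * adj \<phi> x \<partial>\<nu>)"
      using i1 i2 i3 by simp
  qed
  have right: "(\<lambda>n. (\<integral>x. \<theta> (G n x) * adj \<phi> x \<partial>\<nu>) - (\<integral>x. \<theta> (g x) * adj \<phi> x \<partial>\<nu>)) \<longlonglongrightarrow> 0"
  proof -
    have "(\<lambda>n. \<integral>x. (\<theta> (G n x) - \<theta> (g x)) * adj \<phi> x \<partial>\<nu>) \<longlonglongrightarrow> 0"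
    proof (rule integral_tendsto_0_if_L2_factor[OF _ G(2) Bw G(3)])
      have "\<bar>(\<theta> (G n x) - \<theta> (g x)) * adj \<phi> x\<bar> \<le> (C * \<bar>G n x - g x\<bar>) * (B * weight x)" for n x
        unfolding abs_mult using C0 by (intro mult_mono lip\<theta> adj_le') auto
      then show "AE x in \<nu>. \<bar>(\<theta> (G n x) - \<theta> (g x)) * adj \<phi> x\<bar> \<le> \<bar>G n x - g x\<bar> * \<bar>C * (B * weight x)\<bar>" for n
        using C0 B(1) weight_nonneg by (simp add: abs_mult ac_simps)
    qed measurable
    moreover have "(\<integral>x. (\<theta> (G n x) - \<theta> (g x)) * adj \<phi> x \<partial>\<nu>)
        = (\<integral>x. \<theta> (G n x) * adj \<phi> x \<partial>\<nu>) - (\<integral>x. \<theta> (g x) * adj \<phi> x \<partial>\<nu>)" for n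
      using \<theta>adj \<theta>adj_n by (simp add: left_diff_distrib)
    ultimately show ?thesis by simp
  qed
  have left: "(\<lambda>n. (\<integral>x. u n x \<partial>\<nu>) - (\<integral>x. \<theta>' (g x) * \<phi> x \<partial>\<nu>)) \<longlonglongrightarrow> 0"
  proof -
    \<comment> \<open>Exchange first the field \<open>R \<nabla>(G n)\<close> for \<open>Mg\<close>, whose product with \<open>\<Psi>\<close> is 1, and then
      \<open>\<theta>' (G n)\<close> for \<open>\<theta>' (g)\<close>.\<close>
    define v where "v n x = \<theta>' (G n x) * \<phi> x * inner (R (grad (G n) x) - Mop \<nu> R g x) (\<Psi> x)" for n x
    define w where "w n x = (\<theta>' (G n x) - \<theta>' (g x)) * \<phi> x" for n x
    have [measurable]: "v n \<in> borel_measurable \<nu>" "w n \<in> borel_measurable \<nu>" for n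
      unfolding v_def[abs_def] w_def[abs_def] by measurable
    have CB: "integrable \<nu> (\<lambda>x. (C * B * norm (\<Psi> x))\<^sup>2)" using \<Psi>_sq by (simp add: power_mult_distrib)
    have v_le: "AE x in \<nu>. \<bar>v n x\<bar> \<le> \<bar>norm (R (grad (G n) x) - Mop \<nu> R g x)\<bar> * \<bar>C * B * norm (\<Psi> x)\<bar>" for n
    proof (rule AE_I2)
      fix x
      have "\<bar>v n x\<bar> \<le> (C * B) * (norm (R (grad (G n) x) - Mop \<nu> R g x) * norm (\<Psi> x))"
        unfolding v_def abs_mult using B(1) C0
        by (intro mult_mono Cauchy_Schwarz_ineq2 bd B(2)) auto
      then show "\<bar>v n x\<bar> \<le> \<bar>norm (R (grad (G n) x) - Mop \<nu> R g x)\<bar> * \<bar>C * B * norm (\<Psi> x)\<bar>"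
        using C0 B(1) by (simp add: abs_mult ac_simps)
    qed
    have w_le: "AE x in \<nu>. \<bar>w n x\<bar> \<le> \<bar>G n x - g x\<bar> * \<bar>K * B\<bar>" for n
    proof (rule AE_I2)
      fix x
      have "\<bar>w n x\<bar> \<le> (K * \<bar>G n x - g x\<bar>) * B"
        unfolding w_def abs_mult using B(1) K0 by (intro mult_mono lip B(2)) auto
      then show "\<bar>w n x\<bar> \<le> \<bar>G n x - g x\<bar> * \<bar>K * B\<bar>" using K0 B(1) by (simp add: ac_simps)
    qed
    have "(\<lambda>n. (\<integral>x. v n x \<partial>\<nu>) + (\<integral>x. w n x \<partial>\<nu>)) \<longlonglongrightarrow> 0 + 0"
      by (intro tendsto_add integral_tendsto_0_if_L2_factor[OF _ G(4) CB G(5) v_le]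
          integral_tendsto_0_if_L2_factor[OF _ G(2) square_integrable_const G(3) w_le]) measurable
    moreover have "(\<integral>x. v n x \<partial>\<nu>) + (\<integral>x. w n x \<partial>\<nu>) = (\<integral>x. u n x \<partial>\<nu>) - (\<integral>x. \<theta>' (g x) * \<phi> x \<partial>\<nu>)" for n
    proof -
      have "integrable \<nu> (v n)" "integrable \<nu> (w n)"
        by (rule integrable_if_square_integrable_factors[OF _ G(4) CB v_le]
          integrable_if_square_integrable_factors[OF _ G(2) square_integrable_const w_le]; measurable)+
      then have "(\<integral>x. v n x \<partial>\<nu>) + (\<integral>x. w n x \<partial>\<nu>) = (\<integral>x. v n x + w n x \<partial>\<nu>)" by simp
      also have "\<dots> = (\<integral>x. u n x - \<theta>' (g x) * \<phi> x \<partial>\<nu>)"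
        using inner_Mg_field
        by (intro integral_cong_AE)
          (auto elim!: eventually_mono simp: u_def v_def w_def inner_diff_left algebra_simps)
      also have "\<dots> = (\<integral>x. u n x \<partial>\<nu>) - (\<integral>x. \<theta>' (g x) * \<phi> x \<partial>\<nu>)"
        using u_int \<theta>'int by simp
      finally show ?thesis .
    qed
    ultimately show ?thesis by simp
  qed
  have "(\<lambda>n. (\<integral>x. u n x \<partial>\<nu>)) \<longlonglongrightarrow> (\<integral>x. \<theta>' (g x) * \<phi> x \<partial>\<nu>)"
    "(\<lambda>n. (\<integral>x. u n x \<partial>\<nu>)) \<longlonglongrightarrow> (\<integral>x. \<theta> (g x) * adj \<phi> x \<partial>\<nu>)"
    using left right by (simp_all add: LIM_zero_iff parts)
  then show ?thesis by (rule LIMSEQ_unique)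
qed

end

lemma CbD:
  assumes "\<phi> \<in> Cb"
  shows "continuous_on UNIV \<phi>" "\<exists>B>0. \<forall>x. \<bar>\<phi> x\<bar> \<le> B"
  using assms unfolding Cb_def bounded_pos by auto

context level_function
begin

lemma Cb_measurable: "\<phi> \<in> Cb \<Longrightarrow> \<phi> \<in> borel_measurable \<nu>"
  by (intro continuous_measurable CbD)

lemma bounded_mult_integrable:
  fixes k :: "'a \<Rightarrow> real"
  assumes "\<phi> \<in> Cb" and [measurable]: "k \<in> borel_measurable \<nu>" and k: "\<And>x. \<bar>k x\<bar> \<le> C"
  shows "integrable \<nu> (\<lambda>x. k x * \<phi> x)"
proof -
  obtain B where B: "\<And>x. \<bar>\<phi> x\<bar> \<le> B" using CbD(2)[OF assms(1)] by blast
  have [measurable]: "\<phi> \<in> borel_measurable \<nu>" by (rule Cb_measurable[OF assms(1)])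
  have "0 \<le> C" using k[of undefined] abs_ge_zero order_trans by blast
  then have "\<bar>k x\<bar> * \<bar>\<phi> x\<bar> \<le> C * B" for x by (intro mult_mono k B) auto
  then show ?thesis by (intro integrable_const_bound[of _ "C * B"]) (auto simp: abs_mult)
qed

lemma F_int_eq: "F_int \<nu> g \<phi> r = (\<integral>x. indicator {x. g x \<le> r} x * \<phi> x \<partial>\<nu>)"
  by (simp add: F_int_def set_lebesgue_integral_def)

text \<open>Up to the limit of the ramps \<open>ramp (1 + n (b - y))\<close>, which decrease to the indicator of
  \<open>y \<le> b\<close>, this is the integration by parts with \<open>\<theta>' = indicator {..b}\<close>.\<close>

lemma F_int_formula:
  assumes \<phi>: "\<phi> \<in> Cb1"
  shows "F_int \<nu> g \<phi> b = - (\<integral>x. max 0 (b - g x) * adj \<phi> x \<partial>\<nu>)"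
proof -
  obtain B where B: "B \<ge> 0" "\<And>x. \<bar>\<phi> x\<bar> \<le> B" "\<And>x. norm (R (grad \<phi> x)) \<le> B"
    using Cb1_bounds[OF \<phi>] by blast
  note [measurable] = Cb1_measurable[OF \<phi>] adj_measurable[OF \<phi>]
  define N where "N n = real (Suc n)" for n
  have N: "N n > 0" for n by (simp add: N_def)
  have limN: "filterlim N at_top sequentially"
    unfolding N_def using filterlim_real_sequentially by (rule filterlim_compose) (rule filterlim_Suc)
  define P where "P n y = ramp_prim (1 + N n * (b - y)) / N n" for n y
  define Q where "Q n y = ramp (1 + N n * (b - y))" for n y
  have DP: "DERIV (\<lambda>y. - P n y) y :> Q n y" for n y
  proof -
    have "DERIV (\<lambda>y. ramp_prim (1 + N n * (b - y))) y :> ramp (1 + N n * (b - y)) * (- N n)"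
      by (rule DERIV_chain2[OF DERIV_ramp_prim]) (auto intro!: derivative_eq_intros)
    then have "DERIV (\<lambda>y. - (ramp_prim (1 + N n * (b - y)) / N n)) y :> - (ramp (1 + N n * (b - y)) * (- N n) / N n)"
      by (intro DERIV_minus DERIV_cdivide)
    then show ?thesis using N[of n] by (simp add: P_def Q_def)
  qed
  have Q1: "\<bar>Q n y\<bar> \<le> 1" for n y using ramp_bounds by (simp add: Q_def abs_le_iff order_trans[of _ 0])
  have Qlip: "\<bar>Q n y - Q n z\<bar> \<le> N n * \<bar>y - z\<bar>" for n y z
  proof -
    have "\<bar>Q n y - Q n z\<bar> \<le> \<bar>(1 + N n * (b - y)) - (1 + N n * (b - z))\<bar>"
      unfolding Q_def by (rule ramp_bounds)
    also have "\<dots> = \<bar>N n * (z - y)\<bar>" by (simp add: algebra_simps)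
    finally show ?thesis using N[of n] by (simp add: abs_mult abs_minus_commute)
  qed
  have [measurable]: "P n \<in> borel_measurable borel" "Q n \<in> borel_measurable borel" for n
    unfolding P_def[abs_def] Q_def[abs_def] ramp_def ramp_prim_def by measurable
  have far: "\<forall>\<^sub>F n in sequentially. 1 + N n * (b - y) \<le> 0" if "b < y" for y
  proof -
    have "\<forall>\<^sub>F n in sequentially. 1 / (y - b) \<le> N n"
      using limN by (simp add: filterlim_at_top)
    then show ?thesis
      using that by (auto elim!: eventually_mono simp: field_simps)
  qed
  have lim_Q: "(\<lambda>n. \<integral>x. Q n (g x) * \<phi> x \<partial>\<nu>) \<longlonglongrightarrow> (\<integral>x. indicator {x. g x \<le> b} x * \<phi> x \<partial>\<nu>)"
  proof (rule integral_dominated_convergence[where w = "\<lambda>_. B"])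
    have Q_lim: "(\<lambda>n. Q n y) \<longlonglongrightarrow> (if y \<le> b then 1 else 0)" for y
    proof (cases "y \<le> b")
      case True
      then have "1 \<le> 1 + N n * (b - y)" for n using N[of n] by simp
      then have "Q n y = 1" for n by (simp add: Q_def ramp_def)
      then show ?thesis using True by simp
    next
      case False
      then have "\<forall>\<^sub>F n in sequentially. Q n y = 0"
        using far[of y] by (auto elim!: eventually_mono simp: Q_def ramp_def)
      then show ?thesis using False by (simp add: tendsto_eventually)
    qed
    have "(\<lambda>n. Q n (g x)) \<longlonglongrightarrow> indicator {x. g x \<le> b} x" for x
      using Q_lim[of "g x"] by (cases "g x \<le> b") simp_all
    then show "AE x in \<nu>. (\<lambda>n. Q n (g x) * \<phi> x) \<longlonglongrightarrow> indicator {x. g x \<le> b} x * \<phi> x"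
      by (intro AE_I2 tendsto_mult tendsto_const)
    have "\<bar>Q n (g x) * \<phi> x\<bar> \<le> 1 * B" for n x
      unfolding abs_mult by (intro mult_mono Q1 B(2)) auto
    then show "AE x in \<nu>. norm (Q n (g x) * \<phi> x) \<le> B" for n by simp
  qed simp_all
  have lim_P: "(\<lambda>n. \<integral>x. - P n (g x) * adj \<phi> x \<partial>\<nu>) \<longlonglongrightarrow> (\<integral>x. - max 0 (b - g x) * adj \<phi> x \<partial>\<nu>)"
  proof (rule integral_dominated_convergence[where w = "\<lambda>x. (\<bar>b\<bar> + \<bar>g x\<bar> + 1) * (B * weight x)"])
    have "(\<lambda>n. P n y) \<longlonglongrightarrow> max 0 (b - y)" for y
    proof (cases "y \<le> b")
      case True
      have "P n y = (b - y) + 1 / 2 / N n" for n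
      proof -
        have "1 \<le> 1 + N n * (b - y)" using N[of n] True by simp
        then have "ramp_prim (1 + N n * (b - y)) = 1 / 2 + N n * (b - y)"
          by (simp add: ramp_prim_ge_1)
        then show ?thesis using N[of n] by (simp add: P_def add_divide_distrib)
      qed
      moreover have "(\<lambda>n. (b - y) + 1 / 2 / N n) \<longlonglongrightarrow> (b - y) + 0"
        by (intro tendsto_add tendsto_const tendsto_divide_0[OF tendsto_const]
            filterlim_at_top_imp_at_infinity limN)
      ultimately show ?thesis using True by simp
    next
      case False
      then have "\<forall>\<^sub>F n in sequentially. P n y = 0"
        using far[of y] by (auto elim!: eventually_mono simp: P_def ramp_prim_nonpos)
      then show ?thesis using False by (simp add: tendsto_eventually)
    qed
    then show "AE x in \<nu>. (\<lambda>n. - P n (g x) * adj \<phi> x) \<longlonglongrightarrow> - max 0 (b - g x) * adj \<phi> x"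
      by (intro AE_I2 tendsto_mult tendsto_minus tendsto_const)
    have P_le: "\<bar>P n y\<bar> \<le> \<bar>b\<bar> + \<bar>y\<bar> + 1" for n y
    proof -
      have "ramp_prim (1 + N n * (b - y)) \<le> max 0 (1 + N n * (b - y))"
        using ramp_prim_bounds by blast
      also have "\<dots> \<le> N n * (\<bar>b\<bar> + \<bar>y\<bar> + 1)"
      proof -
        have "N n * (b - y) \<le> N n * (\<bar>b\<bar> + \<bar>y\<bar>)" using N[of n] by (intro mult_left_mono) auto
        moreover have "1 \<le> N n" by (simp add: N_def)
        moreover have "0 \<le> N n * (\<bar>b\<bar> + \<bar>y\<bar> + 1)" using N[of n] by simp
        ultimately show ?thesis by (simp add: distrib_left)
      qed
      finally have "P n y \<le> \<bar>b\<bar> + \<bar>y\<bar> + 1"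
        using N[of n] by (simp add: P_def divide_le_eq mult.commute)
      moreover have "0 \<le> P n y" using N[of n] ramp_prim_bounds by (simp add: P_def)
      ultimately show ?thesis by simp
    qed
    have "\<bar>- P n (g x) * adj \<phi> x\<bar> \<le> (\<bar>b\<bar> + \<bar>g x\<bar> + 1) * (B * weight x)" for n x
      unfolding abs_mult abs_minus_cancel by (intro mult_mono P_le adj_le B) auto
    then show "AE x in \<nu>. norm (- P n (g x) * adj \<phi> x) \<le> (\<bar>b\<bar> + \<bar>g x\<bar> + 1) * (B * weight x)" for n
      by simp
    show "integrable \<nu> (\<lambda>x. (\<bar>b\<bar> + \<bar>g x\<bar> + 1) * (B * weight x))"
    proof -
      have "integrable \<nu> (\<lambda>x. \<bar>g x\<bar> * weight x)"
        by (rule integrable_if_square_integrable_factors[OF _ g_sq weight_sq])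
          (auto simp: abs_mult)
      then have "integrable \<nu> (\<lambda>x. (\<bar>b\<bar> + 1) * B * weight x + B * (\<bar>g x\<bar> * weight x))"
        using weight_integrable by simp
      then show ?thesis by (simp add: algebra_simps)
    qed
  qed simp_all
  have "(\<integral>x. Q n (g x) * \<phi> x \<partial>\<nu>) = (\<integral>x. - P n (g x) * adj \<phi> x \<partial>\<nu>)" for n
    by (rule integration_by_parts[OF DP Q1 Qlip \<phi>])
  then have "(\<lambda>n. \<integral>x. Q n (g x) * \<phi> x \<partial>\<nu>) \<longlonglongrightarrow> (\<integral>x. - max 0 (b - g x) * adj \<phi> x \<partial>\<nu>)"
    using lim_P by (simp only:)
  with lim_Q have "(\<integral>x. indicator {x. g x \<le> b} x * \<phi> x \<partial>\<nu>) = (\<integral>x. - max 0 (b - g x) * adj \<phi> x \<partial>\<nu>)"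
    by (rule LIMSEQ_unique)
  then show ?thesis by (simp add: F_int_eq)
qed

lemma adj_integrable:
  assumes "\<phi> \<in> Cb1" "k \<in> borel_measurable \<nu>" "\<And>x. \<bar>k x\<bar> \<le> (C::real)"
  shows "integrable \<nu> (\<lambda>x. k x * adj \<phi> x)"
proof -
  obtain B where B: "B \<ge> 0" "\<And>x. \<bar>\<phi> x\<bar> \<le> B" "\<And>x. norm (R (grad \<phi> x)) \<le> B"
    using Cb1_bounds[OF assms(1)] by blast
  note [measurable] = adj_measurable[OF assms(1)] assms(2)
  show ?thesis
  proof (rule Bochner_Integration.integrable_bound)
    show "integrable \<nu> (\<lambda>x. C * (B * weight x))" using weight_integrable by simp
    have le: "\<bar>k x * adj \<phi> x\<bar> \<le> C * (B * weight x)" for x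
      unfolding abs_mult using order_trans[OF abs_ge_zero assms(3)]
      by (intro mult_mono assms(3) adj_le B) auto
    show "AE x in \<nu>. norm (k x * adj \<phi> x) \<le> norm (C * (B * weight x))"
      unfolding real_norm_def by (intro AE_I2 order_trans[OF le abs_ge_self])
  qed measurable
qed

text \<open>The difference quotient at \<open>r\<close> of \<open>b \<mapsto> max 0 (b - g x)\<close>, and that of the indicator of
  \<open>g x \<le> b\<close>.\<close>

definition slope :: "real \<Rightarrow> real \<Rightarrow> 'a \<Rightarrow> real" where
  "slope r t x = (max 0 (r + t - g x) - max 0 (r - g x)) / t"

definition shell :: "real \<Rightarrow> real \<Rightarrow> 'a \<Rightarrow> real" where
  "shell r t x = (indicator {x. g x \<le> r + t} x - indicator {x. g x \<le> r} x) / t"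

lemma slope_measurable [measurable]: "slope r t \<in> borel_measurable \<nu>"
  and shell_measurable [measurable]: "shell r t \<in> borel_measurable \<nu>"
  unfolding slope_def[abs_def] shell_def[abs_def] by measurable

lemma slope_le: "\<bar>slope r t x\<bar> \<le> 1"
proof (cases "t = 0")
  case False
  have "\<bar>max 0 (r + t - g x) - max 0 (r - g x)\<bar> \<le> \<bar>t\<bar>" by (auto simp: max_def)
  then show ?thesis using False by (simp add: slope_def abs_divide)
qed (simp add: slope_def)

lemma shell_nonneg: "0 \<le> shell r t x"
  by (cases t "0::real" rule: linorder_cases)
    (auto simp: shell_def indicator_def divide_nonneg_neg zero_le_divide_iff)

lemma shell_le: "\<bar>shell r t x\<bar> \<le> 1 / \<bar>t\<bar>"
  by (auto simp: shell_def indicator_def abs_divide intro!: divide_right_mono)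

lemma F_int_quotient:
  assumes "\<phi> \<in> Cb"
  shows "(F_int \<nu> g \<phi> (r + t) - F_int \<nu> g \<phi> r) / t = (\<integral>x. shell r t x * \<phi> x \<partial>\<nu>)"
proof -
  have "integrable \<nu> (\<lambda>x. indicator {x. g x \<le> b} x * \<phi> x)" for b
    by (rule bounded_mult_integrable[OF assms, of _ 1]) (auto simp: indicator_def)
  then have "F_int \<nu> g \<phi> (r + t) - F_int \<nu> g \<phi> r
    = (\<integral>x. indicator {x. g x \<le> r + t} x * \<phi> x - indicator {x. g x \<le> r} x * \<phi> x \<partial>\<nu>)"
    by (simp add: F_int_eq)
  moreover have "shell r t x * \<phi> x = (indicator {x. g x \<le> r + t} x * \<phi> x - indicator {x. g x \<le> r} x * \<phi> x) / t" for x
    by (simp add: shell_def left_diff_distrib diff_divide_distrib)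
  ultimately show ?thesis by simp
qed

lemma F_int_quotient_adj:
  assumes \<phi>: "\<phi> \<in> Cb1"
  shows "(F_int \<nu> g \<phi> (r + t) - F_int \<nu> g \<phi> r) / t = - (\<integral>x. slope r t x * adj \<phi> x \<partial>\<nu>)"
proof -
  obtain B where B: "B \<ge> 0" "\<And>x. \<bar>\<phi> x\<bar> \<le> B" "\<And>x. norm (R (grad \<phi> x)) \<le> B"
    using Cb1_bounds[OF \<phi>] by blast
  note [measurable] = adj_measurable[OF \<phi>]
  have int: "integrable \<nu> (\<lambda>x. max 0 (b - g x) * adj \<phi> x)" for b
  proof (rule Bochner_Integration.integrable_bound)
    have "integrable \<nu> (\<lambda>x. \<bar>g x\<bar> * weight x)"
      by (rule integrable_if_square_integrable_factors[OF _ g_sq weight_sq]) (auto simp: abs_mult)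
    then show "integrable \<nu> (\<lambda>x. \<bar>b\<bar> * B * weight x + B * (\<bar>g x\<bar> * weight x))"
      using weight_integrable by simp
    have "\<bar>max 0 (b - g x)\<bar> * \<bar>adj \<phi> x\<bar> \<le> (\<bar>b\<bar> + \<bar>g x\<bar>) * (B * weight x)" for x
      by (intro mult_mono adj_le B) auto
    then show "AE x in \<nu>. norm (max 0 (b - g x) * adj \<phi> x) \<le> norm (\<bar>b\<bar> * B * weight x + B * (\<bar>g x\<bar> * weight x))"
      by (intro AE_I2) (auto simp: abs_mult algebra_simps intro: order_trans[OF _ abs_ge_self])
  qed measurable
  have "F_int \<nu> g \<phi> (r + t) - F_int \<nu> g \<phi> r
      = - (\<integral>x. max 0 (r + t - g x) * adj \<phi> x - max 0 (r - g x) * adj \<phi> x \<partial>\<nu>)"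
    using int by (simp add: F_int_formula[OF \<phi>])
  moreover have "slope r t x * adj \<phi> x
      = (max 0 (r + t - g x) * adj \<phi> x - max 0 (r - g x) * adj \<phi> x) / t" for x
    by (simp add: slope_def left_diff_distrib diff_divide_distrib)
  ultimately show ?thesis by simp
qed

text \<open>The distribution function of \<open>g\<close> is Lipschitz, so that no level set carries mass.\<close>

lemma AE_not_level: "AE x in \<nu>. g x \<noteq> r"
proof -
  define I where "I = (\<integral>x. \<bar>m x\<bar> \<partial>\<nu>)"
  have mi: "integrable \<nu> m" using adj_integrable[of "\<lambda>_. 1" "\<lambda>_. 1" 1] by (simp add: adj_one)
  have I: "0 \<le> I" by (simp add: I_def)
  let ?A = "{x. g x = r}"
  have A[measurable]: "?A \<in> sets \<nu>" by measurable
  have less: "prob ?A \<le> t * I" if t: "t > 0" for t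
  proof -
    have "prob ?A = (\<integral>x. indicator ?A x \<partial>\<nu>)" by simp
    also have "\<dots> \<le> (\<integral>x. t * shell r (- t) x \<partial>\<nu>)"
    proof (rule integral_mono)
      show "integrable \<nu> (\<lambda>x. t * shell r (- t) x)"
      proof -
        have "integrable \<nu> (\<lambda>x. shell r (- t) x * 1)"
          by (rule bounded_mult_integrable[OF Cb1_subset_Cb[OF Cb1_const] shell_measurable shell_le])
        then show ?thesis by simp
      qed
      show "indicator ?A x \<le> t * shell r (- t) x" for x
        using t by (auto simp: shell_def indicator_def field_simps)
    qed (simp add: less_top[symmetric])
    also have "\<dots> = t * ((F_int \<nu> g (\<lambda>_. 1) (r + - t) - F_int \<nu> g (\<lambda>_. 1) r) / (- t))"
      by (subst F_int_quotient) (auto intro: Cb1_subset_Cb)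
    also have "\<dots> = t * - (\<integral>x. slope r (- t) x * m x \<partial>\<nu>)"
      by (subst F_int_quotient_adj) (auto simp: adj_one)
    also have "- (\<integral>x. slope r (- t) x * m x \<partial>\<nu>) \<le> \<bar>\<integral>x. slope r (- t) x * m x \<partial>\<nu>\<bar>" by linarith
    also have "\<dots> \<le> (\<integral>x. \<bar>slope r (- t) x * m x\<bar> \<partial>\<nu>)" by (rule integral_abs_bound)
    also have "\<dots> \<le> I"
      unfolding I_def
    proof (rule integral_mono)
      show "integrable \<nu> (\<lambda>x. \<bar>slope r (- t) x * m x\<bar>)"
        using adj_integrable[of "\<lambda>_. 1" "slope r (- t)" 1] slope_le by (simp add: adj_one)
      show "\<bar>slope r (- t) x * m x\<bar> \<le> \<bar>m x\<bar>" for x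
        using mult_right_mono[OF slope_le, of "\<bar>m x\<bar>"] by (simp add: abs_mult)
    qed (use mi in simp)
    finally show ?thesis using t by simp
  qed
  have "prob ?A \<le> 0"
  proof (rule field_le_epsilon)
    fix e :: real assume e: "0 < e"
    have "prob ?A \<le> e / (I + 1) * I" using e I by (intro less) simp
    also have "\<dots> \<le> 0 + e" using e I by (simp add: field_simps)
    finally show "prob ?A \<le> 0 + e" .
  qed
  then have "prob ?A = 0" using measure_nonneg[of \<nu> ?A] by linarith
  then show ?thesis using A by (simp add: prob_eq_0)
qed

section \<open>Derivatives for \<open>Cb1\<close> functions and tightness\<close>

text \<open>\<open>level_density \<phi> r\<close> will turn out to be the derivative of \<open>F_int \<nu> g \<phi>\<close> at \<open>r\<close>, and
  \<open>defect r t\<close> controls the error of the difference quotient with increment \<open>t\<close>.\<close>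

definition level_density :: "('a \<Rightarrow> real) \<Rightarrow> real \<Rightarrow> real" where
  "level_density \<phi> r = - (\<integral>x. indicator {x. g x < r} x * adj \<phi> x \<partial>\<nu>)"

definition defect :: "real \<Rightarrow> real \<Rightarrow> real" where
  "defect r t = (\<integral>x. \<bar>slope r t x - indicator {x. g x < r} x\<bar> * weight x \<partial>\<nu>)"

lemma slope_tendsto:
  assumes "g x \<noteq> r"
  shows "((\<lambda>t. slope r t x) \<longlongrightarrow> indicator {x. g x < r} x) (at 0)"
proof (cases "g x < r")
  case True
  have "\<forall>\<^sub>F t in at 0. slope r t x = 1"
    unfolding eventually_at
    by (rule exI[of _ "r - g x"]) (use True in \<open>auto simp: slope_def max_def dist_real_def\<close>)
  then show ?thesis using True by (simp add: tendsto_eventually)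
next
  case False
  then have "r < g x" using assms by simp
  then have "\<forall>\<^sub>F t in at 0. slope r t x = 0"
    unfolding eventually_at
    by (intro exI[of _ "g x - r"]) (auto simp: slope_def max_def dist_real_def)
  then show ?thesis using False by (simp add: tendsto_eventually)
qed

lemma defect_tendsto_0: "(defect r \<longlongrightarrow> 0) (at 0)"
  unfolding tendsto_at_iff_sequentially
proof (intro allI impI)
  fix X :: "nat \<Rightarrow> real" assume X: "\<forall>i. X i \<in> UNIV - {0}" "X \<longlonglongrightarrow> 0"
  have lim: "(\<lambda>i. slope r (X i) x) \<longlonglongrightarrow> indicator {x. g x < r} x" if "g x \<noteq> r" for x
    using slope_tendsto[OF that] X unfolding tendsto_at_iff_sequentially comp_def by blast
  have "(\<lambda>i. \<integral>x. \<bar>slope r (X i) x - indicator {x. g x < r} x\<bar> * weight x \<partial>\<nu>) \<longlonglongrightarrow> (\<integral>x. 0 \<partial>\<nu>)"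
  proof (rule integral_dominated_convergence[where w = "\<lambda>x. 2 * weight x"])
    show "AE x in \<nu>. (\<lambda>i. \<bar>slope r (X i) x - indicator {x. g x < r} x\<bar> * weight x) \<longlonglongrightarrow> 0"
      using AE_not_level[of r]
    proof eventually_elim
      case (elim x)
      have "(\<lambda>i. \<bar>slope r (X i) x - indicator {x. g x < r} x\<bar> * weight x) \<longlonglongrightarrow>
        \<bar>indicator {x. g x < r} x - indicator {x. g x < r} x\<bar> * weight x"
        by (intro tendsto_intros lim elim)
      then show ?case by simp
    qed
    have "\<bar>slope r (X i) x - indicator {x. g x < r} x\<bar> \<le> 2" for i x
      using slope_le[of r "X i" x] by (auto simp: indicator_def)
    then show "AE x in \<nu>. norm (\<bar>slope r (X i) x - indicator {x. g x < r} x\<bar> * weight x) \<le> 2 * weight x" for i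
      using weight_nonneg by (simp add: abs_mult mult_right_mono)
  qed (use weight_integrable in simp_all)
  then show "(defect r \<circ> X) \<longlonglongrightarrow> 0" by (simp add: comp_def defect_def)
qed

text \<open>The error of the difference quotient depends on \<open>\<phi>\<close> only through bounds for \<open>\<phi>\<close> and
  \<open>R \<nabla>\<phi>\<close>.  This uniformity makes limits in \<open>\<phi>\<close> and in \<open>t\<close> interchangeable.\<close>

lemma quotient_minus_density:
  assumes \<phi>: "\<phi> \<in> Cb1" and B: "\<And>x. \<bar>\<phi> x\<bar> \<le> B" "\<And>x. norm (R (grad \<phi> x)) \<le> B"
  shows "\<bar>(\<integral>x. shell r t x * \<phi> x \<partial>\<nu>) - level_density \<phi> r\<bar> \<le> B * defect r t"
proof -
  note [measurable] = adj_measurable[OF \<phi>]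
  let ?k = "\<lambda>x. slope r t x - indicator {x. g x < r} x"
  have k: "\<bar>?k x\<bar> \<le> 2" for x using slope_le[of r t x] by (auto simp: indicator_def)
  have i: "integrable \<nu> (\<lambda>x. slope r t x * adj \<phi> x)"
    "integrable \<nu> (\<lambda>x. indicator {x. g x < r} x * adj \<phi> x)"
    "integrable \<nu> (\<lambda>x. ?k x * adj \<phi> x)"
    by (rule adj_integrable[OF \<phi> _ slope_le] adj_integrable[OF \<phi>, of _ 1] adj_integrable[OF \<phi> _ k];
        simp add: indicator_def)+
  have "(\<integral>x. shell r t x * \<phi> x \<partial>\<nu>) - level_density \<phi> r = - (\<integral>x. ?k x * adj \<phi> x \<partial>\<nu>)"
    using i(1,2) F_int_quotient[OF Cb1_subset_Cb[OF \<phi>], of r t] F_int_quotient_adj[OF \<phi>, of r t]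
    by (simp add: level_density_def left_diff_distrib)
  then have "\<bar>(\<integral>x. shell r t x * \<phi> x \<partial>\<nu>) - level_density \<phi> r\<bar> \<le> (\<integral>x. \<bar>?k x * adj \<phi> x\<bar> \<partial>\<nu>)"
    using integral_abs_bound[of \<nu> "\<lambda>x. ?k x * adj \<phi> x"] by simp
  also have "\<dots> \<le> (\<integral>x. B * (\<bar>?k x\<bar> * weight x) \<partial>\<nu>)"
  proof (rule integral_mono)
    show "integrable \<nu> (\<lambda>x. \<bar>?k x * adj \<phi> x\<bar>)" using i(3) by simp
    have "integrable \<nu> (\<lambda>x. \<bar>?k x\<bar> * weight x)"
    proof (rule Bochner_Integration.integrable_bound)
      show "integrable \<nu> (\<lambda>x. 2 * weight x)" using weight_integrable by simp
      show "AE x in \<nu>. norm (\<bar>?k x\<bar> * weight x) \<le> norm (2 * weight x)"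
        using k weight_nonneg by (intro AE_I2) (simp add: abs_mult mult_right_mono)
    qed measurable
    then show "integrable \<nu> (\<lambda>x. B * (\<bar>?k x\<bar> * weight x))" by simp
    show "\<bar>?k x * adj \<phi> x\<bar> \<le> B * (\<bar>?k x\<bar> * weight x)" for x
      using mult_left_mono[OF adj_le[of \<phi> x B], of "\<bar>?k x\<bar>"] B by (simp add: abs_mult ac_simps)
  qed
  also have "\<dots> = B * defect r t" by (simp add: defect_def)
  finally show ?thesis .
qed

lemma quotient_tendsto_Cb1:
  assumes \<phi>: "\<phi> \<in> Cb1"
  shows "((\<lambda>t. \<integral>x. shell r t x * \<phi> x \<partial>\<nu>) \<longlongrightarrow> level_density \<phi> r) (at 0)"
proof -
  obtain B where B: "B \<ge> 0" "\<And>x. \<bar>\<phi> x\<bar> \<le> B" "\<And>x. norm (R (grad \<phi> x)) \<le> B"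
    using Cb1_bounds[OF \<phi>] by blast
  have "((\<lambda>t. (\<integral>x. shell r t x * \<phi> x \<partial>\<nu>) - level_density \<phi> r) \<longlongrightarrow> 0) (at 0)"
  proof (rule Lim_null_comparison)
    show "\<forall>\<^sub>F t in at 0. norm ((\<integral>x. shell r t x * \<phi> x \<partial>\<nu>) - level_density \<phi> r) \<le> B * defect r t"
      using quotient_minus_density[OF \<phi> B(2,3)] by (intro always_eventually) simp
    show "((\<lambda>t. B * defect r t) \<longlongrightarrow> 0) (at 0)"
      using tendsto_mult[OF tendsto_const defect_tendsto_0, of B r] by simp
  qed
  then show ?thesis by (rule LIM_zero_cancel)
qed

text \<open>The difference quotients are integrals against the nonnegative functions \<open>shell r t\<close>, and
  positivity survives in the limit.\<close>

lemma positive_functional_level_density: "positive_functional (\<lambda>\<phi>. level_density \<phi> r)"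
proof
  have i: "integrable \<nu> (\<lambda>x. indicator {x. g x < r} x * adj \<phi> x)" if "\<phi> \<in> Cb1" for \<phi>
    by (rule adj_integrable[OF that, of _ 1]) (auto simp: indicator_def)
  show "level_density (\<lambda>x. f x + h x) r = level_density f r + level_density h r"
    if "f \<in> Cb1" "h \<in> Cb1" for f h
    using i[OF that(1)] i[OF that(2)] that
    by (simp add: level_density_def adj_add distrib_left)
  show "level_density (\<lambda>x. c * f x) r = c * level_density f r" if "f \<in> Cb1" for f c
    using that by (simp add: level_density_def adj_cmult mult.left_commute)
  show "0 \<le> level_density f r" if f: "f \<in> Cb1" "\<And>x. 0 \<le> f x" for f
  proof (rule tendsto_lowerbound[OF quotient_tendsto_Cb1[OF f(1)]])
    show "\<forall>\<^sub>F t in at 0. 0 \<le> (\<integral>x. shell r t x * f x \<partial>\<nu>)"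
      using f(2) shell_nonneg by (intro always_eventually allI integral_nonneg_AE AE_I2) simp
  qed simp
qed

text \<open>For fixed \<open>t\<close> the difference quotients of the functions \<open>d k\<close>, which tend to 0 with
  uniformly bounded gradients, tend to 0 by dominated convergence; by the uniform error bound
  so do the derivatives.\<close>

lemma level_density_tight:
  assumes "\<eta> > 0" "e > 0"
  shows "\<exists>u\<in>Cb1. (\<forall>x. 0 \<le> u x) \<and> level_density u r \<le> \<eta> \<and>
      (\<exists>F. finite F \<and> {x. u x < 1} \<subseteq> (\<Union>a\<in>F. ball a e))"
proof -
  interpret L: positive_functional "\<lambda>\<phi>. level_density \<phi> r" by (rule positive_functional_level_density)
  obtain d :: "nat \<Rightarrow> 'a \<Rightarrow> real" where d: "\<And>k. d k \<in> Cb1" "\<And>k x. 0 \<le> d k x" "\<And>k x. d k x \<le> 1"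
    "\<And>k x. norm (grad (d k) x) \<le> 1" "\<And>x. (\<lambda>k. d k x) \<longlonglongrightarrow> 0"
    "\<And>k t. t \<le> 1/2 \<Longrightarrow> \<exists>F. finite F \<and> {x. d k x < t} \<subseteq> (\<Union>a\<in>F. ball a (sqrt (2 * t)))"
    using soft_distance_to_dense_sequence by blast
  obtain K where K: "K \<ge> 0" "\<And>x. norm (R x) \<le> norm x * K"
    using bounded_linear.nonneg_bounded[OF R] by blast
  define B where "B = max 1 K"
  have B: "\<bar>d k x\<bar> \<le> B" "norm (R (grad (d k) x)) \<le> B" for k x
    using d(2,3)[of k x] K(2)[of "grad (d k) x"] mult_right_mono[OF d(4)[of k x] K(1)]
    by (auto simp: B_def)
  have "(\<lambda>k. level_density (d k) r) \<longlonglongrightarrow> 0"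
  proof (rule LIMSEQ_I)
    fix \<epsilon> :: real assume \<epsilon>: "\<epsilon> > 0"
    have "((\<lambda>t. B * defect r t) \<longlongrightarrow> 0) (at 0)"
      using tendsto_mult[OF tendsto_const defect_tendsto_0, of B r] by simp
    then have "\<forall>\<^sub>F t in at 0. B * defect r t < \<epsilon> / 2 \<and> t \<noteq> 0"
      using \<epsilon> by (intro eventually_conj order_tendstoD(2)[where y = 0] eventually_neq_at_within) auto
    then obtain t where t: "B * defect r t < \<epsilon> / 2" "t \<noteq> 0"
      using eventually_happens[of _ "at (0::real)"] by auto
    have "(\<lambda>k. \<integral>x. shell r t x * d k x \<partial>\<nu>) \<longlonglongrightarrow> (\<integral>x. shell r t x * 0 \<partial>\<nu>)"
    proof (rule integral_dominated_convergence[where w = "\<lambda>_. 1 / \<bar>t\<bar>"])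
      show "AE x in \<nu>. (\<lambda>k. shell r t x * d k x) \<longlonglongrightarrow> shell r t x * 0"
        by (intro AE_I2 tendsto_mult tendsto_const d)
      have "\<bar>shell r t x\<bar> * \<bar>d k x\<bar> \<le> 1 / \<bar>t\<bar> * 1" for k x
        using d(2,3) by (intro mult_mono shell_le) auto
      then show "AE x in \<nu>. norm (shell r t x * d k x) \<le> 1 / \<bar>t\<bar>" for k by (simp add: abs_mult)
    qed (use Cb1_measurable[OF d(1)] in simp_all)
    then obtain N where N: "\<And>k. k \<ge> N \<Longrightarrow> \<bar>\<integral>x. shell r t x * d k x \<partial>\<nu>\<bar> < \<epsilon> / 2"
      using LIMSEQ_D[of _ 0 "\<epsilon> / 2"] \<epsilon> by force
    have "norm (level_density (d k) r - 0) < \<epsilon>" if "k \<ge> N" for k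
      using N[OF that] t(1) quotient_minus_density[where \<phi> = "d k" and r = r and t = t, OF d(1) B]
      by simp
    then show "\<exists>no. \<forall>n\<ge>no. norm (level_density (d n) r - 0) < \<epsilon>" by blast
  qed
  moreover define t where "t = min (1/2) (e\<^sup>2 / 2)"
  have t: "0 < t" "t \<le> 1/2" "sqrt (2 * t) \<le> e"
    using assms(2) by (auto simp: t_def intro!: real_le_lsqrt)
  ultimately obtain k where k: "level_density (d k) r < \<eta> * t"
    using order_tendstoD(2)[of "\<lambda>k. level_density (d k) r" 0 sequentially "\<eta> * t"] assms(1)
      eventually_happens[of _ sequentially] by auto
  obtain F where F: "finite F" "{x. d k x < t} \<subseteq> (\<Union>a\<in>F. ball a (sqrt (2 * t)))"
    using d(6)[OF t(2)] by blast
  show ?thesis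
  proof (intro bexI[of _ "\<lambda>x. 1 / t * d k x"] conjI allI exI[of _ F])
    show "(\<lambda>x. 1 / t * d k x) \<in> Cb1" by (intro Cb1_cmult d)
    show "0 \<le> 1 / t * d k x" for x using t d(2) by simp
    show "level_density (\<lambda>x. 1 / t * d k x) r \<le> \<eta>"
      using k t(1) by (subst L.L_cmult[OF d(1)]) (simp add: field_simps)
    have "{x. 1 / t * d k x < 1} = {x. d k x < t}" using t(1) by (simp add: field_simps)
    moreover have "(\<Union>a\<in>F. ball a (sqrt (2 * t))) \<subseteq> (\<Union>a\<in>F. ball a e)"
      using t(3) by (intro UN_mono subset_ball order_refl)
    ultimately show "{x. 1 / t * d k x < 1} \<subseteq> (\<Union>a\<in>F. ball a e)"
      using F(2) by (simp only:)
  qed (rule F)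
qed

section \<open>Surface measures\<close>

definition surface :: "real \<Rightarrow> 'a measure" where
  "surface r = positive_functional.represent (\<lambda>\<phi>. level_density \<phi> r)"

lemma surface_basic:
  shows sets_surface: "sets (surface r) = sets borel" and finite_surface: "finite_measure (surface r)"
    and surface_mass: "measure (surface r) UNIV = level_density (\<lambda>_. 1) r"
proof -
  interpret L: positive_functional "\<lambda>\<phi>. level_density \<phi> r" by (rule positive_functional_level_density)
  show "sets (surface r) = sets borel" "finite_measure (surface r)"
    unfolding surface_def by (rule L.sets_represent, unfold_locales)
  show "measure (surface r) UNIV = level_density (\<lambda>_. 1) r"
    unfolding surface_def by (rule L.represent_mass[OF level_density_tight])
qed

lemma Cb_integrable_surface:
  assumes "\<phi> \<in> Cb"
  shows "integrable (surface r) \<phi>"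
proof -
  obtain B where B: "\<And>x. \<bar>\<phi> x\<bar> \<le> B" using CbD(2)[OF assms] by blast
  have "\<phi> \<in> borel_measurable (surface r)"
    using borel_measurable_continuous_onI[OF CbD(1)[OF assms]]
    by (simp add: measurable_cong_sets[OF sets_surface refl])
  then show ?thesis
    using B by (intro finite_measure.integrable_const_bound[OF finite_surface, of _ B]) auto
qed

text \<open>Functions of \<open>Cb1\<close> inscribed in \<open>\<phi>\<close> bound the difference quotients from below, functions
  inscribed in \<open>1 - \<phi>\<close> bound them from above; the total mass closes the gap.\<close>

lemma quotient_tendsto_unit:
  assumes c: "continuous_on UNIV \<phi>" and \<phi>: "\<And>x. 0 \<le> \<phi> x" "\<And>x. \<phi> x \<le> 1"
  shows "((\<lambda>t. \<integral>x. shell r t x * \<phi> x \<partial>\<nu>) \<longlongrightarrow> (\<integral>x. \<phi> x \<partial>surface r)) (at 0)"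
proof (rule tendstoI)
  interpret L: positive_functional "\<lambda>\<phi>. level_density \<phi> r" by (rule positive_functional_level_density)
  define Q where "Q f t = (\<integral>x. shell r t x * f x \<partial>\<nu>)" for f t
  define I where "I = (\<integral>x. \<phi> x \<partial>surface r)"
  define q where "q = level_density (\<lambda>_. 1) r"
  have Cb: "\<phi> \<in> Cb" "(\<lambda>x. 1 - \<phi> x) \<in> Cb"
    using c \<phi> by (auto simp: Cb_def bounded_iff intro!: exI[of _ 1] continuous_intros)
  have Cb_one: "(\<lambda>_::'a. 1) \<in> Cb" by (rule Cb1_subset_Cb[OF Cb1_const])
  have Q_mono: "Q f t \<le> Q h t" if "f \<in> Cb" "h \<in> Cb" "\<And>x. f x \<le> h x" for f h t
    unfolding Q_def using that shell_nonneg
    by (intro integral_mono bounded_mult_integrable[OF _ shell_measurable shell_le] mult_left_mono)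
  have Q_compl: "Q (\<lambda>x. 1 - \<phi> x) t = Q (\<lambda>_. 1) t - Q \<phi> t" for t
    using bounded_mult_integrable[OF Cb_one shell_measurable shell_le]
      bounded_mult_integrable[OF Cb(1) shell_measurable shell_le]
    by (simp add: Q_def right_diff_distrib)
  have I_compl: "(\<integral>x. 1 - \<phi> x \<partial>surface r) = q - I"
  proof -
    have "(\<integral>x. 1 \<partial>surface r) = measure (surface r) UNIV"
      using sets_eq_imp_space_eq[OF sets_surface] by simp
    then show ?thesis
      using Bochner_Integration.integral_diff[OF Cb_integrable_surface[OF Cb_one, of r] Cb_integrable_surface[OF Cb(1), of r]]
      by (simp add: I_def q_def surface_mass)
  qed
  fix e :: real assume e: "e > 0"
  have e3: "e / 3 > 0" using e by simp
  obtain \<psi> where \<psi>: "\<psi> \<in> Cb1" "\<And>x. \<psi> x \<le> \<phi> x" "I \<le> level_density \<psi> r + e / 3"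
    using L.represent_integral_le[OF c \<phi> e3] unfolding I_def surface_def by blast
  obtain \<xi> where \<xi>: "\<xi> \<in> Cb1" "\<And>x. \<xi> x \<le> 1 - \<phi> x" "q - I \<le> level_density \<xi> r + e / 3"
    using L.represent_integral_le[of "\<lambda>x. 1 - \<phi> x", OF _ _ _ e3] c \<phi> I_compl
    unfolding surface_def by (fastforce intro: continuous_intros)
  have "\<forall>\<^sub>F t in at 0. level_density \<psi> r - e / 3 < Q \<psi> t"
    unfolding Q_def using e by (intro order_tendstoD(1)[OF quotient_tendsto_Cb1[OF \<psi>(1)]]) simp
  moreover have "\<forall>\<^sub>F t in at 0. level_density \<xi> r - e / 3 < Q \<xi> t"
    unfolding Q_def using e by (intro order_tendstoD(1)[OF quotient_tendsto_Cb1[OF \<xi>(1)]]) simp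
  moreover have "\<forall>\<^sub>F t in at 0. Q (\<lambda>_. 1) t < q + e / 3"
    unfolding Q_def q_def using e
    by (intro order_tendstoD(2)[OF quotient_tendsto_Cb1[OF Cb1_const]]) simp
  ultimately show "\<forall>\<^sub>F t in at 0. dist (\<integral>x. shell r t x * \<phi> x \<partial>\<nu>) (\<integral>x. \<phi> x \<partial>surface r) < e"
  proof eventually_elim
    case (elim t)
    have "Q \<psi> t \<le> Q \<phi> t" "Q \<xi> t \<le> Q (\<lambda>x. 1 - \<phi> x) t"
      using Q_mono Cb1_subset_Cb \<psi>(1,2) \<xi>(1,2) Cb by blast+
    then have "\<bar>Q \<phi> t - I\<bar> < e"
      using elim \<psi>(3) \<xi>(3) Q_compl[of t] by (simp add: abs_less_iff)
    then show ?case by (simp add: Q_def I_def dist_real_def)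
  qed
qed

text \<open>An affine change of the values reduces the claim to functions with values in \<open>[0, 1]\<close>, because
  the quotients of the constant 1 converge to the total mass.\<close>

lemma F_int_has_derivative:
  assumes \<phi>: "\<phi> \<in> Cb"
  shows "DERIV (F_int \<nu> g \<phi>) r :> (\<integral>x. \<phi> x \<partial>surface r)"
proof -
  obtain B where B: "B > 0" "\<And>x. \<bar>\<phi> x\<bar> \<le> B" using CbD(2)[OF \<phi>] by blast
  define \<psi> where "\<psi> x = (\<phi> x + B) / (2 * B)" for x
  have c: "continuous_on UNIV \<psi>"
    unfolding \<psi>_def using B(1) by (intro continuous_intros CbD(1)[OF \<phi>]) auto
  have b: "0 \<le> \<psi> x" "\<psi> x \<le> 1" for x
    using B(1) B(2)[of x] by (auto simp: \<psi>_def field_simps abs_le_iff)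
  have \<psi>Cb: "\<psi> \<in> Cb" using c b by (auto simp: Cb_def bounded_iff intro!: exI[of _ 1])
  have Cb_one: "(\<lambda>_::'a. 1) \<in> Cb" by (rule Cb1_subset_Cb[OF Cb1_const])
  have \<phi>_eq: "\<phi> x = 2 * B * \<psi> x - B * 1" for x
    using B(1) by (simp add: \<psi>_def)
  have "((\<lambda>t. 2 * B * (\<integral>x. shell r t x * \<psi> x \<partial>\<nu>) - B * (\<integral>x. shell r t x * 1 \<partial>\<nu>)) \<longlongrightarrow>
      2 * B * (\<integral>x. \<psi> x \<partial>surface r) - B * (\<integral>x. 1 \<partial>surface r)) (at 0)"
    by (intro tendsto_diff tendsto_mult tendsto_const quotient_tendsto_unit c b) auto
  moreover have "2 * B * (\<integral>x. shell r t x * \<psi> x \<partial>\<nu>) - B * (\<integral>x. shell r t x * 1 \<partial>\<nu>)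
      = (\<integral>x. shell r t x * \<phi> x \<partial>\<nu>)" for t
  proof -
    have "(\<integral>x. shell r t x * \<phi> x \<partial>\<nu>) = (\<integral>x. 2 * B * (shell r t x * \<psi> x) - B * (shell r t x * 1) \<partial>\<nu>)"
      by (intro Bochner_Integration.integral_cong refl) (simp add: \<phi>_eq algebra_simps)
    also have "\<dots> = 2 * B * (\<integral>x. shell r t x * \<psi> x \<partial>\<nu>) - B * (\<integral>x. shell r t x * 1 \<partial>\<nu>)"
      using bounded_mult_integrable[OF Cb_one shell_measurable shell_le, of r t]
        bounded_mult_integrable[OF \<psi>Cb shell_measurable shell_le, of r t] by simp
    finally show ?thesis by simp
  qed
  moreover have "2 * B * (\<integral>x. \<psi> x \<partial>surface r) - B * (\<integral>x. 1 \<partial>surface r) = (\<integral>x. \<phi> x \<partial>surface r)"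
  proof -
    have "(\<integral>x. \<phi> x \<partial>surface r) = (\<integral>x. 2 * B * \<psi> x - B * 1 \<partial>surface r)"
      by (simp only: \<phi>_eq)
    also have "\<dots> = 2 * B * (\<integral>x. \<psi> x \<partial>surface r) - B * (\<integral>x. 1 \<partial>surface r)"
      using Cb_integrable_surface[OF \<psi>Cb, of r] Cb_integrable_surface[OF Cb_one, of r]
        finite_measure.integrable_const[OF finite_surface, of r B]
      by (subst Bochner_Integration.integral_diff) auto
    finally show ?thesis by simp
  qed
  ultimately have "((\<lambda>t. \<integral>x. shell r t x * \<phi> x \<partial>\<nu>) \<longlongrightarrow> (\<integral>x. \<phi> x \<partial>surface r)) (at 0)" by simp
  then show ?thesis by (simp add: DERIV_def F_int_quotient[OF \<phi>])
qed

lemma q1_eq: "q1 \<nu> R g r = level_density (\<lambda>_. 1) r"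
  by (simp add: q1_def level_density_def adj_one set_lebesgue_integral_def)

lemma q1_eq_mass: "q1 \<nu> R g r = measure (surface r) UNIV"
  by (simp add: q1_eq surface_mass)

lemma q1_nonneg: "0 \<le> q1 \<nu> R g r"
  by (simp add: q1_eq_mass)

lemma F_int_one_derivative: "DERIV (F_int \<nu> g (\<lambda>_. 1)) r :> q1 \<nu> R g r"
  using F_int_has_derivative[OF Cb1_subset_Cb[OF Cb1_const], of 1 r]
    sets_eq_imp_space_eq[OF sets_surface] by (simp add: q1_eq_mass)

lemma surface_nontrivial_iff: "surface r \<noteq> null_measure borel \<longleftrightarrow> 0 < measure (surface r) UNIV"
proof
  show "surface r \<noteq> null_measure borel" if "0 < measure (surface r) UNIV"
    using that by (auto simp: measure_def)
  show "0 < measure (surface r) UNIV" if "surface r \<noteq> null_measure borel"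
  proof (rule ccontr)
    interpret S: finite_measure "surface r" by (rule finite_surface)
    assume "\<not> ?thesis"
    then have "measure (surface r) UNIV = 0" using measure_nonneg[of "surface r" UNIV] by linarith
    moreover have "measure (surface r) A \<le> measure (surface r) UNIV" for A
      using S.bounded_measure[of A] sets_eq_imp_space_eq[OF sets_surface] by simp
    ultimately have "measure (surface r) A = 0" for A
      using measure_nonneg[of "surface r" A] by (metis order.antisym)
    then have "surface r = null_measure borel"
      by (intro measure_eqI) (simp_all add: sets_surface S.emeasure_eq_measure)
    then show False using that by simp
  qed
qed

section \<open>The density of \<open>g\<close>\<close>

text \<open>Only points on the level set \<open>{g = r}\<close>, a null set, prevent the indicators of \<open>g x < s\<close> from
  converging as \<open>s \<longlongrightarrow> r\<close>.\<close>

lemma q1_continuous: "continuous_on UNIV (q1 \<nu> R g)"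
proof (rule continuous_at_imp_continuous_on, intro ballI)
  fix r
  have mi: "integrable \<nu> m" using adj_integrable[of "\<lambda>_. 1" "\<lambda>_. 1" 1] by (simp add: adj_one)
  have "(q1 \<nu> R g \<longlongrightarrow> q1 \<nu> R g r) (at r)"
    unfolding tendsto_at_iff_sequentially
  proof (intro allI impI)
    fix X :: "nat \<Rightarrow> real" assume X: "X \<longlonglongrightarrow> r"
    have "(\<lambda>i. \<integral>x. indicator {x. g x < X i} x * m x \<partial>\<nu>) \<longlonglongrightarrow> (\<integral>x. indicator {x. g x < r} x * m x \<partial>\<nu>)"
    proof (rule integral_dominated_convergence[where w = "\<lambda>x. \<bar>m x\<bar>"])
      show "AE x in \<nu>. (\<lambda>i. indicator {x. g x < X i} x * m x) \<longlonglongrightarrow> indicator {x. g x < r} x * m x"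
        using AE_not_level[of r]
      proof eventually_elim
        case (elim x)
        have "\<forall>\<^sub>F i in sequentially. indicator {x. g x < X i} x = (indicator {x. g x < r} x :: real)"
        proof (cases "g x < r")
          case True
          then show ?thesis using order_tendstoD(1)[OF X True] by (auto elim!: eventually_mono)
        next
          case False
          then have "r < g x" using elim by simp
          from order_tendstoD(2)[OF X this] show ?thesis
            by eventually_elim (use False in auto)
        qed
        then show ?case by (intro tendsto_mult tendsto_const tendsto_eventually)
      qed
      show "AE x in \<nu>. norm (indicator {x. g x < X i} x * m x) \<le> \<bar>m x\<bar>" for i
        by (intro AE_I2) (auto simp: indicator_def)
    qed (use mi in simp_all)
    then show "(q1 \<nu> R g \<circ> X) \<longlonglongrightarrow> q1 \<nu> R g r"
      unfolding comp_def q1_eq level_density_def adj_one by (rule tendsto_minus)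
  qed
  then show "isCont (q1 \<nu> R g) r" by (simp add: isCont_def)
qed

text \<open>The distribution function of \<open>g\<close> is \<open>F_int \<nu> g (\<lambda>_. 1)\<close>, with derivative \<open>q1\<close> everywhere; the
  fundamental theorem of calculus on \<open>[r, \<infinity>)\<close> identifies the tails.\<close>

lemma distr_eq_density: "distr \<nu> borel g = density lborel (\<lambda>r. ennreal (q1 \<nu> R g r))"
proof (rule measure_eqI_lessThan)
  interpret D: real_distribution "distr \<nu> borel g"
    by (rule real_distribution_distr) simp
  have F: "F_int \<nu> g (\<lambda>_. 1) = cdf (distr \<nu> borel g)"
    by (rule ext) (simp add: F_int_eq cdf_def measure_distr vimage_def)
  have [measurable]: "q1 \<nu> R g \<in> borel_measurable borel"
    by (rule borel_measurable_continuous_onI[OF q1_continuous])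
  fix r
  show "emeasure (distr \<nu> borel g) {r<..} < \<infinity>" by (simp add: less_top[symmetric])
  have "emeasure (distr \<nu> borel g) {r<..} = ennreal (1 - cdf (distr \<nu> borel g) r)"
  proof -
    have "{r<..} = space (distr \<nu> borel g) - {..r}" by auto
    then show ?thesis
      using D.prob_compl[of "{..r}"] by (simp add: D.emeasure_eq_measure cdf_def)
  qed
  also have "\<dots> = (\<integral>\<^sup>+x. ennreal (q1 \<nu> R g x) * indicator {r..} x \<partial>lborel)"
    using F_int_one_derivative D.cdf_lim_at_top_prob
    by (intro nn_integral_FTC_atLeast[symmetric] q1_nonneg) (simp_all add: F[symmetric])
  also have "\<dots> = (\<integral>\<^sup>+x. ennreal (q1 \<nu> R g x) * indicator {r<..} x \<partial>lborel)"
    using AE_lborel_singleton[of r]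
    by (intro nn_integral_cong_AE) (auto elim!: eventually_mono simp: indicator_def)
  also have "\<dots> = emeasure (density lborel (\<lambda>r. ennreal (q1 \<nu> R g r))) {r<..}"
    by (simp add: emeasure_density)
  finally show "emeasure (distr \<nu> borel g) {r<..} = emeasure (density lborel (\<lambda>r. ennreal (q1 \<nu> R g r))) {r<..}" .
qed simp_all

end

theorem theorem3p3:
  fixes \<nu> :: "'a::{real_inner, banach, second_countable_topology} measure"
    and R :: "'a \<Rightarrow> 'a"
    and g :: "'a \<Rightarrow> real"
  assumes infdim: "infinite_dimensional TYPE('a)"
    and prob: "prob_space \<nu>"
    and sets_nu: "sets \<nu> = sets borel"
    and nondeg: "nondegenerate \<nu>"
    and R: "bounded_linear R"
    and closable: "\<And>p. p > 1 \<Longrightarrow> closable_graph \<nu> p (Rgrad R)"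
    and g_borel: "g \<in> borel_measurable borel"
    and g_W1: "\<And>p. p > 1 \<Longrightarrow> g \<in> W1 \<nu> R p"
    and Mg_nonzero: "AE x in \<nu>. Mop \<nu> R g x \<noteq> 0"
    and field_dom: "\<And>p. p > 1 \<Longrightarrow> normal_field \<nu> R g \<in> Mp_adj_dom \<nu> R p"
  shows "(\<forall>\<phi> \<in> Cb. \<forall>r. F_int \<nu> g \<phi> differentiable (at r)) \<and>
         continuous_on UNIV (q1 \<nu> R g) \<and>
         (\<forall>r. q1 \<nu> R g r \<ge> 0) \<and>
         distr \<nu> borel g = density lborel (\<lambda>r. ennreal (q1 \<nu> R g r)) \<and>
         (\<forall>r. \<exists>\<sigma> :: 'a measure.
            sets \<sigma> = sets borel \<and> finite_measure \<sigma> \<and>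
            (\<forall>\<phi> \<in> Cb. deriv (F_int \<nu> g \<phi>) r = (\<integral>x. \<phi> x \<partial>\<sigma>)) \<and>
            measure \<sigma> UNIV = deriv (F_int \<nu> g (\<lambda>_. 1)) r \<and>
            deriv (F_int \<nu> g (\<lambda>_. 1)) r = q1 \<nu> R g r \<and>
            (\<sigma> \<noteq> null_measure borel \<longleftrightarrow> deriv (F_int \<nu> g (\<lambda>_. 1)) r > 0))"
proof -
  interpret level_function \<nu> R g
    by (intro level_function.intro gradient_operator.intro gradient_operator_axioms.intro
        level_function_axioms.intro prob sets_nu R closable g_borel g_W1 Mg_nonzero field_dom)
  have d1: "deriv (F_int \<nu> g (\<lambda>_. 1)) r = q1 \<nu> R g r" for r
    by (rule DERIV_imp_deriv[OF F_int_one_derivative])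
  show ?thesis
  proof (intro conjI ballI allI)
    show "F_int \<nu> g \<phi> differentiable (at r)" if "\<phi> \<in> Cb" for \<phi> r
      using F_int_has_derivative[OF that] real_differentiable_def by blast
    show "continuous_on UNIV (q1 \<nu> R g)" by (rule q1_continuous)
    show "q1 \<nu> R g r \<ge> 0" for r by (rule q1_nonneg)
    show "distr \<nu> borel g = density lborel (\<lambda>r. ennreal (q1 \<nu> R g r))" by (rule distr_eq_density)
    fix r
    have "deriv (F_int \<nu> g \<phi>) r = (\<integral>x. \<phi> x \<partial>surface r)" if "\<phi> \<in> Cb" for \<phi>
      by (rule DERIV_imp_deriv[OF F_int_has_derivative[OF that]])
    then show "\<exists>\<sigma> :: 'a measure.
            sets \<sigma> = sets borel \<and> finite_measure \<sigma> \<and>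
            (\<forall>\<phi> \<in> Cb. deriv (F_int \<nu> g \<phi>) r = (\<integral>x. \<phi> x \<partial>\<sigma>)) \<and>
            measure \<sigma> UNIV = deriv (F_int \<nu> g (\<lambda>_. 1)) r \<and>
            deriv (F_int \<nu> g (\<lambda>_. 1)) r = q1 \<nu> R g r \<and>
            (\<sigma> \<noteq> null_measure borel \<longleftrightarrow> deriv (F_int \<nu> g (\<lambda>_. 1)) r > 0)"
      by (intro exI[of _ "surface r"])
        (simp add: sets_surface finite_surface d1 q1_eq_mass surface_nontrivial_iff)
  qed
qed

end
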